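(* Consider a Gaussian relay network with interference on a directed graph $\mathcal{G}=(V,E)$ with source $s=1$ and destination set $D$, with per-edge average power constraints $P_{u,v}\ge 0$, $(u,v)\in E$ (all notions as defined in the context). Then: (i) the multicast capacity is at most $$\min_{S\in\Gamma}\sum_{v\in\bar S^c} C\!\left(\Big(\sum_{u\in\Delta_S(v)}\sqrt{P_{u,v}}\Big)^2\right),\qquad C(x)=\tfrac12\log(1+x);$$ (ii) every multicast rate $R$ strictly smaller than $$\min_{S\in\Gamma}\sum_{v\in\bar S^c}\left[\frac12\log\left(\Big(\frac{1}{\sum_{u\in\Delta(v)}P_{u,v}}+1\Big)\cdot\max_{u\in\Delta_S(v)}P_{u,v}\right)\right]^+$$ is achievable, where $[x]^+=\max\{x,0\}$; (iii) the upper bound in (i) minus the quantity in (ii) is at most $\sum_{v\in V\setminus\{1\}}\log|\Delta(v)|$.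
   Context: All logarithms are base 2. The network is a directed graph $\mathcal{G}=(V,E)$, $V=\{1,\dots,|V|\}$, $E\subseteq V\times V$. Node $1$ is the source $s$; $D\subseteq V\setminus\{1\}$ is the set of destinations; the source has no incoming edges and destinations have no outgoing edges. For $v\in V$, $\Delta(v)=\{u:(u,v)\in E\}$. Each edge $(u,v)$ carries a real channel input $X_{u,v}^{(t)}$ at time $t$ (outgoing channels of a node are orthogonal), and each node $v\neq 1$ receives $Y_v^{(t)}=\sum_{u\in\Delta(v)}X_{u,v}^{(t)}+Z_v^{(t)}$, where the $Z_v^{(t)}$ are i.i.d. $\mathcal N(0,1)$, independent over $v$ and $t$. Each edge input satisfies the average power constraint $\frac1n\sum_{t=1}^n (X_{u,v}^{(t)})^2\le P_{u,v}$ over each block of $n$ channel uses. A code of block length $N$ consists of a message $W$ uniform on $\{1,\dots,M\}$, source encoders $X_{s,w}^{(t)}=f_{s,w}^{(t)}(W)$, relay encoders $X_{v,w}^{(t)}=f_{v,w}^{(t)}(Y_v^{(1)},\dots,Y_v^{(t-1)})$ for $(v,w)\in E$, and decoders $\hat W=g_d(Y_d^{(1)},\dots,Y_d^{(N)})$ at each $d\in D$; its error probability is $P_e=\Pr\{\bigcup_{d\in D}\{g_d(Y_d^N)\neq W\}\}$. A rate $R$ is achievable if for every $\epsilon>0$ and all sufficiently large $N$ there are codes with $M\ge 2^{NR}$ and $P_e\le\epsilon$; the multicast capacity is the supremum of achievable rates. A cut is a set $S\subset V$ with $s\in S$ and $S^c\cap D\neq\emptyset$; $\Gamma$ is the set of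 all cuts. For a cut $S$: $\bar S^c=\{v\in S^c:\exists u\in S,\ (u,v)\in E\}$ and $\Delta_S(v)=\Delta(v)\cap S$.
   Formalization: D is assumed nonempty (else the minimum over cuts is undefined); in (iii) the sum runs only over nodes with at least one incoming edge, since log 0 is undefined; in (ii) a term whose maximum power over Δ_S(v) is 0 counts as 0. *)

theory Defs
  imports "HOL-Probability.Probability"
begin

definition nodes :: "nat \<Rightarrow> nat set" where
  "nodes nV = {1..nV}"

definition inn :: "(nat \<times> nat) set \<Rightarrow> nat \<Rightarrow> nat set" where
  "inn E v = {u. (u, v) \<in> E}"

definition gaussian_network :: "nat \<Rightarrow> (nat \<times> nat) set \<Rightarrow> nat set \<Rightarrow> bool" where
  "gaussian_network nV E D \<longleftrightarrow>
     E \<subseteq> nodes nV \<times> nodes nV \<and>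
     D \<subseteq> nodes nV - {1} \<and> D \<noteq> {} \<and>
     (\<forall>u. (u, 1) \<notin> E) \<and>
     (\<forall>d\<in>D. \<forall>w. (d, w) \<notin> E)"

(* Channel input on edge (u,v) at time t, given message m and the history H of
   received signals (H u t = Y_u^(t)).  src v t m = f_{1,v}^(t)(m);
   enc u v t y = f_{u,v}^(t)(Y_u^(1..t-1)), y being the extensional function on {1..<t}. *)
definition chan_in ::
  "(nat \<Rightarrow> nat \<Rightarrow> nat \<Rightarrow> real) \<Rightarrow> (nat \<Rightarrow> nat \<Rightarrow> nat \<Rightarrow> (nat \<Rightarrow> real) \<Rightarrow> real)
   \<Rightarrow> nat \<Rightarrow> (nat \<Rightarrow> nat \<Rightarrow> real) \<Rightarrow> nat \<Rightarrow> nat \<Rightarrow> nat \<Rightarrow> real" where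
  "chan_in src enc m H u v t =
     (if u = 1 then src v t m else enc u v t (restrict (H u) {1..<t}))"

(* hist ... k v t = Y_v^(t) for t \<le> k (and 0 otherwise); z (v,t) = Z_v^(t). *)
fun hist ::
  "(nat \<times> nat) set \<Rightarrow> (nat \<Rightarrow> nat \<Rightarrow> nat \<Rightarrow> real) \<Rightarrow> (nat \<Rightarrow> nat \<Rightarrow> nat \<Rightarrow> (nat \<Rightarrow> real) \<Rightarrow> real)
   \<Rightarrow> nat \<Rightarrow> (nat \<times> nat \<Rightarrow> real) \<Rightarrow> nat \<Rightarrow> nat \<Rightarrow> nat \<Rightarrow> real" where
  "hist E src enc m z 0 = (\<lambda>v t. 0)"
| "hist E src enc m z (Suc k) = (\<lambda>v t.
     if t \<le> k then hist E src enc m z k v t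
     else if t = Suc k then
       (\<Sum>u\<in>inn E v. chan_in src enc m (hist E src enc m z k) u v t) + z (v, t)
     else 0)"

definition received where
  "received E src enc m z v t = hist E src enc m z t v t"

definition chan_input where
  "chan_input E src enc m z u v t = chan_in src enc m (hist E src enc m z t) u v t"

definition noise :: "nat \<Rightarrow> nat \<Rightarrow> (nat \<times> nat \<Rightarrow> real) measure" where
  "noise nV N = PiM ((nodes nV - {1}) \<times> {1..N}) (\<lambda>_. density lborel std_normal_density)"

definition valid_code ::
  "nat \<Rightarrow> (nat \<times> nat) set \<Rightarrow> nat set \<Rightarrow> (nat \<times> nat \<Rightarrow> real) \<Rightarrow> nat \<Rightarrow> nat
   \<Rightarrow> (nat \<Rightarrow> nat \<Rightarrow> nat \<Rightarrow> real) \<Rightarrow> (nat \<Rightarrow> nat \<Rightarrow> nat \<Rightarrow> (nat \<Rightarrow> real) \<Rightarrow> real)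
   \<Rightarrow> (nat \<Rightarrow> (nat \<Rightarrow> real) \<Rightarrow> nat) \<Rightarrow> bool" where
  "valid_code nV E D P N M src enc dec \<longleftrightarrow>
     M \<ge> 1 \<and>
     (\<forall>u w t. (u, w) \<in> E \<and> u \<noteq> 1 \<and> t \<in> {1..N} \<longrightarrow>
        enc u w t \<in> borel_measurable (PiM {1..<t} (\<lambda>_. borel))) \<and>
     (\<forall>d\<in>D. dec d \<in> measurable (PiM {1..N} (\<lambda>_. borel)) (count_space UNIV)) \<and>
     (\<forall>m\<in>{1..M}. \<forall>z\<in>space (noise nV N). \<forall>u w. (u, w) \<in> E \<longrightarrow>
        (\<Sum>t=1..N. (chan_input E src enc m z u w t)\<^sup>2) / real N \<le> P (u, w))"

definition error_prob where
  "error_prob nV E D N M src enc dec =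
     (\<Sum>m=1..M. measure (noise nV N)
        {z \<in> space (noise nV N). \<exists>d\<in>D.
           dec d (restrict (received E src enc m z d) {1..N}) \<noteq> m}) / real M"

definition achievable ::
  "nat \<Rightarrow> (nat \<times> nat) set \<Rightarrow> nat set \<Rightarrow> (nat \<times> nat \<Rightarrow> real) \<Rightarrow> real \<Rightarrow> bool" where
  "achievable nV E D P R \<longleftrightarrow>
     (\<forall>\<epsilon>>0. \<exists>N0. \<forall>N\<ge>N0. \<exists>M src enc dec.
        valid_code nV E D P N M src enc dec \<and>
        real M \<ge> 2 powr (real N * R) \<and>
        error_prob nV E D N M src enc dec \<le> \<epsilon>)"

definition multicast_capacity where
  "multicast_capacity nV E D P = Sup {R. achievable nV E D P R}"

definition cuts :: "nat \<Rightarrow> nat set \<Rightarrow> nat set set" where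
  "cuts nV D = {S. S \<subseteq> nodes nV \<and> 1 \<in> S \<and> (nodes nV - S) \<inter> D \<noteq> {}}"

definition cut_front :: "nat \<Rightarrow> (nat \<times> nat) set \<Rightarrow> nat set \<Rightarrow> nat set" where
  "cut_front nV E S = {v \<in> nodes nV - S. \<exists>u\<in>S. (u, v) \<in> E}"

definition Cfun :: "real \<Rightarrow> real" where
  "Cfun x = 1/2 * log 2 (1 + x)"

definition upper_bound where
  "upper_bound nV E D P =
     Min ((\<lambda>S. \<Sum>v\<in>cut_front nV E S.
              Cfun ((\<Sum>u\<in>inn E v \<inter> S. sqrt (P (u, v)))\<^sup>2)) ` cuts nV D)"

(* [ 1/2 log((1/sum_{u in Delta(v)} P + 1) * max_{u in Delta_S(v)} P) ]^+, with [log 0]^+ = 0 *)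
definition lb_term where
  "lb_term E P S v =
     (let Mx = Max ((\<lambda>u. P (u, v)) ` (inn E v \<inter> S)) in
      if Mx = 0 then 0
      else max 0 (1/2 * log 2 ((1 / (\<Sum>u\<in>inn E v. P (u, v)) + 1) * Mx)))"

definition lower_bound where
  "lower_bound nV E D P =
     Min ((\<lambda>S. \<Sum>v\<in>cut_front nV E S. lb_term E P S v) ` cuts nV D)"

end

theory Submission
  imports Defs
begin

text \<open>
  Converse: fix a cut \<open>S\<close> and let \<open>Q\<close> make the signals that cross it independent Gaussians whose
  variance at receiver \<open>v\<close> is \<open>1 + (\<Sum> sqrt P)\<^sup>2\<close>. The decoder is a function of these signals that
  does not depend on the message, so under \<open>Q\<close> it guesses right with average probability at most
  \<open>1 / M\<close>; the divergence of the true law from \<open>Q\<close> is at most \<open>N\<close> times the value of the cut.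

  Achievability: no lattices are needed. Each receiver decodes the real sum of its incoming
  codewords. The codewords of the edge \<open>(u, v)\<close> are the points \<open>x\<close> of a fine cubic grid with
  \<open>\<bar>x\<bar>\<^sup>2 \<le> n P\<close> that lie in one coset of a random linear hash \<open>x \<mapsto> \<Sum> h\<^sub>i x\<^sub>i mod q\<close>, the same hash for
  all edges into \<open>v\<close>. The hash of the sum is then known, and after MMSE scaling the residual noise has power
  \<open>s / (1 + s)\<close> with \<open>s = \<Sum> P\<close>, so the sum is decodable once there are fewer than \<open>q\<close> grid points in
  the noise ball; this leaves \<open>(P (1 + s) / s) ^ (n / 2)\<close> codewords on the edge. Fixing all summands but
  one, the sum determines the remaining one. Hence random relaying over these noiseless sum channels
  distinguishes any two messages unless all receivers in the front of some cut see a collision,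
  which gives the cut value with the maximum over \<open>u\<close>.
\<close>

section \<open>The gap between the bounds\<close>

text \<open>A single tuple of codewords may add up to far more power than \<open>s\<close>, so no
  individual tuple is guaranteed to be decodable. Every error bound is therefore an average over
  uniform tuples: the symmetry of the ball under sign flips and coordinate swaps makes the cross
  terms small, in place of a dither. Random relay functions fit this, since the tuple that reaches a
  receiver is read off at distinct independent entries and is again uniform.

  Relaying is controlled by a potential on message pairs, with p = 2^(-n \<kappa>) bounding the
  collision probability of every cut. After B blocks at most M^2 (4p)^B / p^|V| messages are
  confused. The |V| lost blocks and the factor 4^B are harmless because B is fixed first and n grows
  afterwards.

  In the converse the power constraint holds for every noise realisation, so the quadratic term of
  the log-likelihood ratio is bounded pointwise and only terms with an explicit mean remain. The
  role of Fano's inequality is taken by ln x <= x - 1 at a mixed weight, at the price of an additive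
  ln 2.\<close>

lemma finite_inn:
  assumes "gaussian_network nV E D"
  shows "finite (inn E v)"
proof (rule finite_subset)
  show "inn E v \<subseteq> nodes nV" using assms by (auto simp: gaussian_network_def inn_def)
qed (simp add: nodes_def)

lemma finite_cuts: "finite (cuts nV D)"
  by (rule finite_subset[of _ "Pow (nodes nV)"]) (auto simp: cuts_def nodes_def)

lemma cuts_nonempty:
  assumes "gaussian_network nV E D"
  shows "cuts nV D \<noteq> {}"
proof -
  obtain d where "d \<in> D" "d \<in> nodes nV" "d \<noteq> 1" using assms by (auto simp: gaussian_network_def)
  then have "{1} \<in> cuts nV D" by (auto simp: cuts_def nodes_def)
  then show ?thesis by auto
qed

lemma finite_cut_front: "finite (cut_front nV E S)"
  by (simp add: cut_front_def nodes_def)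

text \<open>Coherent addition of k signals yields at most k^2 times the strongest power
  \<open>Mx\<close>, so it suffices that \<open>1 + k^2 * Mx \<le> K^2 * max 1 c\<close>, where
  \<open>K\<close> counts all in-neighbours. If the cut contains all of them,
  \<open>s \<le> K * Mx\<close> and the summand \<open>Mx / s\<close> of \<open>c\<close> pays for
  the 1. Otherwise \<open>k + 1 \<le> K\<close>, and K^2 - k^2 pays for it.\<close>

lemma Cfun_minus_lb_term_le:
  assumes fin: "finite (inn E v)" and ne: "inn E v \<inter> S \<noteq> {}"
    and P: "\<forall>e\<in>E. P e \<ge> 0"
  shows "Cfun ((\<Sum>u\<in>inn E v \<inter> S. sqrt (P (u, v)))\<^sup>2) - lb_term E P S v
           \<le> log 2 (real (card (inn E v)))"
proof -
  define A where "A = inn E v \<inter> S"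
  define Mx where "Mx = Max ((\<lambda>u. P (u, v)) ` A)"
  define s where "s = (\<Sum>u\<in>inn E v. P (u, v))"
  define k where "k = real (card A)"
  define K where "K = real (card (inn E v))"
  define c where "c = (1 / s + 1) * Mx"
  have P0: "P (u, v) \<ge> 0" if "u \<in> inn E v" for u using P that by (auto simp: inn_def)
  have finA: "finite A" and neA: "A \<noteq> {}" and sub: "A \<subseteq> inn E v" using fin ne by (auto simp: A_def)
  have PM: "P (u, v) \<le> Mx" if "u \<in> A" for u using that finA by (auto simp: Mx_def)
  have "Mx \<in> (\<lambda>u. P (u, v)) ` A" unfolding Mx_def using finA neA by (intro Max_in) auto
  then obtain u0 where u0: "u0 \<in> A" "Mx = P (u0, v)" by auto
  have Mx0: "Mx \<ge> 0" using P0 u0 sub by auto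
  have k1: "k \<ge> 1" using finA neA by (simp add: k_def Suc_le_eq card_gt_0_iff)
  have kK: "k \<le> K" unfolding k_def K_def using card_mono[OF fin sub] by simp
  have "(\<Sum>u\<in>A. sqrt (P (u, v))) \<le> (\<Sum>u\<in>A. sqrt Mx)" by (intro sum_mono) (simp add: PM)
  also have "\<dots> = k * sqrt Mx" by (simp add: k_def)
  finally have "(\<Sum>u\<in>A. sqrt (P (u, v)))\<^sup>2 \<le> (k * sqrt Mx)\<^sup>2"
    by (intro power_mono sum_nonneg) (use P0 sub in auto)
  then have sq: "(\<Sum>u\<in>A. sqrt (P (u, v)))\<^sup>2 \<le> k\<^sup>2 * Mx" using Mx0 by (simp add: power_mult_distrib)
  have le: "1 + k\<^sup>2 * Mx \<le> K\<^sup>2 * max 1 c" if "Mx > 0"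
  proof -
    have s_ge: "s \<ge> Mx" unfolding s_def u0(2) using u0(1) sub fin P0 by (intro member_le_sum) auto
    then have s0: "s > 0" using that by simp
    have cM: "c \<ge> Mx" using that s0 by (simp add: c_def field_simps)
    show ?thesis
    proof (cases "A = inn E v")
      case True
      then have kK: "k = K" by (simp add: k_def K_def)
      have "s \<le> (\<Sum>u\<in>inn E v. Mx)" unfolding s_def by (intro sum_mono) (use PM True in auto)
      then have "s \<le> K * Mx" by (simp add: K_def)
      then have "Mx / s \<ge> 1 / K" using s0 k1 kK by (simp add: field_simps)
      then have "c \<ge> Mx + 1 / K" by (simp add: c_def algebra_simps)
      then have "K\<^sup>2 * c \<ge> K\<^sup>2 * (Mx + 1 / K)" by (intro mult_left_mono) auto
      also have "K\<^sup>2 * (Mx + 1 / K) = K\<^sup>2 * Mx + K" using k1 kK by (simp add: field_simps power2_eq_square)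
      finally have "1 + k\<^sup>2 * Mx \<le> K\<^sup>2 * c" using k1 kK by simp
      also have "\<dots> \<le> K\<^sup>2 * max 1 c" by (intro mult_left_mono) auto
      finally show ?thesis .
    next
      case False
      then have "card A < card (inn E v)" using sub fin by (intro psubset_card_mono) auto
      then have "k + 1 \<le> K" by (simp add: k_def K_def)
      then have "(k + 1)\<^sup>2 \<le> K\<^sup>2" using k1 by (intro power_mono) auto
      then have kk: "1 + k\<^sup>2 \<le> K\<^sup>2" using k1 by (simp add: power2_eq_square algebra_simps)
      have "1 + k\<^sup>2 * Mx \<le> max 1 c + k\<^sup>2 * max 1 c" using cM by (intro add_mono mult_left_mono) auto
      also have "\<dots> = (1 + k\<^sup>2) * max 1 c" by (simp add: algebra_simps)
      also have "\<dots> \<le> K\<^sup>2 * max 1 c" using kk by (intro mult_right_mono) auto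
      finally show ?thesis .
    qed
  qed
  have logK: "log 2 K \<ge> 0" using k1 kK by simp
  show ?thesis
  proof (cases "Mx = 0")
    case True
    then have "(\<Sum>u\<in>A. sqrt (P (u, v)))\<^sup>2 = 0"
      using sq zero_le_power2[of "\<Sum>u\<in>A. sqrt (P (u, v))"] by simp
    then show ?thesis using True logK
      by (simp add: lb_term_def Cfun_def A_def[symmetric] Mx_def[symmetric] K_def)
  next
    case False
    then have M: "Mx > 0" using Mx0 by simp
    have "Cfun ((\<Sum>u\<in>A. sqrt (P (u, v)))\<^sup>2) \<le> 1/2 * log 2 (K\<^sup>2 * max 1 c)"
      unfolding Cfun_def using sq le[OF M]
      by (intro mult_left_mono log_mono) (auto intro: add_pos_nonneg)
    also have "\<dots> = log 2 K + 1/2 * log 2 (max 1 c)"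
      using k1 kK by (simp add: log_mult log_nat_power)
    also have "1/2 * log 2 (max 1 c) \<le> max 0 (1/2 * log 2 c)"
      by (auto simp: max_def)
    finally show ?thesis using False
      by (simp add: lb_term_def Let_def A_def[symmetric] Mx_def[symmetric] K_def c_def s_def[symmetric])
  qed
qed

text \<open>Both bounds are compared at a cut that attains the lower one, which reduces the gap to
  the receivers in its front. Receivers outside the front only add nonnegative logarithms.\<close>

lemma upper_bound_minus_lower_bound:
  assumes net: "gaussian_network nV E D" and P: "\<forall>e\<in>E. P e \<ge> 0"
  shows "upper_bound nV E D P - lower_bound nV E D P
           \<le> (\<Sum>v\<in>{v \<in> nodes nV - {1}. inn E v \<noteq> {}}. log 2 (real (card (inn E v))))"
proof -
  let ?lb = "\<lambda>S. \<Sum>v\<in>cut_front nV E S. lb_term E P S v"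
  let ?ub = "\<lambda>S. \<Sum>v\<in>cut_front nV E S. Cfun ((\<Sum>u\<in>inn E v \<inter> S. sqrt (P (u, v)))\<^sup>2)"
  let ?V = "{v \<in> nodes nV - {1}. inn E v \<noteq> {}}"
  have "lower_bound nV E D P \<in> ?lb ` cuts nV D"
    unfolding lower_bound_def using finite_cuts cuts_nonempty[OF net] by (intro Min_in) auto
  then obtain S where S: "S \<in> cuts nV D" "lower_bound nV E D P = ?lb S" by auto
  have sub: "cut_front nV E S \<subseteq> ?V" using S(1) by (auto simp: cut_front_def cuts_def inn_def)
  have "upper_bound nV E D P \<le> ?ub S"
    unfolding upper_bound_def using S(1) finite_cuts by (intro Min_le) auto
  then have "upper_bound nV E D P - lower_bound nV E D P \<le> ?ub S - ?lb S" using S(2) by simp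
  also have "\<dots> = (\<Sum>v\<in>cut_front nV E S. Cfun ((\<Sum>u\<in>inn E v \<inter> S. sqrt (P (u, v)))\<^sup>2) - lb_term E P S v)"
    by (simp add: sum_subtractf)
  also have "\<dots> \<le> (\<Sum>v\<in>cut_front nV E S. log 2 (real (card (inn E v))))"
    by (intro sum_mono Cfun_minus_lb_term_le finite_inn[OF net] P) (auto simp: cut_front_def inn_def)
  also have "\<dots> \<le> (\<Sum>v\<in>?V. log 2 (real (card (inn E v))))"
  proof (intro sum_mono2 sub)
    fix v assume "v \<in> ?V - cut_front nV E S"
    then have "card (inn E v) \<ge> 1" using finite_inn[OF net, of v] by (simp add: Suc_le_eq card_gt_0_iff)
    then show "0 \<le> log 2 (real (card (inn E v)))" by simp
  qed (simp add: nodes_def)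
  finally show ?thesis .
qed

section \<open>Counting grid points\<close>

lemma sum_PiE_insert:
  fixes F :: "('a \<Rightarrow> 'b) \<Rightarrow> real"
  assumes "u \<notin> U"
  shows "(\<Sum>x\<in>PiE (insert u U) T. F x) = (\<Sum>y\<in>PiE U T. \<Sum>t\<in>T u. F (y(u := t)))"
proof -
  have "(\<Sum>x\<in>PiE (insert u U) T. F x) = (\<Sum>(t, y)\<in>T u \<times> PiE U T. F (y(u := t)))"
    unfolding PiE_insert_eq using inj_combinator[OF assms]
    by (subst sum.reindex) (auto simp: case_prod_unfold)
  also have "\<dots> = (\<Sum>y\<in>PiE U T. \<Sum>t\<in>T u. F (y(u := t)))"
    by (subst sum.cartesian_product[symmetric], rule sum.swap)
  finally show ?thesis .
qed

text \<open>Resampling coordinate \<open>u\<close> of a uniform tuple leaves it uniform. The next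
  lemma uses this as a tower rule: an average is bounded through its conditional averages given the
  other coordinates.\<close>

lemma sum_PiE_update:
  fixes F :: "('a \<Rightarrow> 'b) \<Rightarrow> real"
  assumes "u \<in> U"
  shows "real (card (T u)) * (\<Sum>x\<in>PiE U T. F x) = (\<Sum>x\<in>PiE U T. \<Sum>t\<in>T u. F (x(u := t)))"
proof -
  have U: "U = insert u (U - {u})" and u: "u \<notin> U - {u}" using assms by auto
  show ?thesis
    by (subst (1 2) U, subst (1 2) sum_PiE_insert[OF u]) (simp add: sum_distrib_left)
qed

lemma sum_PiE_le:
  fixes F :: "('a \<Rightarrow> 'b) \<Rightarrow> real"
  assumes "u \<in> U" "finite (T u)" "T u \<noteq> {}"
    and le: "\<And>x. x \<in> PiE U T \<Longrightarrow> (\<Sum>t\<in>T u. F (x(u := t))) \<le> real (card (T u)) * C"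
  shows "(\<Sum>x\<in>PiE U T. F x) \<le> real (card (PiE U T)) * C"
proof -
  have "real (card (T u)) * (\<Sum>x\<in>PiE U T. F x) \<le> (\<Sum>x\<in>PiE U T. real (card (T u)) * C)"
    unfolding sum_PiE_update[of u U T F, OF assms(1)] by (intro sum_mono le)
  also have "\<dots> = real (card (T u)) * (real (card (PiE U T)) * C)" by simp
  finally show ?thesis using assms by (subst (asm) mult_le_cancel_left_pos) (auto simp: card_gt_0_iff)
qed

text \<open>Padding with zeros beyond \<open>n\<close> makes sums and differences of points stay in
  the set and turns equality of vectors into equality of functions.\<close>

definition int_vecs :: "nat \<Rightarrow> (nat \<Rightarrow> int) set" where
  "int_vecs n = {x. \<forall>i\<ge>n. x i = 0}"

definition grid_ball :: "nat \<Rightarrow> real \<Rightarrow> real \<Rightarrow> (nat \<Rightarrow> real) \<Rightarrow> (nat \<Rightarrow> int) set" where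
  "grid_ball n g \<rho> y = {x \<in> int_vecs n. (\<Sum>i<n. (g * real_of_int (x i) - y i)\<^sup>2) \<le> \<rho>}"

lemma int_vecs_eqI: "x \<in> int_vecs n \<Longrightarrow> y \<in> int_vecs n \<Longrightarrow> (\<And>i. i < n \<Longrightarrow> x i = y i) \<Longrightarrow> x = y"
  by (rule ext, metis (mono_tags, lifting) int_vecs_def linorder_not_less mem_Collect_eq)

lemma grid_ball_coord:
  assumes "x \<in> grid_ball n g \<rho> y" "i < n"
  shows "\<bar>g * real_of_int (x i) - y i\<bar> \<le> sqrt \<rho>"
proof -
  have "(g * real_of_int (x i) - y i)\<^sup>2 \<le> (\<Sum>i<n. (g * real_of_int (x i) - y i)\<^sup>2)"
    using assms(2) by (intro member_le_sum) auto
  also have "\<dots> \<le> \<rho>" using assms(1) by (simp add: grid_ball_def)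
  finally show ?thesis by (simp add: real_le_rsqrt)
qed

text \<open>Subtracting the integer parts of \<open>y i / g\<close> moves every ball into one fixed
  finite box. The bound is uniform in the centre, so a largest cardinality exists although there are
  infinitely many centres.\<close>

lemma grid_ball_card_bounded:
  assumes g: "g > 0"
  shows "\<exists>K. \<forall>y. finite (grid_ball n g \<rho> y) \<and> card (grid_ball n g \<rho> y) \<le> K"
proof -
  define L where "L = \<lceil>sqrt \<rho> / g\<rceil> + 1"
  define B where "B = {f::nat \<Rightarrow> int. \<forall>i. (i \<in> {..<n} \<longrightarrow> f i \<in> {-L..L}) \<and> (i \<notin> {..<n} \<longrightarrow> f i = 0)}"
  have finB: "finite B" unfolding B_def by (rule finite_set_of_finite_funs) auto
  have "finite (grid_ball n g \<rho> y) \<and> card (grid_ball n g \<rho> y) \<le> card B" for y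
  proof -
    define F where "F = (\<lambda>(x::nat \<Rightarrow> int) i. if i < n then x i - \<lfloor>y i / g\<rfloor> else 0)"
    have inj: "inj_on F (grid_ball n g \<rho> y)"
    proof (rule inj_onI)
      fix x x' assume *: "x \<in> grid_ball n g \<rho> y" "x' \<in> grid_ball n g \<rho> y" "F x = F x'"
      show "x = x'"
      proof (rule int_vecs_eqI)
        fix i assume "i < n"
        then show "x i = x' i" using fun_cong[OF *(3), of i] by (simp add: F_def)
      qed (use * in \<open>auto simp: grid_ball_def\<close>)
    qed
    have sub: "F ` grid_ball n g \<rho> y \<subseteq> B"
    proof (rule image_subsetI)
      fix x assume x: "x \<in> grid_ball n g \<rho> y"
      have "F x i \<in> {-L..L}" if "i < n" for i
      proof -
        have "\<bar>real_of_int (x i) - y i / g\<bar> \<le> sqrt \<rho> / g"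
          using grid_ball_coord[OF x that] g by (simp add: field_simps abs_le_iff)
        then have "-L \<le> x i - \<lfloor>y i / g\<rfloor>" "x i - \<lfloor>y i / g\<rfloor> \<le> L" unfolding L_def by linarith+
        then show ?thesis using that by (simp add: F_def)
      qed
      then show "F x \<in> B" by (auto simp: B_def F_def)
    qed
    show ?thesis
      using inj_on_finite[OF inj sub finB] card_inj_on_le[OF inj sub finB] by blast
  qed
  then show ?thesis by blast
qed

lemma finite_grid_ball: "g > 0 \<Longrightarrow> finite (grid_ball n g \<rho> y)"
  using grid_ball_card_bounded by blast

text \<open>Scale the ball around \<open>y\<close> by the rational \<open>a / b\<close>: split every unit cell into \<open>a\<^sup>n\<close> cells,
  then merge \<open>b\<^sup>n\<close> cells into one.\<close>
lemma grid_ball_scale: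
  fixes a b :: nat
  assumes g: "g > 0" and a: "a > 0" and b: "b > 0" and N0: "Nn \<ge> 0" and P0: "P \<ge> 0"
    and le: "(a / b) * sqrt Nn + g * (a / b + 1) \<le> sqrt P"
  shows "card (grid_ball n g (n * Nn) y) * a ^ n \<le> card (grid_ball n g (n * P) (\<lambda>_. 0)) * b ^ n"
proof -
  let ?B = "grid_ball n g (n * Nn) y" and ?T = "grid_ball n g (n * P) (\<lambda>_. 0)"
  let ?E = "\<lambda>c::nat. PiE {..<n} (\<lambda>_. {0..<int c})"
  \<comment> \<open>\<open>w\<close> numbers the fine cells and \<open>c\<close> is the centre
    measured in fine cells. \<open>F\<close> is the merged cell that holds the fine cell once the
    centre is moved to the origin, and \<open>R\<close> is the position inside it. As
    \<open>c\<close> is real, the ceiling picks the first integer of the merged cell, so that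
    \<open>R\<close> lies in \<open>{0..<b}\<close>.\<close>
  define c where "c = (\<lambda>i. a * y i / g)"
  define w where "w = (\<lambda>(l::nat \<Rightarrow> int, e::nat \<Rightarrow> int) i. int a * l i + e i)"
  define F where "F = (\<lambda>le i. if i < n then \<lfloor>(w le i - c i) / b\<rfloor> else 0)"
  define R where "R = (\<lambda>le. \<lambda>i\<in>{..<n}. w le i - \<lceil>c i + b * F le i\<rceil>)"
  have Fle: "F le i \<le> (w le i - c i) / b" "(w le i - c i) / b < F le i + 1" if "i < n" for le i
    using that floor_correct[of "(w le i - c i) / b"] by (auto simp: F_def)
  have cardE: "card (?E k) = k ^ n" for k by (simp add: card_PiE)
  have finE: "finite (?E k)" for k by (intro finite_PiE) auto
  have FT: "F (l, e) \<in> ?T" if l: "l \<in> ?B" and e: "e \<in> ?E a" for l e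
  proof -
    \<comment> \<open>The rounding error of the scaling in one coordinate. Splitting contributes at
      most \<open>a / b\<close> and the floor at most 1, which is the origin of the term
      \<open>g * (a / b + 1)\<close> in the hypothesis.\<close>
    define th where "th = (\<lambda>i. real_of_int (F (l, e) i) - (a / b) * (l i - y i / g))"
    have th: "\<bar>th i\<bar> \<le> a / b + 1" if i: "i < n" for i
    proof -
      have ei: "0 \<le> e i" "e i < int a" using e i by (auto dest!: PiE_mem[where x=i])
      have "(w (l, e) i - c i) / b = (a / b) * (l i - y i / g) + e i / b"
        using b g by (simp add: w_def c_def field_simps)
      moreover have "0 \<le> e i / b" using ei(1) by simp
      moreover have "e i / b \<le> a / b" using ei(2) by (intro divide_right_mono) linarith+
      moreover note Fle[OF i, of "(l, e)"]
      ultimately show ?thesis unfolding th_def by linarith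
    qed
    have "L2_set (\<lambda>i. g * F (l, e) i) {..<n} = L2_set (\<lambda>i. (a / b) * (g * l i - y i) + g * th i) {..<n}"
      using g by (intro arg_cong2[where f=L2_set] refl ext) (simp add: th_def right_diff_distrib)
    also have "\<dots> \<le> L2_set (\<lambda>i. (a / b) * (g * l i - y i)) {..<n} + L2_set (\<lambda>i. g * th i) {..<n}"
      by (rule L2_set_triangle_ineq)
    also have "L2_set (\<lambda>i. (a / b) * (g * l i - y i)) {..<n} = (a / b) * L2_set (\<lambda>i. g * l i - y i) {..<n}"
      by (rule L2_set_right_distrib[symmetric]) simp
    also have "L2_set (\<lambda>i. g * l i - y i) {..<n} \<le> sqrt (n * Nn)"
      using l by (simp add: L2_set_def grid_ball_def)
    also have "L2_set (\<lambda>i. g * th i) {..<n} \<le> sqrt (n * (g * (a / b + 1))\<^sup>2)"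
    proof -
      have "(\<Sum>i<n. (g * th i)\<^sup>2) \<le> (\<Sum>i<n. (g * (a / b + 1))\<^sup>2)"
        using th g by (intro sum_mono) (simp add: power_mult_distrib abs_le_square_iff[symmetric])
      then show ?thesis by (simp add: L2_set_def)
    qed
    also have "sqrt (n * (g * (a / b + 1))\<^sup>2) = sqrt n * (g * (a / b + 1))"
      using g by (simp add: real_sqrt_mult)
    finally have "L2_set (\<lambda>i. g * F (l, e) i) {..<n} \<le> (a / b) * sqrt (n * Nn) + sqrt n * (g * (a / b + 1))"
      by (simp add: mult_left_mono divide_right_mono)
    also have "\<dots> = sqrt n * ((a / b) * sqrt Nn + g * (a / b + 1))" by (simp add: real_sqrt_mult algebra_simps)
    also have "\<dots> \<le> sqrt n * sqrt P" by (intro mult_left_mono le) auto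
    finally have "sqrt (\<Sum>i<n. (g * F (l, e) i)\<^sup>2) \<le> sqrt (n * P)" by (simp add: L2_set_def real_sqrt_mult)
    then show ?thesis by (auto simp: grid_ball_def int_vecs_def F_def)
  qed
  have RE: "R le \<in> ?E b" for le
  proof
    fix i assume "i \<in> {..<n}"
    then have i: "i < n" by simp
    from Fle[OF i, of le] have "c i + b * F le i \<le> w le i" "w le i < c i + b * F le i + b"
      using b by (simp_all add: field_simps)
    then have "0 \<le> w le i - \<lceil>c i + b * F le i\<rceil>" "w le i - \<lceil>c i + b * F le i\<rceil> < int b" by linarith+
    then show "R le i \<in> {0..<int b}" using i by (simp add: R_def)
  qed (simp add: R_def)
  have inj: "inj_on (\<lambda>le. (F le, R le)) (?B \<times> ?E a)"
  proof (rule inj_onI)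
    fix p p' assume p: "p \<in> ?B \<times> ?E a" "p' \<in> ?B \<times> ?E a" and eq: "(F p, R p) = (F p', R p')"
    obtain l e l' e' where pq: "p = (l, e)" "p' = (l', e')" by (cases p, cases p') auto
    have both: "l i = l' i \<and> e i = e' i" if i: "i < n" for i
    proof -
      have "R p i = R p' i" using eq by simp
      then have weq: "int a * l i + e i = int a * l' i + e' i"
        using i eq by (simp add: R_def w_def pq)
      have ei: "0 \<le> e i" "e i < int a" "0 \<le> e' i" "e' i < int a"
        using p i by (auto simp: pq dest!: PiE_mem[where x=i])
      have "l i = (int a * l i + e i) div int a" "l' i = (int a * l' i + e' i) div int a"
        using ei a by simp_all
      then have "l i = l' i" using weq by simp
      then show ?thesis using weq by simp
    qed
    have "l = l'" by (rule int_vecs_eqI[of _ n]) (use p both in \<open>auto simp: pq grid_ball_def\<close>)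
    moreover have "e = e'" using p both by (intro PiE_ext[of e "{..<n}" "\<lambda>_. {0..<int a}"]) (auto simp: pq)
    ultimately show "p = p'" by (simp add: pq)
  qed
  have "card (?B \<times> ?E a) \<le> card (?T \<times> ?E b)"
  proof (rule card_inj_on_le[OF inj])
    show "(\<lambda>le. (F le, R le)) ` (?B \<times> ?E a) \<subseteq> ?T \<times> ?E b"
    proof (rule image_subsetI)
      fix p assume "p \<in> ?B \<times> ?E a"
      then show "(F p, R p) \<in> ?T \<times> ?E b"
        using FT[of "fst p" "snd p"] RE[of p] by (simp add: mem_Times_iff)
    qed
  qed (intro finite_cartesian_product finite_grid_ball[OF g] finE)
  then show ?thesis by (simp add: card_cartesian_product cardE)
qed

text \<open>Distinct solutions \<open>t\<close> have distinct quotients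
  \<open>(t * x + c) div q\<close>. For positive \<open>x\<close> these lie between c/q and c/q + x,
  hence among the \<open>x\<close> integers starting at \<open>k0\<close>, the ceiling of c/q. A
  negative \<open>x\<close> is handled by changing all signs.\<close>

lemma card_linear_cong_le:
  fixes x c :: int and q :: nat
  assumes q: "q > 0" and x: "x \<noteq> 0"
  shows "card {t \<in> {0..<int q}. int q dvd t * x + c} \<le> nat \<bar>x\<bar>"
proof -
  have pos: "card {t \<in> {0..<int q}. int q dvd t * x + c} \<le> nat x" if x: "x > 0" for x c :: int
  proof -
    let ?A = "{t \<in> {0..<int q}. int q dvd t * x + c}"
    let ?F = "\<lambda>t. (t * x + c) div int q"
    define k0 where "k0 = - ((- c) div int q)"
    have inj: "inj_on ?F ?A"
    proof (rule inj_onI)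
      fix t t' assume t: "t \<in> ?A" "t' \<in> ?A" "?F t = ?F t'"
      then have "t * x + c = t' * x + c" by (metis (mono_tags, lifting) dvd_div_mult_self mem_Collect_eq)
      then show "t = t'" using x by simp
    qed
    have sub: "?F ` ?A \<subseteq> {k0..<k0 + x}"
    proof (rule image_subsetI)
      fix t assume t: "t \<in> ?A"
      define k where "k = ?F t"
      have k: "int q * k = t * x + c" using t by (simp add: k_def)
      have "t * x < int q * x" using t x by simp
      moreover have "0 \<le> t * x" using t x by simp
      ultimately have b: "c \<le> int q * k" "int q * k < c + int q * x" using k by linarith+
      have c: "- c = int q * ((- c) div int q) + (- c) mod int q" by simp
      have "0 \<le> (- c) mod int q" "(- c) mod int q < int q" using q by simp_all
      then have c2: "c \<le> int q * k0" "int q * k0 < c + int q"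
        using c unfolding k0_def mult_minus_right by linarith+
      have "int q * k0 < int q * (k + 1)" using b c2 by (simp add: algebra_simps)
      moreover have "int q * k < int q * (k0 + x)" using b c2 by (simp add: algebra_simps)
      ultimately show "?F t \<in> {k0..<k0 + x}" using q by (simp add: k_def[symmetric])
    qed
    have "card ?A \<le> card {k0..<k0 + x}" by (rule card_inj_on_le[OF inj sub]) simp
    then show ?thesis by simp
  qed
  show ?thesis
  proof (cases "x > 0")
    case True then show ?thesis using pos[of x c] by simp
  next
    case False
    have "int q dvd t * x + c \<longleftrightarrow> int q dvd t * (- x) + (- c)" for t
      using dvd_minus_iff[of "int q" "t * x + c"] by (simp add: algebra_simps)
    then show ?thesis using pos[of "- x" "- c"] False x by simp
  qed
qed

definition hash :: "nat \<Rightarrow> nat \<Rightarrow> (nat \<Rightarrow> int) \<Rightarrow> (nat \<Rightarrow> int) \<Rightarrow> int" where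
  "hash n q h x = (\<Sum>i<n. h i * x i) mod int q"

text \<open>The modulus \<open>q\<close> need not be prime: the loss factor \<open>L\<close> is only polynomial in \<open>n\<close> in the
  application.\<close>
lemma hash_zero_card_le:
  fixes L :: nat
  assumes q: "q > 0" and x: "x \<in> int_vecs n" "x \<noteq> (\<lambda>_. 0)" and L: "\<And>i. i < n \<Longrightarrow> \<bar>x i\<bar> \<le> int L"
  shows "real (card {h \<in> PiE {..<n} (\<lambda>_. {0..<int q}). hash n q h x = 0}) \<le> real q ^ n * (L / q)"
proof -
  let ?H = "PiE {..<n} (\<lambda>_. {0..<int q})"
  obtain i where i: "i < n" "x i \<noteq> 0"
    using x int_vecs_eqI[of x n "\<lambda>_. 0"] by (auto simp: int_vecs_def)
  have fin: "finite ?H" by (intro finite_PiE) auto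
  have "real (card {h \<in> ?H. hash n q h x = 0}) = (\<Sum>h\<in>?H. of_bool (hash n q h x = 0))"
    using fin by (subst sum_of_bool_eq) (auto simp: Int_def)
  also have "\<dots> \<le> real (card ?H) * (L / q)"
  proof (rule sum_PiE_le[of i])
    fix h assume h: "h \<in> ?H"
    have eq: "hash n q (h(i := t)) x = 0 \<longleftrightarrow> int q dvd t * x i + (\<Sum>j\<in>{..<n} - {i}. h j * x j)" for t
    proof -
      have "(\<Sum>j<n. (h(i := t)) j * x j) = t * x i + (\<Sum>j\<in>{..<n} - {i}. h j * x j)"
        using i by (subst sum.remove[of _ i]) (auto intro!: sum.cong)
      then show ?thesis by (simp add: hash_def dvd_eq_mod_eq_0)
    qed
    have "(\<Sum>t\<in>{0..<int q}. of_bool (hash n q (h(i := t)) x = 0))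
        = real (card {t \<in> {0..<int q}. int q dvd t * x i + (\<Sum>j\<in>{..<n} - {i}. h j * x j)})"
      unfolding eq by (subst sum_of_bool_eq) (auto simp: Int_def)
    also have "\<dots> \<le> real L"
      using card_linear_cong_le[OF q i(2), of "\<Sum>j\<in>{..<n} - {i}. h j * x j"] L[OF i(1)] by linarith
    finally show "(\<Sum>t\<in>{0..<int q}. of_bool (hash n q (h(i := t)) x = 0)) \<le> real (card {0..<int q}) * (L / q)"
      using q by simp
  qed (use i q in auto)
  also have "card ?H = q ^ n" by (simp add: card_PiE)
  finally show ?thesis by simp
qed

text \<open>Flipping the sign of one coordinate kills the mixed moments \<open>M i j\<close>, and
  swapping coordinates equalises the diagonal ones. So the second-moment matrix of a uniform point
  is a multiple of the identity, and its trace is at most \<open>n * P\<close>.\<close>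

lemma grid_ball_second_moment:
  fixes g P :: real and v :: "nat \<Rightarrow> real"
  assumes g: "g > 0" and n: "n > 0"
  shows "(\<Sum>x\<in>grid_ball n g (n * P) (\<lambda>_. 0). (\<Sum>i<n. g * x i * v i)\<^sup>2)
     \<le> real (card (grid_ball n g (n * P) (\<lambda>_. 0))) * (P * (\<Sum>i<n. (v i)\<^sup>2))"
proof -
  let ?T = "grid_ball n g (n * P) (\<lambda>_. 0)"
  have fin: "finite ?T" by (rule finite_grid_ball[OF g])
  define M where "M = (\<lambda>i j. \<Sum>x\<in>?T. (g * x i) * (g * x j))"
  have off: "M i j = 0" if ij: "i \<noteq> j" "i < n" for i j
  proof -
    define \<tau> where "\<tau> = (\<lambda>x::nat\<Rightarrow>int. x(i := - x i))"
    have mem: "\<tau> x \<in> ?T" if "x \<in> ?T" for x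
    proof -
      have "(\<Sum>k<n. (g * \<tau> x k)\<^sup>2) = (\<Sum>k<n. (g * x k)\<^sup>2)" by (intro sum.cong) (auto simp: \<tau>_def)
      moreover have "\<tau> x \<in> int_vecs n" using that by (auto simp: grid_ball_def int_vecs_def \<tau>_def)
      ultimately show ?thesis using that by (simp add: grid_ball_def)
    qed
    have inv: "\<tau> (\<tau> x) = x" for x by (simp add: \<tau>_def fun_eq_iff)
    have "M i j = (\<Sum>x\<in>?T. (g * \<tau> x i) * (g * \<tau> x j))"
      unfolding M_def by (rule sum.reindex_bij_witness[of _ \<tau> \<tau>]) (simp_all only: mem inv)
    also have "\<dots> = - M i j" using ij by (simp add: M_def \<tau>_def sum_negf)
    finally show ?thesis by simp
  qed
  have swap: "M i i = M 0 0" if i: "i < n" for i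
  proof -
    define \<tau> where "\<tau> = (\<lambda>x::nat\<Rightarrow>int. x \<circ> Transposition.transpose i 0)"
    have mem: "\<tau> x \<in> ?T" if "x \<in> ?T" for x
    proof -
      have "(\<Sum>k<n. (g * \<tau> x k)\<^sup>2) = (\<Sum>k<n. (g * x k)\<^sup>2)"
        by (rule sum.reindex_bij_witness[of _ "Transposition.transpose i 0" "Transposition.transpose i 0"])
           (use i n in \<open>auto simp: \<tau>_def Transposition.transpose_def\<close>)
      moreover have "\<tau> x \<in> int_vecs n" using that i n
        by (auto simp: grid_ball_def int_vecs_def \<tau>_def Transposition.transpose_def)
      ultimately show ?thesis using that by (simp add: grid_ball_def)
    qed
    have inv: "\<tau> (\<tau> x) = x" for x by (simp add: \<tau>_def fun_eq_iff)
    show ?thesis unfolding M_def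
      by (rule sum.reindex_bij_witness[of _ \<tau> \<tau>]) (simp_all only: mem inv, simp add: \<tau>_def)
  qed
  have "(\<Sum>i<n. M i i) = (\<Sum>i<n. M 0 0)" by (intro sum.cong swap) auto
  then have "real n * M 0 0 = (\<Sum>i<n. M i i)" by simp
  also have "\<dots> = (\<Sum>x\<in>?T. \<Sum>i<n. (g * x i)\<^sup>2)"
    unfolding M_def by (subst sum.swap) (simp add: power2_eq_square)
  also have "\<dots> \<le> (\<Sum>x\<in>?T. n * P)" by (intro sum_mono) (auto simp: grid_ball_def)
  finally have M0: "M 0 0 \<le> card ?T * P" using n by simp
  have "(\<Sum>x\<in>?T. (\<Sum>i<n. g * x i * v i)\<^sup>2) = (\<Sum>x\<in>?T. \<Sum>i<n. \<Sum>j<n. v i * v j * ((g * x i) * (g * x j)))"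
    unfolding power2_eq_square sum_product by (intro sum.cong refl) (simp add: mult_ac)
  also have "\<dots> = (\<Sum>i<n. \<Sum>j<n. v i * v j * M i j)"
    unfolding M_def sum_distrib_left by (subst sum.swap, rule sum.cong[OF refl], rule sum.swap)
  also have "\<dots> = (\<Sum>i<n. v i * v i * M 0 0)"
  proof (rule sum.cong[OF refl])
    fix i assume "i \<in> {..<n}"
    then have i: "i < n" by simp
    have "(\<Sum>j<n. v i * v j * M i j) = (\<Sum>j<n. if j = i then v i * v i * M i i else 0)"
      using off i by (intro sum.cong) auto
    then show "(\<Sum>j<n. v i * v j * M i j) = v i * v i * M 0 0" using i by (simp add: swap[OF i])
  qed
  also have "\<dots> = (\<Sum>i<n. (v i)\<^sup>2) * M 0 0" by (simp add: sum_distrib_right power2_eq_square)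
  also have "\<dots> \<le> (\<Sum>i<n. (v i)\<^sup>2) * (card ?T * P)" by (intro mult_left_mono M0 sum_nonneg) auto
  finally show ?thesis by (simp add: mult_ac)
qed

section \<open>Effective noise after scaling\<close>

abbreviation gauss :: "real measure" where
  "gauss \<equiv> density lborel (\<lambda>x. ennreal (std_normal_density x))"

lemma prob_space_gauss: "prob_space gauss"
  by (rule prob_space_normal_density) simp

lemma gauss_integrable_power: "integrable gauss (\<lambda>x. x ^ k)"
proof (subst integrable_density)
  show "integrable lborel (\<lambda>x. std_normal_density x *\<^sub>R x ^ k)"
    using integrable_std_normal_moment[of k] by simp
qed auto

lemma gauss_integral_power: "(\<integral>x. x ^ k \<partial>gauss) = (\<integral>x. std_normal_density x * x ^ k \<partial>lborel)"
  by (subst integral_density) auto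

lemma gauss_integral_id: "integrable gauss (\<lambda>x. x)" "(\<integral>x. x \<partial>gauss) = 0"
  using gauss_integrable_power[of 1] gauss_integral_power[of 1] integral_std_normal_moment_odd[of 0]
  by simp_all

lemma gauss_integral_square: "(\<integral>x. x\<^sup>2 \<partial>gauss) = 1"
  using gauss_integral_power[of 2] integral_std_normal_moment_even[of 1] by simp

lemma gauss_integral_4: "(\<integral>x. x ^ 4 \<partial>gauss) = 3"
  using gauss_integral_power[of 4] integral_std_normal_moment_even[of 2] by (simp add: fact_numeral)

lemma gauss_integral_square_minus_1:
  "integrable gauss (\<lambda>x. x\<^sup>2 - 1)" "(\<integral>x. x\<^sup>2 - 1 \<partial>gauss) = 0"
  "integrable gauss (\<lambda>x. (x\<^sup>2 - 1)\<^sup>2)" "(\<integral>x. (x\<^sup>2 - 1)\<^sup>2 \<partial>gauss) = 2"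
proof -
  interpret prob_space gauss by (rule prob_space_gauss)
  have one: "measure gauss UNIV = 1" using prob_space by simp
  show i: "integrable gauss (\<lambda>x. x\<^sup>2 - 1)" using gauss_integrable_power[of 2] by simp
  show "(\<integral>x. x\<^sup>2 - 1 \<partial>gauss) = 0"
    using gauss_integrable_power[of 2] gauss_integral_square one by simp
  have eq: "(\<lambda>x::real. (x\<^sup>2 - 1)\<^sup>2) = (\<lambda>x. x ^ 4 - 2 * x\<^sup>2 + 1)"
    by (auto simp: fun_eq_iff power2_eq_square algebra_simps power4_eq_xxxx)
  show "integrable gauss (\<lambda>x. (x\<^sup>2 - 1)\<^sup>2)"
    unfolding eq using gauss_integrable_power[of 2] gauss_integrable_power[of 4] by simp
  show "(\<integral>x. (x\<^sup>2 - 1)\<^sup>2 \<partial>gauss) = 2"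
    unfolding eq using gauss_integrable_power[of 2] gauss_integrable_power[of 4]
    by (simp add: one gauss_integral_square gauss_integral_4)
qed

lemma PiM_second_moment:
  fixes \<phi> :: "'a \<Rightarrow> real" and c :: "'i \<Rightarrow> real"
  assumes I: "finite I" and M: "prob_space M"
    and i1: "integrable M \<phi>" and m1: "(\<integral>x. \<phi> x \<partial>M) = 0" and i2: "integrable M (\<lambda>x. (\<phi> x)\<^sup>2)"
  shows "integrable (PiM I (\<lambda>_. M)) (\<lambda>z. (\<Sum>i\<in>I. c i * \<phi> (z i))\<^sup>2)"
    and "(\<integral>z. (\<Sum>i\<in>I. c i * \<phi> (z i))\<^sup>2 \<partial>PiM I (\<lambda>_. M)) = (\<Sum>i\<in>I. (c i)\<^sup>2) * (\<integral>x. (\<phi> x)\<^sup>2 \<partial>M)"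
proof -
  interpret M: prob_space M by (rule M)
  interpret product_sigma_finite "\<lambda>_. M" by standard
  let ?V = "\<integral>x. (\<phi> x)\<^sup>2 \<partial>M"
  have pair: "integrable (PiM I (\<lambda>_. M)) (\<lambda>z. \<phi> (z i) * \<phi> (z j)) \<and>
      (\<integral>z. \<phi> (z i) * \<phi> (z j) \<partial>PiM I (\<lambda>_. M)) = (if i = j then ?V else 0)"
    if ij: "i \<in> I" "j \<in> I" for i j
  proof -
    \<comment> \<open>Writing \<open>\<phi> (z i) * \<phi> (z j)\<close> as a product with one
      factor per coordinate treats \<open>i = j\<close> and \<open>i \<noteq> j\<close> by the same
      product formula; for \<open>i \<noteq> j\<close> one factor has mean 0.\<close>
    define f where "f = (\<lambda>k x. (if k = i then \<phi> x else 1) * (if k = j then \<phi> x else 1))"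
    have int: "integrable M (f k)" for k
      using i1 i2 by (cases "k = i"; cases "k = j") (simp_all add: f_def power2_eq_square)
    have eq: "(\<Prod>k\<in>I. f k (z k)) = \<phi> (z i) * \<phi> (z j)" for z
      using I ij by (simp add: f_def prod.distrib prod.delta)
    have "(\<Prod>k\<in>I. integral\<^sup>L M (f k)) = (if i = j then ?V else 0)"
    proof (cases "i = j")
      case True
      have "(\<Prod>k\<in>I. integral\<^sup>L M (f k)) = (\<Prod>k\<in>I. if k = i then ?V else 1)"
        using True by (intro prod.cong) (auto simp: f_def power2_eq_square M.prob_space)
      then show ?thesis using True I ij by simp
    next
      case False
      then have "integral\<^sup>L M (f i) = 0" using m1 by (simp add: f_def)
      then show ?thesis using False I ij by auto
    qed
    then show ?thesis
      using product_integrable_prod[OF I, of f] product_integral_prod[OF I, of f] int by (simp add: eq)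
  qed
  have eq: "(\<Sum>i\<in>I. c i * \<phi> (z i))\<^sup>2 = (\<Sum>i\<in>I. \<Sum>j\<in>I. c i * c j * (\<phi> (z i) * \<phi> (z j)))" for z
    unfolding power2_eq_square sum_product by (intro sum.cong refl) (simp add: mult_ac)
  show "integrable (PiM I (\<lambda>_. M)) (\<lambda>z. (\<Sum>i\<in>I. c i * \<phi> (z i))\<^sup>2)"
    unfolding eq using pair by (intro Bochner_Integration.integrable_sum integrable_mult_right) blast
  have "(\<integral>z. (\<Sum>i\<in>I. c i * \<phi> (z i))\<^sup>2 \<partial>PiM I (\<lambda>_. M))
     = (\<Sum>i\<in>I. \<Sum>j\<in>I. c i * c j * (if i = j then ?V else 0))"
    unfolding eq using pair by (simp add: Bochner_Integration.integral_sum)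
  also have "\<dots> = (\<Sum>i\<in>I. c i * c i * ?V)"
    by (intro sum.cong refl) (simp add: I if_distrib cong: if_cong)
  finally show "(\<integral>z. (\<Sum>i\<in>I. c i * \<phi> (z i))\<^sup>2 \<partial>PiM I (\<lambda>_. M)) = (\<Sum>i\<in>I. (c i)\<^sup>2) * ?V"
    by (simp add: sum_distrib_right power2_eq_square)
qed

abbreviation gauss_vec :: "nat \<Rightarrow> (nat \<Rightarrow> real) measure" where
  "gauss_vec n \<equiv> PiM {..<n} (\<lambda>_. gauss)"

lemma prob_space_gauss_vec: "prob_space (gauss_vec n)"
  by (intro prob_space_PiM prob_space_gauss)

lemma measurable_gauss_vec_coord [measurable]:
  "i < n \<Longrightarrow> (\<lambda>z. z i) \<in> borel_measurable (gauss_vec n)"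
  using measurable_component_singleton[of i "{..<n}" "\<lambda>_. gauss"] by simp

text \<open>The scaling \<open>\<alpha> = s / (1 + s)\<close> is the linear MMSE coefficient for a signal of power \<open>s\<close>; it satisfies
  \<open>\<alpha>\<^sup>2 + (1 - \<alpha>)\<^sup>2 s = \<alpha>\<close>.\<close>
lemma mmse_noise_tail:
  fixes v :: "nat \<Rightarrow> real"
  assumes s: "s > 0" and \<alpha>: "\<alpha> = s / (1 + s)" and \<delta>: "\<delta> > 0" and n: "n > 0"
    and v: "(\<Sum>i<n. (v i)\<^sup>2) \<le> n * s + Q" and Q: "Q \<ge> 0"
  shows "measure (gauss_vec n) {z \<in> space (gauss_vec n). \<not> (\<Sum>i<n. (v i - \<alpha> * (v i + z i))\<^sup>2) \<le> n * (\<alpha> + \<delta>)}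
     \<le> 3 * (2 * real n + 4 * (\<Sum>i<n. (v i)\<^sup>2) + Q\<^sup>2) / (n * \<delta>)\<^sup>2"
proof -
  interpret prob_space "gauss_vec n" by (rule prob_space_gauss_vec)
  \<comment> \<open>The residual is (1 - \<alpha>) v - \<alpha> z. Its square splits into the
    centred quadratic noise \<open>a\<close>, the part \<open>b\<close> linear in the noise, and a
    deterministic rest whose excess over the nominal power is at most \<open>Q\<close>.\<close>
  define a where "a = (\<lambda>z::nat \<Rightarrow> real. \<Sum>i<n. \<alpha>\<^sup>2 * ((z i)\<^sup>2 - 1))"
  define b where "b = (\<lambda>z::nat \<Rightarrow> real. \<Sum>i<n. (- 2 * \<alpha> * (1 - \<alpha>) * v i) * z i)"
  have al: "0 < \<alpha>" "\<alpha> < 1" using s by (auto simp: \<alpha>)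
  have "s * (1 - \<alpha>) = \<alpha>" using s by (simp add: \<alpha> field_simps)
  then have id: "\<alpha>\<^sup>2 + (1 - \<alpha>)\<^sup>2 * s = \<alpha>" 
    using arg_cong[of "s * (1 - \<alpha>)" \<alpha> "\<lambda>t. \<alpha>\<^sup>2 + (1 - \<alpha>) * t"]
    by (simp add: power2_eq_square algebra_simps)
  have a2: "integrable (gauss_vec n) (\<lambda>z. (a z)\<^sup>2)" "(\<integral>z. (a z)\<^sup>2 \<partial>gauss_vec n) = n * (\<alpha>\<^sup>2)\<^sup>2 * 2"
    using PiM_second_moment[OF _ prob_space_gauss gauss_integral_square_minus_1(1-3), of "{..<n}" "\<lambda>_. \<alpha>\<^sup>2"]
    by (auto simp: a_def gauss_integral_square_minus_1)
  have b2: "integrable (gauss_vec n) (\<lambda>z. (b z)\<^sup>2)"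
    "(\<integral>z. (b z)\<^sup>2 \<partial>gauss_vec n) = (\<Sum>i<n. (- 2 * \<alpha> * (1 - \<alpha>) * v i)\<^sup>2)"
    using PiM_second_moment[OF _ prob_space_gauss gauss_integral_id gauss_integrable_power[of 2],
        of "{..<n}" "\<lambda>i. - 2 * \<alpha> * (1 - \<alpha>) * v i"]
    by (auto simp: b_def gauss_integral_square)
  have aa: "(\<alpha>\<^sup>2)\<^sup>2 \<le> 1" using al by (simp add: power_le_one)
  have bb: "(- 2 * \<alpha> * (1 - \<alpha>) * v i)\<^sup>2 \<le> 4 * (v i)\<^sup>2" for i
  proof -
    have "(\<alpha> * (1 - \<alpha>))\<^sup>2 \<le> 1" using al by (intro power_le_one mult_nonneg_nonneg mult_le_one) auto
    then have "(\<alpha> * (1 - \<alpha>))\<^sup>2 * (4 * (v i)\<^sup>2) \<le> 1 * (4 * (v i)\<^sup>2)" by (intro mult_right_mono) auto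
    moreover have "(- 2 * \<alpha> * (1 - \<alpha>) * v i)\<^sup>2 = (\<alpha> * (1 - \<alpha>))\<^sup>2 * (4 * (v i)\<^sup>2)"
      by (simp add: power2_eq_square algebra_simps)
    ultimately show ?thesis by simp
  qed
  \<comment> \<open>\<open>f\<close> dominates the square of \<open>a + b + Q\<close>, so Markov's
    inequality for \<open>f\<close> acts as Chebyshev's inequality for the three deviations
    together.\<close>
  define f where "f = (\<lambda>z. 3 * ((a z)\<^sup>2 + (b z)\<^sup>2 + Q\<^sup>2))"
  have f: "integrable (gauss_vec n) f" unfolding f_def using a2 b2 by simp
  have "(\<integral>z. f z \<partial>gauss_vec n) = 3 * (n * (\<alpha>\<^sup>2)\<^sup>2 * 2 + (\<Sum>i<n. (- 2 * \<alpha> * (1 - \<alpha>) * v i)\<^sup>2) + Q\<^sup>2)"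
    unfolding f_def using a2 b2 by (simp add: prob_space)
  also have "\<dots> \<le> 3 * (n * 1 * 2 + (\<Sum>i<n. 4 * (v i)\<^sup>2) + Q\<^sup>2)"
    using mult_left_le[OF aa, of "real n"] by (intro mult_left_mono[of _ _ 3] add_mono sum_mono bb) auto
  finally have If: "(\<integral>z. f z \<partial>gauss_vec n) \<le> 3 * (2 * real n + 4 * (\<Sum>i<n. (v i)\<^sup>2) + Q\<^sup>2)"
    by (simp add: sum_distrib_left mult_ac)
  have "measure (gauss_vec n) {z \<in> space (gauss_vec n). \<not> (\<Sum>i<n. (v i - \<alpha> * (v i + z i))\<^sup>2) \<le> n * (\<alpha> + \<delta>)}
     \<le> measure (gauss_vec n) {z \<in> space (gauss_vec n). f z \<ge> (n * \<delta>)\<^sup>2}"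
  proof (intro finite_measure_mono)
    show "{z \<in> space (gauss_vec n). f z \<ge> (n * \<delta>)\<^sup>2} \<in> sets (gauss_vec n)"
      using borel_measurable_integrable[OF f] by measurable
    show "{z \<in> space (gauss_vec n). \<not> (\<Sum>i<n. (v i - \<alpha> * (v i + z i))\<^sup>2) \<le> n * (\<alpha> + \<delta>)}
      \<subseteq> {z \<in> space (gauss_vec n). f z \<ge> (n * \<delta>)\<^sup>2}"
    proof safe
      fix z assume big: "\<not> (\<Sum>i<n. (v i - \<alpha> * (v i + z i))\<^sup>2) \<le> n * (\<alpha> + \<delta>)"
      have "(\<Sum>i<n. (v i - \<alpha> * (v i + z i))\<^sup>2)
          = (\<Sum>i<n. \<alpha>\<^sup>2 * ((z i)\<^sup>2 - 1) + (- 2 * \<alpha> * (1 - \<alpha>) * v i) * z i + (1 - \<alpha>)\<^sup>2 * (v i)\<^sup>2 + \<alpha>\<^sup>2)"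
        by (intro sum.cong refl) (simp add: power2_eq_square algebra_simps)
      also have "\<dots> = a z + b z + (1 - \<alpha>)\<^sup>2 * (\<Sum>i<n. (v i)\<^sup>2) + n * \<alpha>\<^sup>2"
        by (simp only: sum.distrib a_def b_def sum_distrib_left sum_constant card_lessThan)
      also have "(1 - \<alpha>)\<^sup>2 * (\<Sum>i<n. (v i)\<^sup>2) \<le> (1 - \<alpha>)\<^sup>2 * (n * s + Q)" by (intro mult_left_mono v) auto
      also have "(1 - \<alpha>)\<^sup>2 * (n * s + Q) \<le> n * ((1 - \<alpha>)\<^sup>2 * s) + Q"
        using al Q by (simp add: distrib_left mult_left_le_one_le power_le_one)
      finally have "(\<Sum>i<n. (v i - \<alpha> * (v i + z i))\<^sup>2) \<le> a z + b z + Q + n * (\<alpha>\<^sup>2 + (1 - \<alpha>)\<^sup>2 * s)"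
        by (simp add: algebra_simps)
      then have "n * \<delta> \<le> a z + b z + Q" using big unfolding id by (simp add: algebra_simps)
      then have "(n * \<delta>)\<^sup>2 \<le> (a z + b z + Q)\<^sup>2" using \<delta> by (intro power_mono) auto
      also have "\<dots> \<le> f z"
      proof -
        have "0 \<le> (a z - b z)\<^sup>2 + (b z - Q)\<^sup>2 + (a z - Q)\<^sup>2" by simp
        then show ?thesis by (simp add: f_def power2_eq_square algebra_simps)
      qed
      finally show "(n * \<delta>)\<^sup>2 \<le> f z" .
    qed
  qed
  also have "\<dots> \<le> (\<integral>z. f z \<partial>gauss_vec n) / (n * \<delta>)\<^sup>2"
    using n \<delta> by (intro integral_Markov_inequality_measure[OF f, of "{}", simplified]) (auto simp: f_def)
  also have "\<dots> \<le> 3 * (2 * real n + 4 * (\<Sum>i<n. (v i)\<^sup>2) + Q\<^sup>2) / (n * \<delta>)\<^sup>2"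
    by (intro divide_right_mono If) auto
  finally show ?thesis .
qed

text \<open>Independent points of two balls are nearly orthogonal: with \<open>x u'\<close> fixed,
  \<open>grid_ball_second_moment\<close> bounds the mean squared inner product by \<open>P u\<close>
  times the squared norm of \<open>x u'\<close>, hence by \<open>n * s\<^sup>2\<close>.
  Cauchy-Schwarz over at most \<open>card U ^ 2\<close> ordered pairs gives the fourth power. What
  matters is the order n, compared with n^2 for the square of the tolerated deviation.\<close>

lemma cross_terms_average:
  fixes P :: "'u \<Rightarrow> real" and g s :: real
  assumes U: "finite U" and g: "g > 0" and n: "n > 0" and P0: "\<And>u. u \<in> U \<Longrightarrow> P u \<ge> 0"
    and Ps: "(\<Sum>u\<in>U. P u) \<le> s"
  defines "T \<equiv> \<lambda>u. grid_ball n g (n * P u) (\<lambda>_. 0)"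
  defines "W \<equiv> {(u, u') \<in> U \<times> U. u \<noteq> u'}"
  shows "(\<Sum>x\<in>PiE U T. (\<Sum>(u, u')\<in>W. \<Sum>i<n. (g * x u i) * (g * x u' i))\<^sup>2)
     \<le> card (PiE U T) * (real (card U) ^ 4 * (n * s\<^sup>2))"
proof -
  have finW: "finite W" unfolding W_def by (rule finite_subset[of _ "U \<times> U"]) (use U in auto)
  have cW: "real (card W) \<le> real (card U) ^ 2"
  proof -
    have "card W \<le> card (U \<times> U)" unfolding W_def by (intro card_mono) (use U in auto)
    then show ?thesis using of_nat_mono[of "card W" "card U * card U", where 'a=real]
      by (simp add: power2_eq_square card_cartesian_product)
  qed
  have Pus: "P u \<le> s" if "u \<in> U" for u
    using member_le_sum[of u U P] P0 U that Ps by auto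
  have zero: "(\<lambda>_. 0) \<in> T u" if "u \<in> U" for u
    using P0[OF that] by (simp add: T_def grid_ball_def int_vecs_def)
  have pair: "(\<Sum>x\<in>PiE U T. (\<Sum>i<n. (g * x u i) * (g * x u' i))\<^sup>2) \<le> card (PiE U T) * (n * s\<^sup>2)"
    if uu: "u \<in> U" "u' \<in> U" "u \<noteq> u'" for u u'
  proof (rule sum_PiE_le[of u])
    fix x assume x: "x \<in> PiE U T"
    then have xu': "(\<Sum>i<n. (g * x u' i)\<^sup>2) \<le> n * P u'"
      using uu by (auto simp: T_def grid_ball_def dest!: PiE_mem[where x=u'])
    have "(\<Sum>t\<in>T u. (\<Sum>i<n. (g * (x(u := t)) u i) * (g * (x(u := t)) u' i))\<^sup>2)
        = (\<Sum>t\<in>T u. (\<Sum>i<n. g * t i * (g * x u' i))\<^sup>2)" using uu by simp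
    also have "\<dots> \<le> card (T u) * (P u * (\<Sum>i<n. (g * x u' i)\<^sup>2))"
      unfolding T_def by (rule grid_ball_second_moment[OF g n])
    also have "\<dots> \<le> card (T u) * (s * (n * s))"
      using xu' Pus[OF uu(1)] Pus[OF uu(2)] P0[OF uu(1)]
      by (intro mult_left_mono mult_mono order_trans[OF xu']) (auto intro!: sum_nonneg)
    finally show "(\<Sum>t\<in>T u. (\<Sum>i<n. (g * (x(u := t)) u i) * (g * (x(u := t)) u' i))\<^sup>2)
        \<le> card (T u) * (n * s\<^sup>2)" by (simp add: power2_eq_square mult_ac)
  qed (use uu zero[OF uu(1)] finite_grid_ball[OF g] in \<open>auto simp: T_def\<close>)
  have "(\<Sum>x\<in>PiE U T. (\<Sum>(u, u')\<in>W. \<Sum>i<n. (g * x u i) * (g * x u' i))\<^sup>2)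
      \<le> (\<Sum>x\<in>PiE U T. card W * (\<Sum>(u, u')\<in>W. (\<Sum>i<n. (g * x u i) * (g * x u' i))\<^sup>2))"
    by (intro sum_mono order_trans[OF sum_squared_le_sum_of_squares])
       (auto simp: finW case_prod_unfold mult.commute)
  also have "\<dots> = card W * (\<Sum>(u, u')\<in>W. \<Sum>x\<in>PiE U T. (\<Sum>i<n. (g * x u i) * (g * x u' i))\<^sup>2)"
    unfolding case_prod_unfold sum_distrib_left[symmetric] by (subst sum.swap) simp
  also have "\<dots> \<le> card W * (\<Sum>w\<in>W. card (PiE U T) * (n * s\<^sup>2))"
    by (intro mult_left_mono sum_mono) (auto simp: W_def intro!: pair)
  also have "\<dots> = (real (card W))\<^sup>2 * (card (PiE U T) * (n * s\<^sup>2))" by (simp add: power2_eq_square)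
  also have "\<dots> \<le> (real (card U) ^ 2)\<^sup>2 * (card (PiE U T) * (n * s\<^sup>2))"
    by (intro mult_right_mono power_mono cW) auto
  finally show ?thesis by (simp add: mult_ac)
qed

text \<open>The absolute cross term \<open>\<bar>cr x\<bar>\<close> serves as the power excess
  \<open>Q\<close> of \<open>mmse_noise_tail\<close>. Its mean square is of order n, and division by
  \<open>(n * \<delta>)\<^sup>2\<close> leaves an average error of order 1/n. For the linear noise
  term the crude Cauchy-Schwarz bound \<open>card U * (n * s)\<close> on the power of the sum is
  enough.\<close>

lemma mmse_noise_average:
  fixes P :: "'u \<Rightarrow> real" and g s :: real
  assumes U: "finite U" and g: "g > 0" and n: "n > 0" and P0: "\<And>u. u \<in> U \<Longrightarrow> P u \<ge> 0"
    and Ps: "(\<Sum>u\<in>U. P u) \<le> s" and s: "s > 0" and \<alpha>: "\<alpha> = s / (1 + s)" and \<delta>: "\<delta> > 0"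
  defines "T \<equiv> \<lambda>u. grid_ball n g (n * P u) (\<lambda>_. 0)"
  shows "(\<Sum>x\<in>PiE U T. measure (gauss_vec n) {z \<in> space (gauss_vec n).
       \<not> (\<Sum>i<n. (g * (\<Sum>u\<in>U. x u i) - \<alpha> * (g * (\<Sum>u\<in>U. x u i) + z i))\<^sup>2) \<le> n * (\<alpha> + \<delta>)})
     \<le> card (PiE U T) * (3 * (2 + 4 * card U * s + real (card U) ^ 4 * s\<^sup>2) / \<delta>\<^sup>2 / n)"
proof -
  define W where "W = {(u, u') \<in> U \<times> U. u \<noteq> u'}"
  define X where "X = (\<lambda>x i. g * real_of_int (\<Sum>u\<in>U. (x::'u \<Rightarrow> nat \<Rightarrow> int) u i))"
  define cr where "cr = (\<lambda>x. \<Sum>(u, u')\<in>W. \<Sum>i<n. (g * real_of_int ((x::'u \<Rightarrow> nat \<Rightarrow> int) u i)) * (g * x u' i))"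
  have point: "measure (gauss_vec n) {z \<in> space (gauss_vec n).
       \<not> (\<Sum>i<n. (X x i - \<alpha> * (X x i + z i))\<^sup>2) \<le> n * (\<alpha> + \<delta>)}
     \<le> 3 * (2 * real n + 4 * (card U * (n * s)) + (cr x)\<^sup>2) / (n * \<delta>)\<^sup>2" if x: "x \<in> PiE U T" for x
  proof -
    have xu: "(\<Sum>i<n. (g * x u i)\<^sup>2) \<le> n * P u" if "u \<in> U" for u
      using PiE_mem[OF x that] by (simp add: T_def grid_ball_def)
    have sumP: "(\<Sum>u\<in>U. \<Sum>i<n. (g * x u i)\<^sup>2) \<le> n * s"
    proof -
      have "(\<Sum>u\<in>U. \<Sum>i<n. (g * x u i)\<^sup>2) \<le> (\<Sum>u\<in>U. n * P u)" by (intro sum_mono xu)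
      also have "\<dots> \<le> n * s" using Ps by (simp add: sum_distrib_left[symmetric] mult_left_mono)
      finally show ?thesis .
    qed
    have Xeq: "X x i = (\<Sum>u\<in>U. g * x u i)" for i by (simp add: X_def sum_distrib_left)
    have sq: "(\<Sum>i<n. (X x i)\<^sup>2) \<le> card U * (n * s)"
    proof -
      have "(\<Sum>i<n. (X x i)\<^sup>2) \<le> (\<Sum>i<n. card U * (\<Sum>u\<in>U. (g * x u i)\<^sup>2))"
        unfolding Xeq by (intro sum_mono order_trans[OF sum_squared_le_sum_of_squares]) (auto simp: U mult.commute)
      also have "\<dots> = card U * (\<Sum>u\<in>U. \<Sum>i<n. (g * x u i)\<^sup>2)"
        unfolding sum_distrib_left[symmetric] by (subst sum.swap) simp
      also have "\<dots> \<le> card U * (n * s)" by (intro mult_left_mono sumP) auto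
      finally show ?thesis .
    qed
    have cr: "(\<Sum>i<n. (X x i)\<^sup>2) = (\<Sum>u\<in>U. \<Sum>i<n. (g * x u i)\<^sup>2) + cr x"
    proof -
      have "(\<Sum>i<n. (X x i)\<^sup>2) = (\<Sum>i<n. \<Sum>p\<in>U \<times> U. (g * x (fst p) i) * (g * x (snd p) i))"
        unfolding Xeq power2_eq_square sum_product sum.cartesian_product by (simp add: case_prod_unfold)
      also have "\<dots> = (\<Sum>p\<in>U \<times> U. \<Sum>i<n. (g * x (fst p) i) * (g * x (snd p) i))" by (rule sum.swap)
      also have "\<dots> = (\<Sum>p\<in>(\<lambda>u. (u, u)) ` U \<union> W. \<Sum>i<n. (g * x (fst p) i) * (g * x (snd p) i))"
        by (intro sum.cong) (auto simp: W_def)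
      also have "\<dots> = (\<Sum>p\<in>(\<lambda>u. (u, u)) ` U. \<Sum>i<n. (g * x (fst p) i) * (g * x (snd p) i)) + cr x"
        unfolding cr_def case_prod_unfold
        by (subst sum.union_disjoint) (auto simp: U W_def intro: finite_subset[of _ "U \<times> U"])
      also have "(\<Sum>p\<in>(\<lambda>u. (u, u)) ` U. \<Sum>i<n. (g * x (fst p) i) * (g * x (snd p) i))
          = (\<Sum>u\<in>U. \<Sum>i<n. (g * x u i)\<^sup>2)"
        by (subst sum.reindex) (auto simp: inj_on_def power2_eq_square)
      finally show ?thesis .
    qed
    have "measure (gauss_vec n) {z \<in> space (gauss_vec n).
        \<not> (\<Sum>i<n. (X x i - \<alpha> * (X x i + z i))\<^sup>2) \<le> n * (\<alpha> + \<delta>)}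
       \<le> 3 * (2 * real n + 4 * (\<Sum>i<n. (X x i)\<^sup>2) + \<bar>cr x\<bar>\<^sup>2) / (n * \<delta>)\<^sup>2"
      by (rule mmse_noise_tail[OF s \<alpha> \<delta> n]) (use cr sumP in auto)
    also have "\<dots> \<le> 3 * (2 * real n + 4 * (card U * (n * s)) + (cr x)\<^sup>2) / (n * \<delta>)\<^sup>2"
      using sq by (intro divide_right_mono mult_left_mono add_mono) auto
    finally show ?thesis .
  qed
  have "(\<Sum>x\<in>PiE U T. measure (gauss_vec n) {z \<in> space (gauss_vec n).
       \<not> (\<Sum>i<n. (X x i - \<alpha> * (X x i + z i))\<^sup>2) \<le> n * (\<alpha> + \<delta>)})
     \<le> (\<Sum>x\<in>PiE U T. 3 * (2 * real n + 4 * (card U * (n * s)) + (cr x)\<^sup>2) / (n * \<delta>)\<^sup>2)"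
    by (intro sum_mono point)
  also have "\<dots> = 3 * (card (PiE U T) * (2 * real n + 4 * (card U * (n * s))) + (\<Sum>x\<in>PiE U T. (cr x)\<^sup>2)) / (n * \<delta>)\<^sup>2"
    by (simp add: sum_divide_distrib[symmetric] sum_distrib_left[symmetric] sum.distrib)
  also have "\<dots> \<le> 3 * (card (PiE U T) * (2 * real n + 4 * (card U * (n * s)))
      + card (PiE U T) * (real (card U) ^ 4 * (n * s\<^sup>2))) / (n * \<delta>)\<^sup>2"
    using cross_terms_average[OF U g n P0 Ps]
    by (intro divide_right_mono mult_left_mono add_mono order_refl) (auto simp: cr_def T_def W_def)
  also have "\<dots> = card (PiE U T) * (3 * (2 + 4 * card U * s + real (card U) ^ 4 * s\<^sup>2) / \<delta>\<^sup>2 / n)"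
    using n \<delta> by (simp add: field_simps power2_eq_square)
  finally show ?thesis by (simp add: X_def)
qed

section \<open>Random cosets\<close>

text \<open>Sum and integral are exchanged, so the noise can be fixed first. If \<open>X\<close>
  itself lies in the ball around the scaled output, all competitors do too: there are at most
  \<open>Nmax\<close> of them, and each differs from \<open>X\<close> by at most \<open>L\<close>
  per coordinate, the diameter in grid steps. By linearity of the hash each collides with
  \<open>X\<close> for at most a fraction \<open>L / q\<close> of the hashes.\<close>

lemma hash_collision_expectation:
  fixes g \<rho> \<alpha> :: real and Nmax L q :: nat and X :: "nat \<Rightarrow> int"
  assumes g: "g > 0" and q: "q > 0" and X: "X \<in> int_vecs n"
    and \<Lambda>: "finite \<Lambda>" "\<Lambda> \<subseteq> int_vecs n"
    and Nmax: "\<And>y. card (grid_ball n g \<rho> y) \<le> Nmax" and L: "2 * sqrt \<rho> / g \<le> L"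
  defines "B \<equiv> \<lambda>\<mu> z. (\<Sum>i<n. (g * real_of_int (\<mu> i) - \<alpha> * (g * X i + z i))\<^sup>2) \<le> \<rho>"
  shows "(\<Sum>h\<in>PiE {..<n} (\<lambda>_. {0..<int q}). measure (gauss_vec n)
      {z \<in> space (gauss_vec n). B X z \<and> (\<exists>\<mu>\<in>\<Lambda>. \<mu> \<noteq> X \<and> hash n q h \<mu> = hash n q h X \<and> B \<mu> z)})
    \<le> real q ^ n * (Nmax * L / q)"
proof -
  interpret prob_space "gauss_vec n" by (rule prob_space_gauss_vec)
  let ?H = "PiE {..<n} (\<lambda>_. {0..<int q})"
  define Ev where "Ev = (\<lambda>h. {z \<in> space (gauss_vec n). B X z \<and> (\<exists>\<mu>\<in>\<Lambda>. \<mu> \<noteq> X \<and> hash n q h \<mu> = hash n q h X \<and> B \<mu> z)})"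
  have finH: "finite ?H" by (intro finite_PiE) auto
  have Bm [measurable]: "Measurable.pred (gauss_vec n) (B \<mu>)" for \<mu> unfolding B_def by measurable
  have Ev: "Ev h \<in> sets (gauss_vec n)" for h unfolding Ev_def using \<Lambda>(1) by measurable
  have count: "(\<Sum>h\<in>?H. indicator (Ev h) z) \<le> real q ^ n * (Nmax * L / q)" for z
  proof (cases "B X z")
    case False
    then have "(\<Sum>h\<in>?H. indicator (Ev h) z) = (0::real)" by (intro sum.neutral) (auto simp: Ev_def)
    then show ?thesis by simp
  next
    case True
    define y where "y = (\<lambda>i. \<alpha> * (g * X i + z i))"
    let ?G = "grid_ball n g \<rho> y"
    have XG: "X \<in> ?G" using True X by (simp add: B_def grid_ball_def y_def)
    have finG: "finite ?G" by (rule finite_grid_ball[OF g])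
    have "(\<Sum>h\<in>?H. indicator (Ev h) z) = real (card {h \<in> ?H. z \<in> Ev h})"
      using sum.inter_filter[OF finH, of "\<lambda>_. 1::real" "\<lambda>h. z \<in> Ev h"] by (simp add: indicator_def of_bool_def)
    also have "card {h \<in> ?H. z \<in> Ev h} \<le> card (\<Union>\<mu>\<in>?G - {X}. {h \<in> ?H. hash n q h (\<lambda>i. \<mu> i - X i) = 0})"
    proof (rule card_mono)
      show "finite (\<Union>\<mu>\<in>?G - {X}. {h \<in> ?H. hash n q h (\<lambda>i. \<mu> i - X i) = 0})" using finG finH by auto
      show "{h \<in> ?H. z \<in> Ev h} \<subseteq> (\<Union>\<mu>\<in>?G - {X}. {h \<in> ?H. hash n q h (\<lambda>i. \<mu> i - X i) = 0})"
      proof safe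
        fix h assume h: "h \<in> ?H" "z \<in> Ev h"
        then obtain l where l: "l \<in> \<Lambda>" "l \<noteq> X" "hash n q h l = hash n q h X" "B l z" by (auto simp: Ev_def)
        have "l \<in> ?G" using l \<Lambda>(2) by (auto simp: B_def grid_ball_def y_def)
        moreover have "hash n q h (\<lambda>i. l i - X i) = 0"
          using l(3) by (simp add: hash_def mod_eq_dvd_iff right_diff_distrib sum_subtractf)
        ultimately show "h \<in> (\<Union>\<mu>\<in>?G - {X}. {h \<in> ?H. hash n q h (\<lambda>i. \<mu> i - X i) = 0})"
          using l(2) h(1) by blast
      qed
    qed
    also have "real (card (\<Union>\<mu>\<in>?G - {X}. {h \<in> ?H. hash n q h (\<lambda>i. \<mu> i - X i) = 0}))
       \<le> (\<Sum>\<mu>\<in>?G - {X}. real (card {h \<in> ?H. hash n q h (\<lambda>i. \<mu> i - X i) = 0}))"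
      using card_UN_le[of "?G - {X}" "\<lambda>\<mu>. {h \<in> ?H. hash n q h (\<lambda>i. \<mu> i - X i) = 0}"] finG
      by (simp flip: of_nat_sum)
    also have "\<dots> \<le> (\<Sum>\<mu>\<in>?G - {X}. real q ^ n * (L / q))"
    proof (intro sum_mono hash_zero_card_le q)
      fix l assume l: "l \<in> ?G - {X}"
      show "(\<lambda>i. l i - X i) \<in> int_vecs n" using l X by (auto simp: grid_ball_def int_vecs_def)
      show "(\<lambda>i. l i - X i) \<noteq> (\<lambda>_. 0)" using l by (auto simp: fun_eq_iff)
      fix i assume i: "i < n"
      have "\<bar>g * real_of_int (l i) - y i\<bar> \<le> sqrt \<rho>" "\<bar>g * real_of_int (X i) - y i\<bar> \<le> sqrt \<rho>"
        using grid_ball_coord[OF _ i] l XG by auto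
      then have "\<bar>g * (real_of_int (l i) - X i)\<bar> \<le> 2 * sqrt \<rho>" by (simp add: right_diff_distrib abs_le_iff)
      then have "\<bar>real_of_int (l i) - X i\<bar> \<le> 2 * sqrt \<rho> / g"
        using g unfolding abs_mult pos_le_divide_eq[OF g] by (simp add: mult.commute)
      also note L
      finally show "\<bar>l i - X i\<bar> \<le> int L" by linarith
    qed
    also have "\<dots> = card (?G - {X}) * (real q ^ n * (L / q))" by simp
    also have "\<dots> \<le> Nmax * (real q ^ n * (L / q))"
      using order_trans[OF card_mono[OF finG, of "?G - {X}"] Nmax[of y]] by (intro mult_right_mono) auto
    finally show ?thesis by (simp add: mult_ac)
  qed
  have "(\<Sum>h\<in>?H. measure (gauss_vec n) (Ev h)) = (\<integral>z. (\<Sum>h\<in>?H. indicator (Ev h) z) \<partial>gauss_vec n)"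
    using Ev by (subst Bochner_Integration.integral_sum) (auto simp: emeasure_eq_measure)
  also have "\<dots> \<le> real q ^ n * (Nmax * L / q)"
    using Ev count by (intro integral_le_const) (auto intro!: Bochner_Integration.integrable_sum simp: emeasure_eq_measure)
  finally show ?thesis by (simp add: Ev_def)
qed

text \<open>A uniformly chosen tuple rarely lies in a small coset, so all cosets can be taken large.\<close>
lemma coset_selection:
  fixes k :: "'h \<Rightarrow> 'x \<Rightarrow> int" and err :: "'h \<Rightarrow> ('u \<Rightarrow> 'x) \<Rightarrow> real" and q :: nat and t :: "'u \<Rightarrow> real" and \<eta> :: real
  assumes H: "finite H" "H \<noteq> {}" and U: "finite U" and T: "\<And>u. u \<in> U \<Longrightarrow> finite (T u)" "\<And>u. u \<in> U \<Longrightarrow> T u \<noteq> {}"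
    and k: "\<And>h x. k h x \<in> {0..<int q}" and \<eta>: "\<eta> > 0"
    and err0: "\<And>h x. err h x \<ge> 0"
    and err: "(\<Sum>h\<in>H. \<Sum>x\<in>PiE U T. err h x) \<le> card H * (card (PiE U T) * (\<eta> / 2))"
    and t: "\<And>u. u \<in> U \<Longrightarrow> 4 * card U * (q * t u) \<le> card (T u)" "\<And>u. u \<in> U \<Longrightarrow> t u > 0"
  shows "\<exists>h\<in>H. \<exists>s. (\<forall>u\<in>U. t u \<le> card {x \<in> T u. k h x = s u}) \<and>
     (\<Sum>x\<in>PiE U (\<lambda>u. {x \<in> T u. k h x = s u}). err h x) \<le> \<eta> * card (PiE U (\<lambda>u. {x \<in> T u. k h x = s u}))"
proof -
  define c where "c = (\<lambda>h u y. {x \<in> T u. k h x = k h y})"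
  define sm where "sm = (\<lambda>h u y. of_bool (real (card (c h u y)) < t u) :: real)"
  \<comment> \<open>A score whose positivity delivers both requirements. Its average is at least
    \<open>\<eta> - \<eta> / 2 - \<eta> / 4\<close>, so some hash, and then some choice of cosets,
    has positive total score. If one chosen coset were small, \<open>sm\<close> would be 1 on all
    its tuples and no score could be positive.\<close>
  define \<phi> where "\<phi> = (\<lambda>h x. \<eta> - err h x - \<eta> * (\<Sum>u\<in>U. sm h u (x u)))"
  have finP: "finite (PiE U T)" using U T by (intro finite_PiE) auto
  have neP: "PiE U T \<noteq> {}" using T by (simp add: PiE_eq_empty_iff)
  have small: "(\<Sum>x\<in>PiE U T. sm h u (x u)) \<le> card (PiE U T) * (1 / (4 * card U))" if u: "u \<in> U" for h u
  proof (rule sum_PiE_le[of u])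
    fix x assume "x \<in> PiE U T"
    have K: "card U > 0" using u U by (auto simp: card_gt_0_iff)
    let ?bad = "{y \<in> T u. real (card (c h u y)) < t u}"
    have "(\<Sum>y\<in>T u. sm h u ((x(u := y)) u)) = real (card ?bad)"
      using T(1)[OF u] by (simp add: sm_def Int_def)
    also have "card ?bad \<le> card (\<Union>j\<in>{0..<int q}. {y \<in> ?bad. k h y = j})"
      using T(1)[OF u] k[of h] by (intro card_mono) auto
    also have "real (card (\<Union>j\<in>{0..<int q}. {y \<in> ?bad. k h y = j})) \<le> (\<Sum>j\<in>{0..<int q}. real (card {y \<in> ?bad. k h y = j}))"
      using card_UN_le[of "{0..<int q}" "\<lambda>j. {y \<in> ?bad. k h y = j}"] by (simp flip: of_nat_sum)
    also have "\<dots> \<le> (\<Sum>j\<in>{0..<int q}. t u)"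
    proof (rule sum_mono)
      fix j
      show "real (card {y \<in> ?bad. k h y = j}) \<le> t u"
      proof (cases "{y \<in> ?bad. k h y = j} = {}")
        case True
        show ?thesis unfolding True using t(2)[OF u] by simp
      next
        case False
        then obtain y where y: "y \<in> ?bad" "k h y = j" by blast
        have "card {y \<in> ?bad. k h y = j} \<le> card (c h u y)"
          using y T(1)[OF u] by (intro card_mono) (auto simp: c_def)
        then show ?thesis using y by auto
      qed
    qed
    also have "\<dots> = q * t u" by simp
    also have "\<dots> \<le> card (T u) * (1 / (4 * card U))" using t(1)[OF u] K by (simp add: field_simps)
    finally show "(\<Sum>y\<in>T u. sm h u ((x(u := y)) u)) \<le> card (T u) * (1 / (4 * card U))" by simp
  qed (use u T in auto)
  have small2: "(\<Sum>x\<in>PiE U T. \<Sum>u\<in>U. sm h u (x u)) \<le> card (PiE U T) * (1 / 4)" for h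
  proof -
    have "(\<Sum>x\<in>PiE U T. \<Sum>u\<in>U. sm h u (x u)) = (\<Sum>u\<in>U. \<Sum>x\<in>PiE U T. sm h u (x u))" by (rule sum.swap)
    also have "\<dots> \<le> (\<Sum>u\<in>U. card (PiE U T) * (1 / (4 * card U)))" by (intro sum_mono small)
    also have "\<dots> \<le> card (PiE U T) * (1 / 4)" by (cases "card U = 0") auto
    finally show ?thesis .
  qed
  have pos: "(\<Sum>h\<in>H. \<Sum>x\<in>PiE U T. \<phi> h x) > 0"
  proof -
    have cpos: "0 < real (card H) * real (card (PiE U T))" using H finP neP by (simp add: card_gt_0_iff)
    have "(\<Sum>h\<in>H. \<Sum>x\<in>PiE U T. \<phi> h x) = card H * card (PiE U T) * \<eta> - (\<Sum>h\<in>H. \<Sum>x\<in>PiE U T. err h x)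
        - \<eta> * (\<Sum>h\<in>H. \<Sum>x\<in>PiE U T. \<Sum>u\<in>U. sm h u (x u))"
      by (simp add: \<phi>_def sum_subtractf sum_distrib_left)
    also have "\<dots> \<ge> card H * card (PiE U T) * \<eta> - card H * (card (PiE U T) * (\<eta> / 2))
        - \<eta> * (\<Sum>h\<in>H. card (PiE U T) * (1 / 4))"
      using \<eta> by (intro diff_mono order_refl err mult_left_mono sum_mono small2) auto
    also have "card H * card (PiE U T) * \<eta> - card H * (card (PiE U T) * (\<eta> / 2))
        - \<eta> * (\<Sum>h\<in>H. card (PiE U T) * (1 / 4)) = (real (card H) * real (card (PiE U T))) * (\<eta> / 4)"
      by (simp add: field_simps)
    finally have "(real (card H) * real (card (PiE U T))) * (\<eta> / 4) \<le> (\<Sum>h\<in>H. \<Sum>x\<in>PiE U T. \<phi> h x)" .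
    moreover have "0 < (real (card H) * real (card (PiE U T))) * (\<eta> / 4)"
      using cpos \<eta> by (intro mult_pos_pos[of "real (card H) * real (card (PiE U T))"]) auto
    ultimately show ?thesis by linarith
  qed
  then obtain h where h: "h \<in> H" "(\<Sum>x\<in>PiE U T. \<phi> h x) > 0"
    using sum_nonpos[of H "\<lambda>h. \<Sum>x\<in>PiE U T. \<phi> h x"] by (auto simp: not_le[symmetric])
  let ?S = "PiE U (\<lambda>_. {0..<int q})" and ?\<sigma> = "\<lambda>x. \<lambda>u\<in>U. k h (x u)"
  \<comment> \<open>For a fixed hash the tuples are partitioned by their vector of hash values; each
    class is a product of cosets.\<close>
  have "(\<Sum>x\<in>PiE U T. \<phi> h x) = (\<Sum>s\<in>?S. \<Sum>x\<in>{x \<in> PiE U T. ?\<sigma> x = s}. \<phi> h x)"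
  proof (intro sum.group[symmetric] finP finite_PiE U)
    show "?\<sigma> ` PiE U T \<subseteq> ?S" by (intro image_subsetI restrict_PiE_iff[THEN iffD2] ballI k)
  qed auto
  then obtain s where s: "s \<in> ?S" "(\<Sum>x\<in>{x \<in> PiE U T. ?\<sigma> x = s}. \<phi> h x) > 0"
    using h(2) sum_nonpos[of ?S "\<lambda>s. \<Sum>x\<in>{x \<in> PiE U T. ?\<sigma> x = s}. \<phi> h x"] by (auto simp: not_le[symmetric])
  define A where "A = (\<lambda>u. {x \<in> T u. k h x = s u})"
  have Aeq: "{x \<in> PiE U T. ?\<sigma> x = s} = PiE U A"
  proof (intro set_eqI iffI)
    fix x assume "x \<in> {x \<in> PiE U T. ?\<sigma> x = s}"
    then show "x \<in> PiE U A" by (auto simp: A_def PiE_iff)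
  next
    fix x assume x: "x \<in> PiE U A"
    then have "?\<sigma> x = s" using s(1) by (auto simp: A_def PiE_iff fun_eq_iff restrict_def extensional_def)
    then show "x \<in> {x \<in> PiE U T. ?\<sigma> x = s}" using x by (auto simp: A_def PiE_iff)
  qed
  have cA: "c h u (x u) = A u" if "x \<in> PiE U A" "u \<in> U" for x u
    using PiE_mem[OF that] by (auto simp: c_def A_def)
  have large: "t u \<le> card (A u)" if u: "u \<in> U" for u
  proof (rule ccontr)
    assume "\<not> t u \<le> card (A u)"
    then have "\<phi> h x \<le> 0" if x: "x \<in> PiE U A" for x
    proof -
      have "1 = sm h u (x u)" using \<open>\<not> t u \<le> card (A u)\<close> by (simp add: sm_def cA[OF x u])
      also have "\<dots> \<le> (\<Sum>u\<in>U. sm h u (x u))" using u U by (intro member_le_sum) (auto simp: sm_def)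
      finally have "\<eta> * 1 \<le> \<eta> * (\<Sum>u\<in>U. sm h u (x u))" using \<eta> by (intro mult_left_mono) auto
      then show ?thesis using err0[of h x] by (simp add: \<phi>_def)
    qed
    then have "(\<Sum>x\<in>PiE U A. \<phi> h x) \<le> 0" by (intro sum_nonpos)
    then show False using s(2) by (simp add: Aeq)
  qed
  have "(\<Sum>x\<in>PiE U A. \<phi> h x) \<le> (\<Sum>x\<in>PiE U A. \<eta> - err h x)"
    using \<eta> by (intro sum_mono) (auto simp: \<phi>_def sm_def intro!: mult_nonneg_nonneg sum_nonneg)
  also have "\<dots> = \<eta> * card (PiE U A) - (\<Sum>x\<in>PiE U A. err h x)" by (simp add: sum_subtractf)
  finally have "(\<Sum>x\<in>PiE U A. err h x) \<le> \<eta> * card (PiE U A)" using s(2) by (simp add: Aeq)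
  then show ?thesis using h(1) large unfolding A_def by blast
qed

section \<open>Codes for decoding a sum at one receiver\<close>

lemma nat_ratio_between:
  fixes x y :: real
  assumes "0 \<le> x" "x < y"
  obtains a b :: nat where "a > 0" "b > 0" "x < a / b" "a / b < y"
proof -
  obtain q where q: "q \<in> \<rat>" "x < q" "q < y" using Rats_dense_in_real[OF assms(2)] by auto
  then obtain m n :: nat where mn: "n \<noteq> 0" "\<bar>q\<bar> = m / n" by (auto elim: Rats_abs_nat_div_natE)
  have "q = m / n" using q assms mn by simp
  moreover have "m > 0" using q assms mn by (cases "m = 0") auto
  ultimately show ?thesis using q mn that[of m n] by auto
qed

lemma eventually_linear_le_power:
  fixes \<theta> C1 C2 :: real
  assumes "\<theta> > 1"
  shows "eventually (\<lambda>n. C1 * real n + C2 \<le> \<theta> ^ n) sequentially"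
proof -
  have n: "norm (1 / \<theta>) < 1" using assms by simp
  have "(\<lambda>n. C1 * (real n * (1 / \<theta>) ^ n) + C2 * (1 / \<theta>) ^ n) \<longlonglongrightarrow> C1 * 0 + C2 * 0"
    by (intro tendsto_intros powser_times_n_limit_0[OF n] LIMSEQ_power_zero[OF n])
  then have "eventually (\<lambda>n. C1 * (real n * (1 / \<theta>) ^ n) + C2 * (1 / \<theta>) ^ n < 1) sequentially"
    by (rule order_tendstoD(2)) simp
  then show ?thesis
  proof eventually_elim
    case (elim n)
    then have "(C1 * real n + C2) / \<theta> ^ n < 1" by (simp add: power_one_over add_divide_distrib)
    then show ?case using assms by (simp add: field_simps)
  qed
qed

lemma hash_sum: "hash n q h (\<lambda>i. \<Sum>u\<in>U. x u i) = (\<Sum>u\<in>U. hash n q h (x u)) mod int q"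
proof -
  have "(\<Sum>i<n. h i * (\<Sum>u\<in>U. x u i)) = (\<Sum>u\<in>U. \<Sum>i<n. h i * x u i)"
    unfolding sum_distrib_left by (rule sum.swap)
  then show ?thesis by (simp add: hash_def mod_sum_eq)
qed

text \<open>The number \<open>Nmax\<close> of grid points in a noise ball cancels. The hash modulus
  \<open>q\<close> is \<open>Nmax\<close> times a factor linear in n, while
  \<open>grid_ball_scale\<close> gives at least \<open>Nmax * (a / b) ^ n\<close> points in each
  power ball. Dividing by \<open>q\<close> leaves (a/b)^n up to a linear factor, and
  \<open>a / b > 2 powr r u\<close> absorbs that factor. The event in the sum is failure of unique
  decoding: within the noise ball there should be the true sum and no other.\<close>

lemma sum_computation_integer_code:
  fixes U :: "'u set" and P r :: "'u \<Rightarrow> real" and s \<eta> :: real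
  assumes U: "finite U" and s: "s > 0" and Ps: "(\<Sum>u\<in>U. P u) \<le> s" and P: "\<And>u. u \<in> U \<Longrightarrow> P u > 0"
    and rate: "\<And>u. u \<in> U \<Longrightarrow> 2 powr (2 * r u) * (s / (1 + s)) < P u" and \<eta>: "\<eta> > 0"
  defines "\<alpha> \<equiv> s / (1 + s)"
  shows "\<exists>g::real. g > 0 \<and> (\<exists>N'. \<exists>n0. \<forall>n\<ge>n0. \<exists>A :: 'u \<Rightarrow> (nat \<Rightarrow> int) set.
     (\<forall>u\<in>U. A u \<subseteq> grid_ball n g (n * P u) (\<lambda>_. 0) \<and> 2 powr (n * r u) \<le> card (A u)) \<and>
     (\<Sum>x\<in>PiE U A. measure (gauss_vec n) {z \<in> space (gauss_vec n).
        \<not> (\<forall>x'\<in>PiE U A. (\<Sum>i<n. (g * (\<Sum>u\<in>U. x' u i) - \<alpha> * (g * (\<Sum>u\<in>U. x u i) + z i))\<^sup>2) \<le> n * N'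
              \<longleftrightarrow> (\<lambda>i. \<Sum>u\<in>U. x' u i) = (\<lambda>i. \<Sum>u\<in>U. x u i))})
       \<le> \<eta> * card (PiE U A))"
proof -
  have al: "0 < \<alpha>" "\<alpha> < 1" using s by (auto simp: \<alpha>_def)
  define K where "K = card U"
  \<comment> \<open>The rate condition says that \<open>2 powr r u\<close> is below the ratio of the
    radii of the power ball and the noise ball; a rational number strictly between them is the scale
    factor for \<open>grid_ball_scale\<close>.\<close>
  define good where "good = (\<lambda>u a b. 0 < (a::nat) \<and> 0 < (b::nat) \<and> 2 powr r u < real a / real b
      \<and> real a / real b < sqrt (P u) / sqrt \<alpha>)"
  have "\<exists>a b. good u a b" if u: "u \<in> U" for u
  proof -
    have "(2 powr r u * sqrt \<alpha>)\<^sup>2 < P u"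
      using rate[OF u] al by (simp add: power_mult_distrib \<alpha>_def powr_power mult.commute)
    then have "2 powr r u * sqrt \<alpha> < sqrt (P u)"
      using P[OF u] by (intro real_less_rsqrt)
    then have "2 powr r u < sqrt (P u) / sqrt \<alpha>" using al by (simp add: field_simps)
    then obtain a b :: nat where "a > 0" "b > 0" "2 powr r u < a / b" "a / b < sqrt (P u) / sqrt \<alpha>"
      by (rule nat_ratio_between[OF powr_ge_zero])
    then have "good u a b" by (simp add: good_def)
    then show ?thesis by blast
  qed
  then obtain a b where "\<And>u. u \<in> U \<Longrightarrow> good u (a u) (b u)" by metis
  then have ab: "a u > 0 \<and> b u > 0 \<and> 2 powr r u < a u / b u \<and> a u / b u < sqrt (P u) / sqrt \<alpha>"
    if "u \<in> U" for u using that by (simp add: good_def)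
  \<comment> \<open>One small \<open>\<epsilon>\<close> acts both as the grid step and as the margin
    of the noise power. It does not depend on n, because the strict inequality at
    \<open>\<epsilon> = 0\<close> is stable.\<close>
  have "eventually (\<lambda>\<epsilon>. \<forall>u\<in>U. (a u / b u) * sqrt (\<alpha> + \<epsilon>) + \<epsilon> * (a u / b u + 1) < sqrt (P u)) (at_right 0)"
  proof (rule eventually_ball_finite[OF U], rule ballI)
    fix u assume u: "u \<in> U"
    have "((\<lambda>\<epsilon>. (a u / b u) * sqrt (\<alpha> + \<epsilon>) + \<epsilon> * (a u / b u + 1)) \<longlongrightarrow> (a u / b u) * sqrt (\<alpha> + 0) + 0 * (a u / b u + 1)) (at_right 0)"
      by (intro tendsto_intros)
    moreover have "(a u / b u) * sqrt (\<alpha> + 0) + 0 * (a u / b u + 1) < sqrt (P u)"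
      using ab[OF u] al by (simp add: field_simps)
    ultimately show "eventually (\<lambda>\<epsilon>. (a u / b u) * sqrt (\<alpha> + \<epsilon>) + \<epsilon> * (a u / b u + 1) < sqrt (P u)) (at_right 0)"
      by (rule order_tendstoD(2))
  qed
  then have "eventually (\<lambda>\<epsilon>. \<epsilon> > 0 \<and> (\<forall>u\<in>U. (a u / b u) * sqrt (\<alpha> + \<epsilon>) + \<epsilon> * (a u / b u + 1) < sqrt (P u))) (at_right (0::real))"
    using eventually_at_right_less by eventually_elim auto
  then obtain \<epsilon> :: real where \<epsilon>: "\<epsilon> > 0" "\<And>u. u \<in> U \<Longrightarrow> (a u / b u) * sqrt (\<alpha> + \<epsilon>) + \<epsilon> * (a u / b u + 1) < sqrt (P u)"
    using eventually_happens'[OF trivial_limit_at_right_real] by blast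
  define N' where "N' = \<alpha> + \<epsilon>"
  have N': "N' > 0" using al \<epsilon> by (simp add: N'_def)
  define C where "C = 3 * (2 + 4 * card U * s + real (card U) ^ 4 * s\<^sup>2) / \<epsilon>\<^sup>2"
  define c0 where "c0 = 2 * sqrt N' / \<epsilon>"
  have c0: "c0 > 0" using N' \<epsilon> by (simp add: c0_def)
  \<comment> \<open>\<open>D1 * n + D2\<close> will bound \<open>4 * K * q / Nmax\<close>:
    \<open>c0 * n + 1\<close> bounds the coordinate diameter \<open>L\<close>, and \<open>q\<close>
    is at most \<open>4 * Nmax * L / \<eta> + 2\<close>.\<close>
  define D1 where "D1 = 4 * K * (4 * c0 / \<eta>)"
  define D2 where "D2 = 4 * K * (4 / \<eta> + 2)"
  have "eventually (\<lambda>n. \<forall>u\<in>U. D1 * real n + D2 \<le> ((a u / b u) / 2 powr r u) ^ n) sequentially"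
  proof (rule eventually_ball_finite[OF U], rule ballI)
    fix u assume "u \<in> U"
    then have "2 powr r u < a u / b u" using ab[of u] by blast
    then have "1 < (a u / b u) / 2 powr r u"
      by (rule less_divide_eq_1_pos[THEN iffD2, rotated]) simp
    then show "eventually (\<lambda>n. D1 * real n + D2 \<le> ((a u / b u) / 2 powr r u) ^ n) sequentially"
      by (rule eventually_linear_le_power)
  qed
  moreover have "eventually (\<lambda>n. C / real n < \<eta> / 4) sequentially"
    by (rule order_tendstoD(2)[OF lim_const_over_n]) (use \<eta> in simp)
  moreover have "eventually (\<lambda>n. n > 0) sequentially" by (rule eventually_gt_at_top)
  ultimately have "eventually (\<lambda>n. n > 0 \<and> C / real n < \<eta> / 4 \<and> (\<forall>u\<in>U. D1 * real n + D2 \<le> ((a u / b u) / 2 powr r u) ^ n)) sequentially"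
    by eventually_elim auto
  then obtain n0 where n0: "\<And>n. n \<ge> n0 \<Longrightarrow> n > 0 \<and> C / real n < \<eta> / 4 \<and> (\<forall>u\<in>U. D1 * real n + D2 \<le> ((a u / b u) / 2 powr r u) ^ n)"
    by (auto simp: eventually_sequentially)
  have main: "\<exists>A :: 'u \<Rightarrow> (nat \<Rightarrow> int) set.
     (\<forall>u\<in>U. A u \<subseteq> grid_ball n \<epsilon> (n * P u) (\<lambda>_. 0) \<and> 2 powr (n * r u) \<le> card (A u)) \<and>
     (\<Sum>x\<in>PiE U A. measure (gauss_vec n) {z \<in> space (gauss_vec n).
        \<not> (\<forall>x'\<in>PiE U A. (\<Sum>i<n. (\<epsilon> * (\<Sum>u\<in>U. x' u i) - \<alpha> * (\<epsilon> * (\<Sum>u\<in>U. x u i) + z i))\<^sup>2) \<le> n * N'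
              \<longleftrightarrow> (\<lambda>i. \<Sum>u\<in>U. x' u i) = (\<lambda>i. \<Sum>u\<in>U. x u i))})
       \<le> \<eta> * card (PiE U A)" if n: "n \<ge> n0" for n
  proof -
    interpret G: prob_space "gauss_vec n" by (rule prob_space_gauss_vec)
    have npos: "n > 0" and Cn: "C / real n < \<eta> / 4"
      and Dn: "\<And>u. u \<in> U \<Longrightarrow> D1 * real n + D2 \<le> ((a u / b u) / 2 powr r u) ^ n" using n0[OF n] by auto
    define T where "T = (\<lambda>u. grid_ball n \<epsilon> (n * P u) (\<lambda>_. 0))"
    define X where "X = (\<lambda>(x :: 'u \<Rightarrow> nat \<Rightarrow> int) i. \<Sum>u\<in>U. x u i)"
    define \<Lambda> where "\<Lambda> = X ` PiE U T"
    define \<rho> where "\<rho> = n * N'"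
    define L where "L = nat \<lceil>2 * sqrt \<rho> / \<epsilon>\<rceil>"
    have finT: "finite (T u)" for u unfolding T_def by (rule finite_grid_ball[OF \<epsilon>(1)])
    have neT: "T u \<noteq> {}" if "u \<in> U" for u
    proof -
      have "(\<lambda>_. 0) \<in> T u" using P[OF that] by (simp add: T_def grid_ball_def int_vecs_def)
      then show ?thesis by auto
    qed
    have finP: "finite (PiE U T)" using U finT by (intro finite_PiE) auto
    have X_in: "X x \<in> int_vecs n" if "x \<in> PiE U T" for x
      using PiE_mem[OF that] by (auto simp: X_def int_vecs_def T_def grid_ball_def intro!: sum.neutral)
    \<comment> \<open>The centre of a fullest ball is needed explicitly, since
      \<open>grid_ball_scale\<close> compares the power ball with a ball around a given
      centre.\<close>
    have "\<exists>y. \<forall>y'. card (grid_ball n \<epsilon> \<rho> y') \<le> card (grid_ball n \<epsilon> \<rho> y)"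
    proof -
      obtain Kb where Kb: "\<And>y. card (grid_ball n \<epsilon> \<rho> y) \<le> Kb"
        using grid_ball_card_bounded[OF \<epsilon>(1), of n \<rho>] by auto
      then show ?thesis
        using ex_has_greatest_nat[of "\<lambda>_. True" undefined "\<lambda>y. card (grid_ball n \<epsilon> \<rho> y)" "Suc Kb"]
        by (auto simp: less_Suc_eq_le)
    qed
    then obtain y0 where y0: "\<And>y'. card (grid_ball n \<epsilon> \<rho> y') \<le> card (grid_ball n \<epsilon> \<rho> y0)" by auto
    define Nmax where "Nmax = card (grid_ball n \<epsilon> \<rho> y0)"
    have N1: "Nmax \<ge> 1"
    proof -
      have "(\<lambda>_. 0) \<in> grid_ball n \<epsilon> \<rho> (\<lambda>_. 0)" using N' by (simp add: grid_ball_def int_vecs_def \<rho>_def)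
      then have "card (grid_ball n \<epsilon> \<rho> (\<lambda>_. 0)) \<ge> 1"
        using finite_grid_ball[OF \<epsilon>(1)] by (auto simp: Suc_le_eq card_gt_0_iff)
      then show ?thesis using y0[of "\<lambda>_. 0"] by (simp add: Nmax_def)
    qed
    have Lge: "2 * sqrt \<rho> / \<epsilon> \<le> L" unfolding L_def by linarith
    have Lle: "L \<le> c0 * n + 1"
    proof -
      have "sqrt (real n) \<le> n" using npos by (intro real_le_lsqrt) (auto simp: power2_eq_square)
      then have "2 * sqrt \<rho> / \<epsilon> \<le> c0 * n"
        using c0 mult_left_mono[of "sqrt n" n c0] by (simp add: \<rho>_def c0_def real_sqrt_mult mult_ac)
      moreover have "0 \<le> 2 * sqrt \<rho> / \<epsilon>" using \<epsilon> N' by (simp add: \<rho>_def)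
      ultimately show ?thesis unfolding L_def by linarith
    qed
    \<comment> \<open>Large enough that the expected collision probability
      \<open>Nmax * L / q\<close> is at most \<open>\<eta> / 4\<close>; the 1 keeps \<open>q\<close>
      positive.\<close>
    define q where "q = nat \<lceil>Nmax * L * 4 / \<eta>\<rceil> + 1"
    have q0: "q > 0" by (simp add: q_def)
    have qge: "Nmax * L * 4 / \<eta> \<le> q" unfolding q_def by linarith
    have "0 \<le> Nmax * L * 4 / \<eta>" using \<eta> by simp
    then have qle: "q \<le> Nmax * L * 4 / \<eta> + 2" unfolding q_def by linarith
    have Nq: "Nmax * L / q \<le> \<eta> / 4" using qge q0 \<eta> by (simp add: field_simps)
    have card_T: "4 * card U * (q * 2 powr (n * r u)) \<le> card (T u)" if u: "u \<in> U" for u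
    proof -
      have abu: "a u > 0" "b u > 0" using ab[OF u] by auto
      have "Nmax * a u ^ n \<le> card (T u) * b u ^ n"
        unfolding Nmax_def T_def \<rho>_def
        by (rule grid_ball_scale[OF \<epsilon>(1) abu]) (use \<epsilon>(2)[OF u] N' P[OF u] in \<open>auto simp: N'_def less_imp_le\<close>)
      then have "real Nmax * real (a u) ^ n \<le> card (T u) * real (b u) ^ n"
        by (metis of_nat_le_iff of_nat_mult of_nat_power)
      then have T1: "Nmax * (a u / b u) ^ n \<le> card (T u)" using abu by (simp add: power_divide field_simps)
      have "4 * K * (q::real) \<le> 4 * K * (Nmax * L * 4 / \<eta> + 2)" by (intro mult_left_mono qle) auto
      also have "\<dots> \<le> 4 * K * (Nmax * L * 4 / \<eta> + Nmax * 2)" using N1 by (intro mult_left_mono add_mono) auto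
      also have "\<dots> = Nmax * (4 * K * (4 * L / \<eta> + 2))" by (simp add: algebra_simps)
      also have "\<dots> \<le> Nmax * (4 * K * (4 * (c0 * n + 1) / \<eta> + 2))"
        using \<eta> Lle by (intro mult_left_mono add_mono divide_right_mono) auto
      also have "4 * K * (4 * (c0 * n + 1) / \<eta> + 2) = D1 * n + D2"
        using \<eta> by (simp add: D1_def D2_def field_simps)
      also have "Nmax * (D1 * n + D2) \<le> Nmax * ((a u / b u) / 2 powr r u) ^ n"
        by (intro mult_left_mono Dn[OF u]) auto
      finally have "4 * K * (q::real) * 2 powr (n * r u) \<le> Nmax * ((a u / b u) / 2 powr r u) ^ n * 2 powr (n * r u)"
        by (intro mult_right_mono) auto
      also have "2 powr (n * r u) = (2 powr r u) ^ n" by (simp add: powr_power mult.commute)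
      also have "Nmax * ((a u / b u) / 2 powr r u) ^ n * (2 powr r u) ^ n = Nmax * (a u / b u) ^ n"
        by (simp add: power_divide power_mult_distrib)
      also note T1
      finally show ?thesis by (simp add: K_def powr_power mult.commute mult.left_commute)
    qed
    define B where "B = (\<lambda>x \<mu> z. (\<Sum>i<n. (\<epsilon> * real_of_int ((\<mu> :: nat \<Rightarrow> int) i) - \<alpha> * (\<epsilon> * X x i + z i))\<^sup>2) \<le> \<rho>)"
    have Bm [measurable]: "Measurable.pred (gauss_vec n) (B x \<mu>)" for x \<mu> unfolding B_def by measurable
    define H where "H = PiE {..<n} (\<lambda>_. {0..<int q})"
    \<comment> \<open>Unique decoding fails either because the true sum leaves the ball
      (\<open>E1\<close>) or because a wrong sum of the same hash enters it (\<open>E2\<close>).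
      Each averages to at most \<open>\<eta> / 4\<close>, which is the \<open>\<eta> / 2\<close>
      that \<open>coset_selection\<close> asks for.\<close>
    define E1 where "E1 = (\<lambda>x. {z \<in> space (gauss_vec n). \<not> B x (X x) z})"
    define E2 where "E2 = (\<lambda>h x. {z \<in> space (gauss_vec n). B x (X x) z \<and> (\<exists>\<mu>\<in>\<Lambda>. \<mu> \<noteq> X x \<and> hash n q h \<mu> = hash n q h (X x) \<and> B x \<mu> z)})"
    have fin\<Lambda>: "finite \<Lambda>" using finP by (simp add: \<Lambda>_def)
    have E1m: "E1 x \<in> sets (gauss_vec n)" for x unfolding E1_def by measurable
    have E2m: "E2 h x \<in> sets (gauss_vec n)" for h x unfolding E2_def using fin\<Lambda> by measurable
    have cardH: "card H = q ^ n" by (simp add: H_def card_PiE)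
    have s1: "(\<Sum>x\<in>PiE U T. measure (gauss_vec n) (E1 x)) \<le> card (PiE U T) * (\<eta> / 4)"
    proof -
      have "(\<Sum>x\<in>PiE U T. measure (gauss_vec n) (E1 x)) \<le> card (PiE U T) * (C / n)"
        using mmse_noise_average[OF U \<epsilon>(1) npos _ Ps s refl \<epsilon>(1)] P
        by (simp add: E1_def B_def X_def T_def C_def \<rho>_def N'_def \<alpha>_def less_imp_le)
      also have "\<dots> \<le> card (PiE U T) * (\<eta> / 4)" using Cn by (intro mult_left_mono) auto
      finally show ?thesis .
    qed
    have s2: "(\<Sum>h\<in>H. measure (gauss_vec n) (E2 h x)) \<le> card H * (\<eta> / 4)" if x: "x \<in> PiE U T" for x
    proof -
      have "(\<Sum>h\<in>H. measure (gauss_vec n) (E2 h x)) \<le> real q ^ n * (Nmax * L / q)"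
        unfolding H_def E2_def B_def
        by (rule hash_collision_expectation[OF \<epsilon>(1) q0 X_in[OF x] fin\<Lambda> _ _ Lge])
           (use X_in y0 in \<open>auto simp: \<Lambda>_def Nmax_def\<close>)
      also have "\<dots> \<le> real q ^ n * (\<eta> / 4)" using Nq by (intro mult_left_mono) auto
      finally show ?thesis by (simp add: cardH)
    qed
    have "\<exists>h\<in>H. \<exists>s. (\<forall>u\<in>U. 2 powr (n * r u) \<le> card {x \<in> T u. hash n q h x = s u}) \<and>
     (\<Sum>x\<in>PiE U (\<lambda>u. {x \<in> T u. hash n q h x = s u}). measure (gauss_vec n) (E1 x) + measure (gauss_vec n) (E2 h x))
        \<le> \<eta> * card (PiE U (\<lambda>u. {x \<in> T u. hash n q h x = s u}))"
    proof (rule coset_selection)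
      show "finite H" "H \<noteq> {}" using q0 by (auto simp: H_def intro!: finite_PiE simp: PiE_eq_empty_iff)
      show "hash n q h x \<in> {0..<int q}" for h x using q0 by (simp add: hash_def)
      have "(\<Sum>h\<in>H. \<Sum>x\<in>PiE U T. measure (gauss_vec n) (E1 x) + measure (gauss_vec n) (E2 h x))
         = card H * (\<Sum>x\<in>PiE U T. measure (gauss_vec n) (E1 x)) + (\<Sum>x\<in>PiE U T. \<Sum>h\<in>H. measure (gauss_vec n) (E2 h x))"
        by (simp add: sum.distrib) (rule sum.swap)
      also have "\<dots> \<le> card H * (card (PiE U T) * (\<eta> / 4)) + (\<Sum>x\<in>PiE U T. card H * (\<eta> / 4))"
        by (intro add_mono mult_left_mono s1 sum_mono s2) auto
      finally show "(\<Sum>h\<in>H. \<Sum>x\<in>PiE U T. measure (gauss_vec n) (E1 x) + measure (gauss_vec n) (E2 h x))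
         \<le> card H * (card (PiE U T) * (\<eta> / 2))" by (simp add: field_simps)
    qed (use U finT neT \<eta> card_T in auto)
    then obtain h sh where hs: "h \<in> H" "\<And>u. u \<in> U \<Longrightarrow> 2 powr (n * r u) \<le> card {x \<in> T u. hash n q h x = sh u}"
      "(\<Sum>x\<in>PiE U (\<lambda>u. {x \<in> T u. hash n q h x = sh u}). measure (gauss_vec n) (E1 x) + measure (gauss_vec n) (E2 h x))
        \<le> \<eta> * card (PiE U (\<lambda>u. {x \<in> T u. hash n q h x = sh u}))" by blast
    define A where "A = (\<lambda>u. {x \<in> T u. hash n q h x = sh u})"
    have AT: "x \<in> PiE U T" if "x \<in> PiE U A" for x using that by (auto simp: A_def PiE_iff)
    \<comment> \<open>All tuples drawn from the chosen cosets give sums with the same hash, so every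
      wrong candidate is one of the competitors counted in \<open>E2\<close>.\<close>
    have hX: "hash n q h (X x) = (\<Sum>u\<in>U. sh u) mod int q" if "x \<in> PiE U A" for x
    proof -
      have "(\<Sum>u\<in>U. hash n q h (x u)) = (\<Sum>u\<in>U. sh u)"
        using PiE_mem[OF that] by (intro sum.cong) (auto simp: A_def)
      then show ?thesis by (simp add: X_def hash_sum)
    qed
    have errle: "measure (gauss_vec n) {z \<in> space (gauss_vec n). \<not> (\<forall>x'\<in>PiE U A. B x (X x') z \<longleftrightarrow> X x' = X x)}
        \<le> measure (gauss_vec n) (E1 x) + measure (gauss_vec n) (E2 h x)" if x: "x \<in> PiE U A" for x
    proof -
      have "measure (gauss_vec n) {z \<in> space (gauss_vec n). \<not> (\<forall>x'\<in>PiE U A. B x (X x') z \<longleftrightarrow> X x' = X x)}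
          \<le> measure (gauss_vec n) (E1 x \<union> E2 h x)"
      proof (intro G.finite_measure_mono sets.Un E1m E2m subsetI)
        fix z assume "z \<in> {z \<in> space (gauss_vec n). \<not> (\<forall>x'\<in>PiE U A. B x (X x') z \<longleftrightarrow> X x' = X x)}"
        then obtain x' where z: "z \<in> space (gauss_vec n)" and x': "x' \<in> PiE U A" "B x (X x') z \<noteq> (X x' = X x)" by auto
        show "z \<in> E1 x \<union> E2 h x"
        proof (cases "B x (X x) z")
          case False then show ?thesis using z by (simp add: E1_def)
        next
          case True
          then have "X x' \<noteq> X x" "B x (X x') z" using x' by auto
          then show ?thesis using True z hX[OF x] hX[OF x'(1)] AT[OF x'(1)] by (auto simp: E2_def \<Lambda>_def)
        qed
      qed
      also have "\<dots> \<le> measure (gauss_vec n) (E1 x) + measure (gauss_vec n) (E2 h x)"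
        by (rule measure_Un_le[OF E1m E2m])
      finally show ?thesis .
    qed
    have "(\<Sum>x\<in>PiE U A. measure (gauss_vec n) {z \<in> space (gauss_vec n). \<not> (\<forall>x'\<in>PiE U A. B x (X x') z \<longleftrightarrow> X x' = X x)})
       \<le> (\<Sum>x\<in>PiE U A. measure (gauss_vec n) (E1 x) + measure (gauss_vec n) (E2 h x))"
      by (intro sum_mono errle)
    also have "\<dots> \<le> \<eta> * card (PiE U A)" using hs(3) by (simp add: A_def)
    finally show ?thesis
      using hs(2) by (intro exI[of _ A]) (auto simp: A_def T_def B_def X_def \<rho>_def)
  qed
  show ?thesis
    by (rule exI[of _ \<epsilon>], rule conjI[OF \<epsilon>(1)], rule exI[of _ N'], rule exI[of _ n0], intro allI impI, rule main)
qed

text \<open>\<open>comb\<close> is the decoded sum encoded as a natural number. The relaying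
  argument uses of it only that it is injective in each single argument. The last clause is an
  average over tuples, because individual tuples may be undecodable.\<close>

definition computation_code ::
  "'u set \<Rightarrow> nat \<Rightarrow> ('u \<Rightarrow> real) \<Rightarrow> ('u \<Rightarrow> real) \<Rightarrow> real \<Rightarrow>
   ('u \<Rightarrow> (nat \<Rightarrow> real) set) \<Rightarrow> (('u \<Rightarrow> nat \<Rightarrow> real) \<Rightarrow> nat) \<Rightarrow> ((nat \<Rightarrow> real) \<Rightarrow> nat) \<Rightarrow> bool" where
  "computation_code U n P r \<eta> A comb G \<longleftrightarrow>
    (\<forall>u\<in>U. finite (A u) \<and> A u \<noteq> {} \<and> 2 powr (n * r u) \<le> card (A u) \<and> (\<forall>x\<in>A u. (\<Sum>i<n. (x i)\<^sup>2) \<le> n * P u)) \<and>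
    (\<forall>x\<in>PiE U A. \<forall>y\<in>PiE U A. \<forall>u\<in>U. (\<forall>w\<in>U - {u}. x w = y w) \<longrightarrow> comb x = comb y \<longrightarrow> x u = y u) \<and>
    G \<in> measurable (PiM {..<n} (\<lambda>_. borel)) (count_space UNIV) \<and>
    (\<Sum>x\<in>PiE U A. measure (gauss_vec n)
        {z \<in> space (gauss_vec n). G (\<lambda>i\<in>{..<n}. (\<Sum>u\<in>U. x u i) + z i) \<noteq> comb x}) \<le> \<eta> * real (card (PiE U A))"

text \<open>Edges of rate 0 send the single zero codeword, and the integer code is built for the
  remaining edges \<open>U'\<close>. The noise scaling still uses the total power \<open>s\<close>
  of all edges, which dominates the power of those in \<open>U'\<close> and appears in the rate
  condition.\<close>

lemma computation_code_exists:
  fixes U :: "'u set" and P r :: "'u \<Rightarrow> real" and \<eta> :: real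
  assumes U: "finite U" and P0: "\<And>u. u \<in> U \<Longrightarrow> P u \<ge> 0" and r0: "\<And>u. u \<in> U \<Longrightarrow> r u \<ge> 0"
    and rate: "\<And>u. u \<in> U \<Longrightarrow> r u > 0 \<Longrightarrow> P u > 0 \<and> r u < 1/2 * log 2 ((1 / (\<Sum>u\<in>U. P u) + 1) * P u)"
    and \<eta>: "\<eta> > 0"
  shows "\<exists>n0. \<forall>n\<ge>n0. \<exists>A comb G. computation_code U n P r \<eta> A comb G"
proof -
  define U' where "U' = {u \<in> U. r u > 0}"
  \<comment> \<open>The default 1 keeps \<open>s\<close> positive when all powers vanish; then
    \<open>U'\<close> is empty. If \<open>U'\<close> has an element, \<open>s\<close> is the true
    sum of powers.\<close>
  define s where "s = (if (\<Sum>u\<in>U. P u) > 0 then (\<Sum>u\<in>U. P u) else 1)"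
  define \<alpha> where "\<alpha> = s / (1 + s)"
  have s: "s > 0" by (simp add: s_def)
  have finU': "finite U'" and subU: "U' \<subseteq> U" using U by (auto simp: U'_def)
  have Ps: "(\<Sum>u\<in>U'. P u) \<le> s"
  proof -
    have "(\<Sum>u\<in>U'. P u) \<le> (\<Sum>u\<in>U. P u)" using U subU P0 by (intro sum_mono2) auto
    then show ?thesis by (simp add: s_def)
  qed
  have PU': "P u > 0" if "u \<in> U'" for u using rate that by (auto simp: U'_def)
  have rateU': "2 powr (2 * r u) * (s / (1 + s)) < P u" if u: "u \<in> U'" for u
  proof -
    have uU: "u \<in> U" using u subU by auto
    have "P u \<le> (\<Sum>u\<in>U. P u)" using uU U P0 by (intro member_le_sum) auto
    then have seq: "s = (\<Sum>u\<in>U. P u)" using PU'[OF u] by (simp add: s_def)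
    have "r u < 1/2 * log 2 ((1 / s + 1) * P u)" using rate[OF uU] u by (simp add: seq U'_def)
    then have "2 * r u < log 2 ((1 / s + 1) * P u)" by simp
    then have "2 powr (2 * r u) < (1 / s + 1) * P u"
      using s PU'[OF u] by (subst (asm) less_log_iff) (auto intro!: mult_pos_pos add_pos_pos)
    then show ?thesis using s by (simp add: field_simps)
  qed
  obtain g :: real and N' n0 where g: "g > 0" and code: "\<And>n. n \<ge> n0 \<Longrightarrow> \<exists>A :: 'u \<Rightarrow> (nat \<Rightarrow> int) set.
     (\<forall>u\<in>U'. A u \<subseteq> grid_ball n g (n * P u) (\<lambda>_. 0) \<and> 2 powr (n * r u) \<le> card (A u)) \<and>
     (\<Sum>x\<in>PiE U' A. measure (gauss_vec n) {z \<in> space (gauss_vec n).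
        \<not> (\<forall>x'\<in>PiE U' A. (\<Sum>i<n. (g * (\<Sum>u\<in>U'. x' u i) - \<alpha> * (g * (\<Sum>u\<in>U'. x u i) + z i))\<^sup>2) \<le> n * N'
              \<longleftrightarrow> (\<lambda>i. \<Sum>u\<in>U'. x' u i) = (\<lambda>i. \<Sum>u\<in>U'. x u i))})
       \<le> \<eta> * card (PiE U' A)"
    using sum_computation_integer_code[OF finU' s Ps PU' rateU' \<eta>] unfolding \<alpha>_def by blast
  have "\<exists>A comb G. computation_code U n P r \<eta> A comb G" if n: "n \<ge> n0" for n
  proof -
    interpret G: prob_space "gauss_vec n" by (rule prob_space_gauss_vec)
    define X where "X = (\<lambda>(x :: 'u \<Rightarrow> nat \<Rightarrow> int) i. \<Sum>u\<in>U'. x u i)"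
    obtain A' :: "'u \<Rightarrow> (nat \<Rightarrow> int) set" where
      A'sub: "\<And>u. u \<in> U' \<Longrightarrow> A' u \<subseteq> grid_ball n g (n * P u) (\<lambda>_. 0)"
      and A'card: "\<And>u. u \<in> U' \<Longrightarrow> 2 powr (n * r u) \<le> card (A' u)"
      and A'err: "(\<Sum>x\<in>PiE U' A'. measure (gauss_vec n) {z \<in> space (gauss_vec n).
        \<not> (\<forall>x'\<in>PiE U' A'. (\<Sum>i<n. (g * X x' i - \<alpha> * (g * X x i + z i))\<^sup>2) \<le> n * N'
              \<longleftrightarrow> X x' = X x)})
       \<le> \<eta> * card (PiE U' A')"
      using code[OF n] unfolding X_def by blast
    have A'fin: "finite (A' u)" if "u \<in> U'" for u
      using A'sub[OF that] finite_grid_ball[OF g] by (rule finite_subset)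
    have A'ne: "A' u \<noteq> {}" if "u \<in> U'" for u
    proof
      assume "A' u = {}"
      then have "2 powr (n * r u) \<le> 0" using A'card[OF that] by simp
      then show False by (simp add: not_le[symmetric])
    qed
    define sc where "sc = (\<lambda>(x :: nat \<Rightarrow> int) i. g * real_of_int (x i))"
    have sc_inj: "sc x = sc y \<Longrightarrow> x = y" for x y using g by (auto simp: sc_def fun_eq_iff)
    define A where "A = (\<lambda>u. if u \<in> U' then sc ` A' u else {\<lambda>_. 0})"
    \<comment> \<open>Pads a tuple over \<open>U'\<close> with zero codewords. It is a bijection
      that preserves the sum, so averages over the two kinds of tuples coincide.\<close>
    define \<Phi> where "\<Phi> = (\<lambda>x. \<lambda>u\<in>U. if u \<in> U' then sc (x u) else (\<lambda>_. 0))"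
    define S where "S = (\<lambda>(x :: 'u \<Rightarrow> nat \<Rightarrow> real) i. \<Sum>u\<in>U. x u i)"
    define \<Lambda> where "\<Lambda> = S ` PiE U A"
    define comb where "comb = (\<lambda>x. to_nat_on \<Lambda> (S x))"
    define ball where "ball = (\<lambda>\<mu> y. (\<Sum>i<n. (\<mu> i - \<alpha> * y i)\<^sup>2) \<le> n * N')"
    \<comment> \<open>The index of the only candidate sum in the ball. \<open>LEAST\<close> provides
      an unambiguous measurable choice; its value when there is no unique candidate only matters on
      the error event.\<close>
    define G where "G = (\<lambda>y. LEAST k. \<exists>\<mu>\<in>\<Lambda>. to_nat_on \<Lambda> \<mu> = k \<and> ball \<mu> y \<and> (\<forall>\<mu>'\<in>\<Lambda>. ball \<mu>' y \<longrightarrow> \<mu>' = \<mu>))"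
    have Afin: "finite (A u)" if "u \<in> U" for u using A'fin by (auto simp: A_def)
    have PAfin: "finite (PiE U A)" using U Afin by (intro finite_PiE) auto
    have PA'fin: "finite (PiE U' A')" using finU' A'fin by (intro finite_PiE) auto
    have \<Lambda>fin: "finite \<Lambda>" using PAfin by (simp add: \<Lambda>_def)
    have code_inj: "inj_on (to_nat_on \<Lambda>) \<Lambda>" using \<Lambda>fin by (intro inj_on_to_nat_on countable_finite)
    have S\<Phi>: "S (\<Phi> x) = (\<lambda>i. g * real_of_int (X x i))" for x
    proof
      fix i
      have "S (\<Phi> x) i = (\<Sum>u\<in>U. if u \<in> U' then sc (x u) i else 0)"
        unfolding S_def \<Phi>_def by (intro sum.cong) auto
      also have "\<dots> = (\<Sum>u\<in>U'. sc (x u) i)" using U subU by (simp add: sum.If_cases Int_absorb1)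
      finally show "S (\<Phi> x) i = g * real_of_int (X x i)" by (simp add: X_def sc_def sum_distrib_left)
    qed
    have S\<Phi>_eq: "S (\<Phi> x) = S (\<Phi> y) \<longleftrightarrow> X x = X y" for x y
      using g by (auto simp: S\<Phi> fun_eq_iff)
    have bij: "bij_betw \<Phi> (PiE U' A') (PiE U A)"
    proof (rule bij_betw_imageI)
      show "inj_on \<Phi> (PiE U' A')"
      proof (rule inj_onI)
        fix x y assume xy: "x \<in> PiE U' A'" "y \<in> PiE U' A'" "\<Phi> x = \<Phi> y"
        have "x u = y u" if "u \<in> U'" for u
          using fun_cong[OF xy(3), of u] that subsetD[OF subU that] by (simp add: \<Phi>_def sc_inj)
        then show "x = y" using xy by (intro PiE_ext[OF xy(1,2)])
      qed
      show "\<Phi> ` PiE U' A' = PiE U A"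
      proof (intro set_eqI iffI)
        fix y assume "y \<in> \<Phi> ` PiE U' A'"
        then show "y \<in> PiE U A" by (auto simp: \<Phi>_def A_def intro!: imageI dest: PiE_mem)
      next
        fix y assume y: "y \<in> PiE U A"
        have "\<exists>x. x \<in> A' u \<and> y u = sc x" if "u \<in> U'" for u
          using PiE_mem[OF y, of u] that subU by (auto simp: A_def)
        then obtain f where f: "\<And>u. u \<in> U' \<Longrightarrow> f u \<in> A' u \<and> y u = sc (f u)" by metis
        have "\<Phi> (restrict f U') u = y u" for u
        proof -
          consider "u \<in> U'" | "u \<in> U" "u \<notin> U'" | "u \<notin> U" by auto
          then show ?thesis
          proof cases
            case 1 then show ?thesis using f[OF 1] subU by (auto simp: \<Phi>_def)
          next
            case 2 then show ?thesis using PiE_mem[OF y, of u] by (auto simp: \<Phi>_def A_def)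
          next
            case 3 then show ?thesis using PiE_arb[OF y, of u] by (auto simp: \<Phi>_def)
          qed
        qed
        then have "y = \<Phi> (restrict f U')" by auto
        moreover have "restrict f U' \<in> PiE U' A'" using f by auto
        ultimately show "y \<in> \<Phi> ` PiE U' A'" by blast
      qed
    qed
    have ball_m [measurable]: "Measurable.pred (PiM {..<n} (\<lambda>_. borel)) (ball \<mu>)" for \<mu>
      unfolding ball_def by measurable
    have Gm: "G \<in> measurable (PiM {..<n} (\<lambda>_. borel)) (count_space UNIV)"
      unfolding G_def using \<Lambda>fin by measurable
    have ball_m2 [measurable]: "Measurable.pred (gauss_vec n) (\<lambda>z. (\<Sum>i<n. (g * X x' i - \<alpha> * (g * X x i + z i))\<^sup>2) \<le> n * N')" for x x'
      by measurable
    have err: "measure (gauss_vec n) {z \<in> space (gauss_vec n). G (\<lambda>i\<in>{..<n}. S (\<Phi> x) i + z i) \<noteq> comb (\<Phi> x)}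
       \<le> measure (gauss_vec n) {z \<in> space (gauss_vec n).
        \<not> (\<forall>x'\<in>PiE U' A'. (\<Sum>i<n. (g * X x' i - \<alpha> * (g * X x i + z i))\<^sup>2) \<le> n * N' \<longleftrightarrow> X x' = X x)}"
      if x: "x \<in> PiE U' A'" for x
    proof (rule G.finite_measure_mono)
      show "{z \<in> space (gauss_vec n).
        \<not> (\<forall>x'\<in>PiE U' A'. (\<Sum>i<n. (g * X x' i - \<alpha> * (g * X x i + z i))\<^sup>2) \<le> n * N' \<longleftrightarrow> X x' = X x)} \<in> sets (gauss_vec n)"
        using PA'fin by measurable
      show "{z \<in> space (gauss_vec n). G (\<lambda>i\<in>{..<n}. S (\<Phi> x) i + z i) \<noteq> comb (\<Phi> x)} \<subseteq> {z \<in> space (gauss_vec n).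
        \<not> (\<forall>x'\<in>PiE U' A'. (\<Sum>i<n. (g * X x' i - \<alpha> * (g * X x i + z i))\<^sup>2) \<le> n * N' \<longleftrightarrow> X x' = X x)}"
      proof (rule subsetI, rule ccontr)
        fix z assume z: "z \<in> {z \<in> space (gauss_vec n). G (\<lambda>i\<in>{..<n}. S (\<Phi> x) i + z i) \<noteq> comb (\<Phi> x)}"
          and "z \<notin> {z \<in> space (gauss_vec n).
            \<not> (\<forall>x'\<in>PiE U' A'. (\<Sum>i<n. (g * X x' i - \<alpha> * (g * X x i + z i))\<^sup>2) \<le> n * N' \<longleftrightarrow> X x' = X x)}"
        then have all: "\<forall>x'\<in>PiE U' A'. (\<Sum>i<n. (g * X x' i - \<alpha> * (g * X x i + z i))\<^sup>2) \<le> n * N' \<longleftrightarrow> X x' = X x"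
          by (simp only: mem_Collect_eq) blast
        note good = bspec[OF all]
        let ?y = "\<lambda>i\<in>{..<n}. S (\<Phi> x) i + z i"
        have b: "ball (S (\<Phi> x')) ?y \<longleftrightarrow> S (\<Phi> x') = S (\<Phi> x)" if "x' \<in> PiE U' A'" for x'
        proof -
          have "ball (S (\<Phi> x')) ?y \<longleftrightarrow> (\<Sum>i<n. (g * X x' i - \<alpha> * (g * X x i + z i))\<^sup>2) \<le> n * N'"
            by (simp add: ball_def S\<Phi>)
          then show ?thesis using good[OF that] by (simp add: S\<Phi>_eq)
        qed
        have \<Lambda>eq: "\<Lambda> = (\<lambda>x. S (\<Phi> x)) ` PiE U' A'"
          unfolding \<Lambda>_def bij_betw_imp_surj_on[OF bij, symmetric] by (simp add: image_image)
        have memx: "S (\<Phi> x) \<in> \<Lambda>" using x by (simp add: \<Lambda>eq)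
        have bL: "ball \<mu> ?y \<longleftrightarrow> \<mu> = S (\<Phi> x)" if mu: "\<mu> \<in> \<Lambda>" for \<mu>
        proof -
          obtain x' where "x' \<in> PiE U' A'" "\<mu> = S (\<Phi> x')" using mu unfolding \<Lambda>eq by blast
          then show ?thesis using b[of x'] by (simp only:)
        qed
        have "G ?y = comb (\<Phi> x)" unfolding G_def
        proof (rule Least_equality)
          show "\<exists>\<mu>\<in>\<Lambda>. to_nat_on \<Lambda> \<mu> = comb (\<Phi> x) \<and> ball \<mu> ?y \<and> (\<forall>\<mu>'\<in>\<Lambda>. ball \<mu>' ?y \<longrightarrow> \<mu>' = \<mu>)"
          proof (intro bexI[OF _ memx] conjI ballI impI)
            show "to_nat_on \<Lambda> (S (\<Phi> x)) = comb (\<Phi> x)" by (simp only: comb_def)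
            show "ball (S (\<Phi> x)) ?y" using bL[OF memx] by (rule iffD2) (rule refl)
            show "\<mu>' = S (\<Phi> x)" if "\<mu>' \<in> \<Lambda>" "ball \<mu>' ?y" for \<mu>' by (rule iffD1[OF bL[OF that(1)] that(2)])
          qed
        next
          fix k assume "\<exists>\<mu>\<in>\<Lambda>. to_nat_on \<Lambda> \<mu> = k \<and> ball \<mu> ?y \<and> (\<forall>\<mu>'\<in>\<Lambda>. ball \<mu>' ?y \<longrightarrow> \<mu>' = \<mu>)"
          then obtain \<mu> where mu: "\<mu> \<in> \<Lambda>" "to_nat_on \<Lambda> \<mu> = k" "ball \<mu> ?y" by (elim bexE conjE)
          have "\<mu> = S (\<Phi> x)" by (rule iffD1[OF bL[OF mu(1)] mu(3)])
          then show "comb (\<Phi> x) \<le> k" using mu(2) by (simp only: comb_def)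
        qed
        then show False using z by (simp only: mem_Collect_eq simp_thms)
      qed
    qed
    have "(\<Sum>x\<in>PiE U A. measure (gauss_vec n)
        {z \<in> space (gauss_vec n). G (\<lambda>i\<in>{..<n}. S x i + z i) \<noteq> comb x})
      = (\<Sum>x\<in>PiE U' A'. measure (gauss_vec n)
        {z \<in> space (gauss_vec n). G (\<lambda>i\<in>{..<n}. S (\<Phi> x) i + z i) \<noteq> comb (\<Phi> x)})"
      by (rule sum.reindex_bij_betw[OF bij, symmetric])
    also have "\<dots> \<le> (\<Sum>x\<in>PiE U' A'. measure (gauss_vec n) {z \<in> space (gauss_vec n).
        \<not> (\<forall>x'\<in>PiE U' A'. (\<Sum>i<n. (g * X x' i - \<alpha> * (g * X x i + z i))\<^sup>2) \<le> n * N' \<longleftrightarrow> X x' = X x)})"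
      by (intro sum_mono err)
    also have "\<dots> \<le> \<eta> * card (PiE U A)" using A'err by (simp add: bij_betw_same_card[OF bij])
    finally have total: "(\<Sum>x\<in>PiE U A. measure (gauss_vec n)
        {z \<in> space (gauss_vec n). G (\<lambda>i\<in>{..<n}. (\<Sum>u\<in>U. x u i) + z i) \<noteq> comb x}) \<le> \<eta> * real (card (PiE U A))"
      by (simp add: S_def)
    have inj: "x u = y u" if x: "x \<in> PiE U A" and y: "y \<in> PiE U A" and u: "u \<in> U"
      and ag: "\<forall>w\<in>U - {u}. x w = y w" and eq: "comb x = comb y" for x y u
    proof
      fix i
      have "S x \<in> \<Lambda>" "S y \<in> \<Lambda>" using x y by (simp_all add: \<Lambda>_def)
      with eq[unfolded comb_def] have "S x = S y" by (rule inj_onD[OF code_inj])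
      then have "(\<Sum>w\<in>U. x w i) = (\<Sum>w\<in>U. y w i)" by (auto simp: S_def fun_eq_iff)
      then have "x u i + (\<Sum>w\<in>U - {u}. x w i) = y u i + (\<Sum>w\<in>U - {u}. y w i)"
        unfolding sum.remove[OF U u, of "\<lambda>w. x w i"] sum.remove[OF U u, of "\<lambda>w. y w i"] .
      moreover have "(\<Sum>w\<in>U - {u}. x w i) = (\<Sum>w\<in>U - {u}. y w i)" using ag by (intro sum.cong) auto
      ultimately show "x u i = y u i" by simp
    qed
    have Aprop: "finite (A u) \<and> A u \<noteq> {} \<and> 2 powr (n * r u) \<le> card (A u) \<and> (\<forall>x\<in>A u. (\<Sum>i<n. (x i)\<^sup>2) \<le> n * P u)"
      if u: "u \<in> U" for u
    proof (cases "u \<in> U'")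
      case True
      have "card (A u) = card (A' u)" using True by (simp add: A_def card_image inj_on_def sc_inj)
      moreover have "(\<Sum>i<n. (x i)\<^sup>2) \<le> n * P u" if "x \<in> A u" for x
        using that True A'sub[OF True] by (auto simp: A_def sc_def grid_ball_def)
      ultimately show ?thesis using True Afin[OF u] A'ne[OF True] A'card[OF True] by (simp add: A_def)
    next
      case False
      then have "r u = 0" using r0[OF u] u by (simp add: U'_def)
      then show ?thesis using False P0[OF u] by (simp add: A_def)
    qed
    have "computation_code U n P r \<eta> A comb G"
      unfolding computation_code_def
      by (intro conjI) (rule ballI, erule Aprop, intro ballI impI, rule inj, assumption+, rule Gm, rule total)
    then show ?thesis by blast
  qed
  then show ?thesis by blast
qed

section \<open>Random relaying over noiseless sum channels\<close>

lemma exists_le_average: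
  fixes Z :: "'a \<Rightarrow> real" and c :: real
  assumes "finite F" "F \<noteq> {}" "(\<Sum>f\<in>F. Z f) \<le> card F * c"
  shows "\<exists>f\<in>F. Z f \<le> c"
proof (rule ccontr)
  assume "\<not> (\<exists>f\<in>F. Z f \<le> c)"
  then have "(\<Sum>f\<in>F. c) < (\<Sum>f\<in>F. Z f)" using assms by (intro sum_strict_mono) auto
  then show False using assms by simp
qed

text \<open>With positive bounds this is averaging applied to \<open>X f / a + Y f / b\<close>,
  whose mean is at most 2. If \<open>a\<close> is not positive, it must be 0 and \<open>X\<close>
  vanishes throughout, so averaging \<open>Y\<close> alone suffices. This case occurs once no pair
  of messages is confused any more.\<close>

lemma exists_le_two_averages:
  fixes X Y :: "'a \<Rightarrow> real" and a b :: real
  assumes F: "finite F" "F \<noteq> {}" and X0: "\<And>f. f \<in> F \<Longrightarrow> X f \<ge> 0" and Y0: "\<And>f. f \<in> F \<Longrightarrow> Y f \<ge> 0"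
    and X: "(\<Sum>f\<in>F. X f) \<le> card F * a" and Y: "(\<Sum>f\<in>F. Y f) \<le> card F * b" and b: "b > 0"
  shows "\<exists>f\<in>F. X f \<le> 2 * a \<and> Y f \<le> 2 * b"
proof (cases "a > 0")
  case True
  have "(\<Sum>f\<in>F. X f / a + Y f / b) = (\<Sum>f\<in>F. X f) / a + (\<Sum>f\<in>F. Y f) / b"
    by (simp add: sum.distrib sum_divide_distrib)
  also have "\<dots> \<le> card F * a / a + card F * b / b"
    using True b X Y by (intro add_mono divide_right_mono) auto
  also have "\<dots> = real (card F) * 2" using True b by simp
  finally obtain f where f: "f \<in> F" "X f / a + Y f / b \<le> 2" using exists_le_average[OF F] by blast
  have "X f / a \<ge> 0" "Y f / b \<ge> 0" using True b X0[OF f(1)] Y0[OF f(1)] by auto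
  then have "X f / a \<le> 2" "Y f / b \<le> 2" using f(2) by linarith+
  then show ?thesis using f(1) True b by (intro bexI[of _ f]) (auto simp: field_simps)
next
  case False
  obtain f where f: "f \<in> F" "Y f \<le> b" using exists_le_average[OF F Y] by blast
  have cF: "real (card F) > 0" using F by (simp add: card_gt_0_iff)
  have "0 \<le> (\<Sum>f\<in>F. X f)" using X0 by (intro sum_nonneg)
  then have "0 \<le> real (card F) * a" using X by linarith
  then have a0: "a = 0" using False cF by (simp add: zero_le_mult_iff)
  have "X f \<le> (\<Sum>f\<in>F. X f)" using f(1) F X0 by (intro member_le_sum) auto
  then have "X f \<le> 0" using X a0 by simp
  then show ?thesis using f a0 b by (intro bexI[of _ f]) auto
qed

lemma card_PiE_split:
  assumes "finite I" "J \<subseteq> I"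
  shows "card (PiE I B) = card (PiE (I - J) B) * (\<Prod>j\<in>J. card (B j))"
  using assms finite_subset[OF assms(2,1)]
  by (simp add: card_PiE prod.subset_diff[OF assms(2,1)])

text \<open>As \<open>\<kappa>\<close> is injective, reading a uniform tuple at the positions
  \<open>\<kappa> k\<close> gives a uniform subtuple: no fibre exceeds the number of choices for the
  remaining coordinates. This carries the average error of a computation code over to random relay
  functions.\<close>

lemma sum_PiE_marginal_le:
  fixes H :: "('k \<Rightarrow> 'x) \<Rightarrow> real" and \<eta> :: real
  assumes I: "finite I" "\<And>i. i \<in> I \<Longrightarrow> finite (B i)" and \<kappa>: "inj_on \<kappa> K" "\<kappa> ` K \<subseteq> I"
    and H0: "\<And>x. H x \<ge> 0"
    and H: "(\<Sum>x\<in>PiE K (\<lambda>k. B (\<kappa> k)). H x) \<le> \<eta> * card (PiE K (\<lambda>k. B (\<kappa> k)))"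
  shows "(\<Sum>f\<in>PiE I B. H (\<lambda>k\<in>K. f (\<kappa> k))) \<le> \<eta> * card (PiE I B)"
proof -
  let ?PK = "PiE K (\<lambda>k. B (\<kappa> k))" and ?J = "\<kappa> ` K"
  define c where "c = card (PiE (I - ?J) B)"
  have K: "finite K" using finite_imageD[OF finite_subset[OF \<kappa>(2) I(1)] \<kappa>(1)] .
  have finI: "finite (PiE I B)" using I by (intro finite_PiE) auto
  have finK: "finite ?PK" using K I \<kappa>(2) by (intro finite_PiE) auto
  have fib: "card {f \<in> PiE I B. (\<lambda>k\<in>K. f (\<kappa> k)) = x} \<le> c" for x
    unfolding c_def
  proof (rule card_inj_on_le[where f = "\<lambda>f. restrict f (I - ?J)"])
    show "inj_on (\<lambda>f. restrict f (I - ?J)) {f \<in> PiE I B. (\<lambda>k\<in>K. f (\<kappa> k)) = x}"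
    proof (rule inj_onI)
      fix f f' assume f: "f \<in> {f \<in> PiE I B. (\<lambda>k\<in>K. f (\<kappa> k)) = x}" "f' \<in> {f \<in> PiE I B. (\<lambda>k\<in>K. f (\<kappa> k)) = x}"
        and eq: "restrict f (I - ?J) = restrict f' (I - ?J)"
      have "f i = f' i" if i: "i \<in> I" for i
      proof (cases "i \<in> ?J")
        case True
        then obtain k where k: "k \<in> K" "i = \<kappa> k" by auto
        have "(\<lambda>k\<in>K. f (\<kappa> k)) k = (\<lambda>k\<in>K. f' (\<kappa> k)) k" using f by simp
        then show ?thesis using k by simp
      next
        case False
        then show ?thesis using fun_cong[OF eq, of i] i by simp
      qed
      then show "f = f'" using f by (intro PiE_ext[of f I B]) auto
    qed
    show "finite (PiE (I - ?J) B)" using I by (intro finite_PiE) auto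
  qed auto
  have "(\<Sum>f\<in>PiE I B. H (\<lambda>k\<in>K. f (\<kappa> k))) = (\<Sum>x\<in>?PK. \<Sum>f\<in>{f \<in> PiE I B. (\<lambda>k\<in>K. f (\<kappa> k)) = x}. H (\<lambda>k\<in>K. f (\<kappa> k)))"
  proof (intro sum.group[symmetric] finI finK)
    show "(\<lambda>f. \<lambda>k\<in>K. f (\<kappa> k)) ` PiE I B \<subseteq> ?PK"
    proof (intro image_subsetI restrict_PiE_iff[THEN iffD2] ballI)
      fix f k assume "f \<in> PiE I B" "k \<in> K"
      then show "f (\<kappa> k) \<in> B (\<kappa> k)" using \<kappa>(2) by (intro PiE_mem[of f I B]) auto
    qed
  qed
  also have "\<dots> = (\<Sum>x\<in>?PK. card {f \<in> PiE I B. (\<lambda>k\<in>K. f (\<kappa> k)) = x} * H x)"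
    by (intro sum.cong refl) simp
  also have "\<dots> \<le> (\<Sum>x\<in>?PK. c * H x)"
    using fib by (intro sum_mono mult_right_mono H0) auto
  also have "\<dots> = c * (\<Sum>x\<in>?PK. H x)" by (simp add: sum_distrib_left)
  also have "\<dots> \<le> c * (\<eta> * card ?PK)" by (intro mult_left_mono H) auto
  also have "card ?PK = (\<Prod>j\<in>?J. card (B j))"
    using K by (simp add: card_PiE prod.reindex[OF \<kappa>(1)])
  also have "c * (\<eta> * (\<Prod>j\<in>?J. card (B j))) = \<eta> * card (PiE I B)"
    unfolding c_def card_PiE_split[OF I(1) \<kappa>(2), of B] by simp
  finally show ?thesis .
qed

definition dist_nodes :: "nat set \<Rightarrow> (nat \<Rightarrow> nat \<Rightarrow> nat list) \<Rightarrow> nat \<Rightarrow> nat \<Rightarrow> nat set" where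
  "dist_nodes V lab m m' = {v \<in> V. lab v m \<noteq> lab v m'}"

text \<open>Counts the ordered pairs that some destination still confuses. The exponent makes
  progress by one more node worth the same factor \<open>p\<close> as the rarity of a collision at
  all receivers in the front.\<close>

definition potential :: "nat set \<Rightarrow> nat set \<Rightarrow> real \<Rightarrow> nat set \<Rightarrow> (nat \<Rightarrow> nat \<Rightarrow> nat list) \<Rightarrow> real" where
  "potential V D p Ms lab = (\<Sum>(m, m')\<in>Ms \<times> Ms.
     if m = m' \<or> D \<subseteq> dist_nodes V lab m m' then 0 else p ^ card (dist_nodes V lab m m'))"

definition sent where
  "sent E f lab v m = (\<lambda>u\<in>inn E v. f (u, v) (lab u m))"

text \<open>A label keeps everything decoded so far, so a pair that a node can tell apart stays
  apart. The source only repeats its message.\<close>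

definition next_lab ::
  "(nat \<times> nat) set \<Rightarrow> (nat \<Rightarrow> (nat \<Rightarrow> 'x) \<Rightarrow> nat) \<Rightarrow> (nat \<times> nat \<Rightarrow> nat list \<Rightarrow> 'x)
   \<Rightarrow> (nat \<Rightarrow> nat \<Rightarrow> nat list) \<Rightarrow> nat \<Rightarrow> nat \<Rightarrow> nat list" where
  "next_lab E comb f lab v m = (if v = 1 then lab v m else lab v m @ [comb v (sent E f lab v m)])"

text \<open>One use of the network: the relays hash their labels with random functions. If the set \<open>S\<close> of
  nodes that can tell \<open>m\<close> from \<open>m'\<close> does not grow, every receiver in the front of the cut \<open>S\<close> sees a
  collision, which has probability at most \<open>p\<close>; if it grows, the weight \<open>p ^ card S\<close> drops by \<open>p\<close>.\<close>
lemma network_step: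
  fixes A :: "nat \<times> nat \<Rightarrow> 'x set" and e :: "nat \<Rightarrow> (nat \<Rightarrow> 'x) \<Rightarrow> real" and lab :: "nat \<Rightarrow> nat \<Rightarrow> nat list" and p \<eta> :: real
  assumes V: "finite V" "1 \<in> V" and E: "E \<subseteq> V \<times> V" and Ms: "finite Ms" "Ms \<noteq> {}"
    and A: "\<And>a. a \<in> E \<Longrightarrow> finite (A a)" "\<And>a. a \<in> E \<Longrightarrow> A a \<noteq> {}"
    and inj: "\<And>v x y u. v \<in> V \<Longrightarrow> x \<in> PiE (inn E v) (\<lambda>u. A (u, v)) \<Longrightarrow> y \<in> PiE (inn E v) (\<lambda>u. A (u, v))
       \<Longrightarrow> u \<in> inn E v \<Longrightarrow> (\<forall>w\<in>inn E v - {u}. x w = y w) \<Longrightarrow> comb v x = comb v y \<Longrightarrow> x u = y u"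
    and src: "\<And>m m'. m \<in> Ms \<Longrightarrow> m' \<in> Ms \<Longrightarrow> m \<noteq> m' \<Longrightarrow> lab 1 m \<noteq> lab 1 m'"
    and cut: "\<And>S. S \<subseteq> V \<Longrightarrow> 1 \<in> S \<Longrightarrow> \<not> D \<subseteq> S \<Longrightarrow> \<exists>us. (\<forall>v\<in>{v\<in>V - S. inn E v \<inter> S \<noteq> {}}. us v \<in> inn E v \<inter> S) \<and>
         1 \<le> p * (\<Prod>v\<in>{v\<in>V - S. inn E v \<inter> S \<noteq> {}}. real (card (A (us v, v))))"
    and e0: "\<And>v x. e v x \<ge> 0"
    and e: "\<And>v. v \<in> V - {1} \<Longrightarrow> (\<Sum>x\<in>PiE (inn E v) (\<lambda>u. A (u, v)). e v x) \<le> \<eta> * card (PiE (inn E v) (\<lambda>u. A (u, v)))"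
    and p: "0 < p" "p \<le> 1" and \<eta>: "\<eta> > 0"
  shows "\<exists>f. (\<forall>a l. a \<in> E \<longrightarrow> f a l \<in> A a) \<and>
     potential V D p Ms (next_lab E comb f lab) \<le> 4 * p * potential V D p Ms lab \<and>
     (\<Sum>m\<in>Ms. \<Sum>v\<in>V - {1}. e v (sent E f lab v m)) \<le> 2 * (card Ms * card V * \<eta>)"
proof -
  \<comment> \<open>One independent codeword for each edge and each label that occurs at its tail.
    Only finitely many labels occur, so the family is finite; \<open>tot\<close> extends it to all
    labels by arbitrary codewords.\<close>
  define I where "I = (SIGMA a:E. lab (fst a) ` Ms)"
  define B where "B = (\<lambda>i :: (nat \<times> nat) \<times> nat list. A (fst i))"
  define F where "F = PiE I B"
  define tot where "tot = (\<lambda>f (a :: nat \<times> nat) l. if (a, l) \<in> I then f (a, l) else (SOME x. x \<in> A a))"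
  have finE: "finite E" using finite_subset[OF E] V by simp
  have finI: "finite I" unfolding I_def using finE Ms by (intro finite_SigmaI) auto
  have finB: "finite (B i)" if "i \<in> I" for i using that A(1) by (auto simp: B_def I_def)
  have neB: "B i \<noteq> {}" if "i \<in> I" for i using that A(2) by (auto simp: B_def I_def)
  have F: "finite F" "F \<noteq> {}" using finI finB neB by (auto simp: F_def PiE_eq_empty_iff intro!: finite_PiE)
  have cF: "real (card F) > 0" using F by (simp add: card_gt_0_iff)
  have inI: "((u, v), lab u m) \<in> I" if "u \<in> inn E v" "m \<in> Ms" for u v m
    using that by (auto simp: I_def inn_def)
  have sent_tot: "sent E (tot f) lab v m = (\<lambda>u\<in>inn E v. f ((u, v), lab u m))" if "m \<in> Ms" for f v m
    using inI that by (auto simp: sent_def tot_def restrict_def fun_eq_iff)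
  have sent_in: "(\<lambda>u\<in>inn E v. f ((u, v), lab u m)) \<in> PiE (inn E v) (\<lambda>u. A (u, v))" if "m \<in> Ms" "f \<in> F" for f v m
  proof
    fix u assume "u \<in> inn E v"
    then show "(\<lambda>u\<in>inn E v. f ((u, v), lab u m)) u \<in> A (u, v)"
      using PiE_mem[of f I B, OF _ inI[of u v m]] that by (simp add: F_def B_def)
  qed simp
  have tot_in: "tot f a l \<in> A a" if "f \<in> F" "a \<in> E" for f a l
  proof (cases "(a, l) \<in> I")
    case True
    then show ?thesis using PiE_mem[of f I B "(a, l)"] that by (simp add: tot_def F_def B_def)
  next
    case False
    then show ?thesis using A(2)[OF that(2)] some_in_eq[of "A a"] by (simp add: tot_def)
  qed
  have pair: "(\<Sum>f\<in>F. if D \<subseteq> dist_nodes V (next_lab E comb (tot f) lab) m m' then 0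
         else p ^ card (dist_nodes V (next_lab E comb (tot f) lab) m m'))
      \<le> card F * (2 * p * (if D \<subseteq> dist_nodes V lab m m' then 0 else p ^ card (dist_nodes V lab m m')))"
    (is "(\<Sum>f\<in>F. ?w f) \<le> _")
    if m: "m \<in> Ms" "m' \<in> Ms" "m \<noteq> m'" for m m'
  proof -
    define S where "S = dist_nodes V lab m m'"
    define S' where "S' = (\<lambda>f. dist_nodes V (next_lab E comb (tot f) lab) m m')"
    have SS': "S \<subseteq> S' f" for f by (auto simp: S_def S'_def dist_nodes_def next_lab_def)
    have S'V: "S' f \<subseteq> V" for f by (auto simp: S'_def dist_nodes_def)
    have finS': "finite (S' f)" for f using finite_subset[OF S'V V(1)] .
    show ?thesis
    proof (cases "D \<subseteq> S")
      case True
      then have "D \<subseteq> S' f" for f using SS'[of f] by auto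
      then show ?thesis using True by (simp add: S_def S'_def)
    next
      case False
      have S: "S \<subseteq> V" "1 \<in> S" using V src[OF m] by (auto simp: S_def dist_nodes_def)
      define V0 where "V0 = {v \<in> V - S. inn E v \<inter> S \<noteq> {}}"
      obtain us where us: "\<And>v. v \<in> V0 \<Longrightarrow> us v \<in> inn E v \<inter> S"
        and prod: "1 \<le> p * (\<Prod>v\<in>V0. real (card (A (us v, v))))"
        using cut[OF S False] unfolding V0_def by blast
      define Bad where "Bad = {f \<in> F. S' f = S}"
      \<comment> \<open>\<open>jj v\<close> is the entry used on the chosen edge into
        \<open>v\<close> for message \<open>m\<close>. Since \<open>us v\<close> separates
        \<open>m\<close> from \<open>m'\<close>, the tuple of \<open>m'\<close> never reads such an
        entry, and the tuple of \<open>m\<close> at \<open>v\<close> reads just this one. A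
        collision at every \<open>v\<close> in \<open>V0\<close> therefore determines all entries
        \<open>jj v\<close> from the others, so bad functions form at most a fraction
        \<open>p\<close>.\<close>
      define jj where "jj = (\<lambda>v. ((us v, v), lab (us v) m))"
      have injj: "inj_on jj V0" by (auto simp: inj_on_def jj_def)
      have subj: "jj ` V0 \<subseteq> I" using us inI m by (auto simp: jj_def)
      have Badeq: "comb v (\<lambda>u\<in>inn E v. f ((u, v), lab u m)) = comb v (\<lambda>u\<in>inn E v. f ((u, v), lab u m'))"
        if f: "f \<in> Bad" and v: "v \<in> V0" for f v
      proof -
        have "v \<notin> S' f" "v \<noteq> 1" using f v S by (auto simp: Bad_def V0_def)
        then show ?thesis using v m
          by (auto simp: S'_def dist_nodes_def next_lab_def sent_tot V0_def)
      qed
      have "inj_on (\<lambda>f. restrict f (I - jj ` V0)) Bad"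
      proof (rule inj_onI)
        fix f f' assume f: "f \<in> Bad" "f' \<in> Bad" and eq: "restrict f (I - jj ` V0) = restrict f' (I - jj ` V0)"
        have fF: "f \<in> F" "f' \<in> F" using f by (auto simp: Bad_def)
        have off: "f i = f' i" if "i \<in> I - jj ` V0" for i using fun_cong[OF eq, of i] that by simp
        have "f i = f' i" if i: "i \<in> I" for i
        proof (cases "i \<in> jj ` V0")
          case False then show ?thesis using off i by simp
        next
          case True
          then obtain v where v: "v \<in> V0" and iv: "i = jj v" by auto
          have usv: "us v \<in> inn E v" "us v \<in> S" using us[OF v] by auto
          let ?x = "\<lambda>f m. \<lambda>u\<in>inn E v. f ((u, v), lab u m)"
          have notj: "((u, v), l) \<notin> jj ` V0" if "u \<noteq> us v \<or> l \<noteq> lab (us v) m" for u l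
            using that by (auto simp: jj_def)
          have eq': "?x f m' = ?x f' m'"
          proof (rule restrict_ext)
            fix u assume u: "u \<in> inn E v"
            have "lab (us v) m' \<noteq> lab (us v) m" using usv(2) by (auto simp: S_def dist_nodes_def)
            then have "((u, v), lab u m') \<notin> jj ` V0" using notj[of u "lab u m'"] by (cases "u = us v") auto
            then show "f ((u, v), lab u m') = f' ((u, v), lab u m')" using off inI[OF u m(2)] by simp
          qed
          have "?x f m (us v) = ?x f' m (us v)"
          proof (rule inj)
            show "v \<in> V" using v by (simp add: V0_def)
            show "\<forall>w\<in>inn E v - {us v}. ?x f m w = ?x f' m w"
              using off inI m(1) notj by auto
            show "comb v (?x f m) = comb v (?x f' m)"
              using Badeq[OF f(1) v] Badeq[OF f(2) v] eq' by simp
          qed (rule sent_in[OF m(1) fF(1)], rule sent_in[OF m(1) fF(2)], rule usv(1))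
          then show ?thesis using usv iv by (simp add: jj_def)
        qed
        then show "f = f'" using fF unfolding F_def by (intro PiE_ext[of f I B]) auto
      qed
      then have "card Bad \<le> card (PiE (I - jj ` V0) B)"
      proof (rule card_inj_on_le)
        show "(\<lambda>f. restrict f (I - jj ` V0)) ` Bad \<subseteq> PiE (I - jj ` V0) B"
          by (auto simp: Bad_def F_def)
        show "finite (PiE (I - jj ` V0) B)" using finI finB by (intro finite_PiE) auto
      qed
      then have "real (card Bad) * (\<Prod>v\<in>V0. real (card (A (us v, v)))) \<le> real (card (PiE (I - jj ` V0) B)) * (\<Prod>v\<in>V0. real (card (A (us v, v))))"
        by (intro mult_right_mono prod_nonneg) auto
      also have "\<dots> = card F"
        unfolding F_def card_PiE_split[OF finI subj, of B] prod.reindex[OF injj]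
        by (simp add: jj_def B_def)
      finally have "real (card Bad) * (\<Prod>v\<in>V0. real (card (A (us v, v)))) * p \<le> card F * p"
        using p by (intro mult_right_mono) auto
      moreover have "real (card Bad) * 1 \<le> real (card Bad) * (p * (\<Prod>v\<in>V0. real (card (A (us v, v)))))"
        by (intro mult_left_mono prod) auto
      ultimately have cBad: "card Bad \<le> card F * p" by (simp add: mult_ac)
      have "?w f \<le> p * p ^ card S + of_bool (f \<in> Bad) * p ^ card S" if f: "f \<in> F" for f
      proof (cases "D \<subseteq> S' f")
        case True
        then show ?thesis using p by (simp add: S'_def)
      next
        case nD: False
        show ?thesis
        proof (cases "S' f = S")
          case True
          then show ?thesis using nD f p by (simp add: S'_def Bad_def)
        next
          case False
          then have "card S < card (S' f)" using SS'[of f] finS' by (intro psubset_card_mono) auto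
          then have "p ^ card (S' f) \<le> p ^ Suc (card S)" using p by (intro power_decreasing) auto
          then show ?thesis using nD False by (simp add: S'_def Bad_def)
        qed
      qed
      then have "(\<Sum>f\<in>F. ?w f) \<le> (\<Sum>f\<in>F. p * p ^ card S + of_bool (f \<in> Bad) * p ^ card S)" by (rule sum_mono)
      also have "\<dots> = card F * (p * p ^ card S) + card Bad * p ^ card S"
      proof -
        have "F \<inter> Bad = Bad" by (auto simp: Bad_def)
        then show ?thesis using F(1) by (simp add: sum.distrib sum_distrib_right[symmetric])
      qed
      also have "\<dots> \<le> card F * (p * p ^ card S) + card F * p * p ^ card S"
        using cBad p by (intro add_left_mono mult_right_mono) auto
      also have "\<dots> = card F * (2 * p * p ^ card S)" by simp
      finally show ?thesis using False by (simp add: S_def)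
    qed
  qed
  have X: "(\<Sum>f\<in>F. potential V D p Ms (next_lab E comb (tot f) lab)) \<le> card F * (2 * p * potential V D p Ms lab)"
  proof -
    have "(\<Sum>f\<in>F. potential V D p Ms (next_lab E comb (tot f) lab))
       = (\<Sum>(m, m')\<in>Ms \<times> Ms. \<Sum>f\<in>F. if m = m' \<or> D \<subseteq> dist_nodes V (next_lab E comb (tot f) lab) m m' then 0
         else p ^ card (dist_nodes V (next_lab E comb (tot f) lab) m m'))"
      unfolding potential_def case_prod_unfold by (rule sum.swap)
    also have "\<dots> \<le> (\<Sum>(m, m')\<in>Ms \<times> Ms. card F * (2 * p * (if m = m' \<or> D \<subseteq> dist_nodes V lab m m' then 0 else p ^ card (dist_nodes V lab m m'))))"
    proof (rule sum_mono, clarify)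
      fix m m' assume m: "m \<in> Ms" "m' \<in> Ms"
      show "(\<Sum>f\<in>F. if m = m' \<or> D \<subseteq> dist_nodes V (next_lab E comb (tot f) lab) m m' then 0
         else p ^ card (dist_nodes V (next_lab E comb (tot f) lab) m m'))
         \<le> card F * (2 * p * (if m = m' \<or> D \<subseteq> dist_nodes V lab m m' then 0 else p ^ card (dist_nodes V lab m m')))"
      proof (cases "m = m'")
        case True
        show ?thesis unfolding True by (simp only: simp_thms if_True sum.neutral_const)
      next
        case False
        show ?thesis using pair[OF m False] False by (simp only: simp_thms)
      qed
    qed
    also have "\<dots> = card F * (2 * p * potential V D p Ms lab)"
      unfolding potential_def case_prod_unfold sum_distrib_left ..
    finally show ?thesis .
  qed
  have Y: "(\<Sum>f\<in>F. \<Sum>m\<in>Ms. \<Sum>v\<in>V - {1}. e v (sent E (tot f) lab v m)) \<le> card F * (card Ms * card V * \<eta>)"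
  proof -
    have one: "(\<Sum>f\<in>F. e v (sent E (tot f) lab v m)) \<le> \<eta> * card F" if m: "m \<in> Ms" and v: "v \<in> V - {1}" for m v
      unfolding sent_tot[OF m] F_def
    proof (rule sum_PiE_marginal_le)
      show "inj_on (\<lambda>u. ((u, v), lab u m)) (inn E v)" by (auto simp: inj_on_def)
      show "(\<lambda>u. ((u, v), lab u m)) ` inn E v \<subseteq> I" using inI m by auto
      show "(\<Sum>x\<in>PiE (inn E v) (\<lambda>k. B ((k, v), lab k m)). e v x) \<le> \<eta> * card (PiE (inn E v) (\<lambda>k. B ((k, v), lab k m)))"
        using e[OF v] by (simp add: B_def)
    qed (use finI finB e0 in auto)
    have "(\<Sum>f\<in>F. \<Sum>m\<in>Ms. \<Sum>v\<in>V - {1}. e v (sent E (tot f) lab v m))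
      = (\<Sum>m\<in>Ms. \<Sum>f\<in>F. \<Sum>v\<in>V - {1}. e v (sent E (tot f) lab v m))" by (rule sum.swap)
    also have "\<dots> = (\<Sum>m\<in>Ms. \<Sum>v\<in>V - {1}. \<Sum>f\<in>F. e v (sent E (tot f) lab v m))"
      by (intro sum.cong refl sum.swap)
    also have "\<dots> \<le> (\<Sum>m\<in>Ms. \<Sum>v\<in>V - {1}. \<eta> * card F)" by (intro sum_mono one)
    also have "\<dots> = card F * (card Ms * card (V - {1}) * \<eta>)" by simp
    also have "\<dots> \<le> card F * (card Ms * card V * \<eta>)"
    proof -
      have "card Ms * card (V - {1}) \<le> card Ms * card V" using V by (intro mult_le_mono2 card_mono) auto
      then have "real (card Ms * card (V - {1})) * \<eta> \<le> real (card Ms * card V) * \<eta>"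
        by (intro mult_right_mono of_nat_mono less_imp_le[OF \<eta>])
      then show ?thesis by (intro mult_left_mono) auto
    qed
    finally show ?thesis .
  qed
  have pos: "real (card Ms * card V) * \<eta> > 0" 
  proof -
    have "card Ms > 0" "card V > 0" using Ms V by (auto simp: card_gt_0_iff)
    then show ?thesis using \<eta> by simp
  qed
  have pot0: "potential V D p Ms lab' \<ge> 0" for lab'
    unfolding potential_def using p by (intro sum_nonneg) auto
  \<comment> \<open>The factor 4 has two sources: 2 for the two ways in which a pair can stay
    confused, and 2 for taking one function that is good for the potential and for the decoding
    errors at once.\<close>
  have "\<exists>f\<in>F. potential V D p Ms (next_lab E comb (tot f) lab) \<le> 2 * (2 * p * potential V D p Ms lab) \<and>
    (\<Sum>m\<in>Ms. \<Sum>v\<in>V - {1}. e v (sent E (tot f) lab v m)) \<le> 2 * (card Ms * card V * \<eta>)"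
    by (rule exists_le_two_averages[OF F pot0 _ X Y pos]) (intro sum_nonneg e0)
  then obtain f where f: "f \<in> F" "potential V D p Ms (next_lab E comb (tot f) lab) \<le> 2 * (2 * p * potential V D p Ms lab)"
    "(\<Sum>m\<in>Ms. \<Sum>v\<in>V - {1}. e v (sent E (tot f) lab v m)) \<le> 2 * (card Ms * card V * \<eta>)" by blast
  have "potential V D p Ms (next_lab E comb (tot f) lab) \<le> 4 * p * potential V D p Ms lab" using f(2) by simp
  then show ?thesis using tot_in[OF f(1)] f(3) by blast
qed

primrec labels :: "(nat \<times> nat) set \<Rightarrow> (nat \<Rightarrow> (nat \<Rightarrow> 'x) \<Rightarrow> nat) \<Rightarrow> (nat \<Rightarrow> nat \<times> nat \<Rightarrow> nat list \<Rightarrow> 'x)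
   \<Rightarrow> nat \<Rightarrow> nat \<Rightarrow> nat \<Rightarrow> nat list" where
  "labels E comb fs 0 = (\<lambda>v m. if v = 1 then [m] else [])"
| "labels E comb fs (Suc b) = next_lab E comb (fs b) (labels E comb fs b)"

lemma labels_source: "labels E comb fs b 1 m = [m]"
  by (induction b) (auto simp: next_lab_def)

text \<open>The random choice is removed block by block: the functions of block \<open>b\<close> are
  fixed by \<open>network_step\<close> for the labels that the earlier choices produced. Every
  weight is at most 1, so the potential starts at no more than the number of ordered pairs.\<close>

lemma network_code:
  fixes A :: "nat \<times> nat \<Rightarrow> 'x set" and e :: "nat \<Rightarrow> (nat \<Rightarrow> 'x) \<Rightarrow> real" and p \<eta> :: real
  assumes V: "finite V" "1 \<in> V" and E: "E \<subseteq> V \<times> V" and Ms: "finite Ms" "Ms \<noteq> {}"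
    and A: "\<And>a. a \<in> E \<Longrightarrow> finite (A a)" "\<And>a. a \<in> E \<Longrightarrow> A a \<noteq> {}"
    and inj: "\<And>v x y u. v \<in> V \<Longrightarrow> x \<in> PiE (inn E v) (\<lambda>u. A (u, v)) \<Longrightarrow> y \<in> PiE (inn E v) (\<lambda>u. A (u, v))
       \<Longrightarrow> u \<in> inn E v \<Longrightarrow> (\<forall>w\<in>inn E v - {u}. x w = y w) \<Longrightarrow> comb v x = comb v y \<Longrightarrow> x u = y u"
    and cut: "\<And>S. S \<subseteq> V \<Longrightarrow> 1 \<in> S \<Longrightarrow> \<not> D \<subseteq> S \<Longrightarrow> \<exists>us. (\<forall>v\<in>{v\<in>V - S. inn E v \<inter> S \<noteq> {}}. us v \<in> inn E v \<inter> S) \<and>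
         1 \<le> p * (\<Prod>v\<in>{v\<in>V - S. inn E v \<inter> S \<noteq> {}}. real (card (A (us v, v))))"
    and e0: "\<And>v x. e v x \<ge> 0"
    and e: "\<And>v. v \<in> V - {1} \<Longrightarrow> (\<Sum>x\<in>PiE (inn E v) (\<lambda>u. A (u, v)). e v x) \<le> \<eta> * card (PiE (inn E v) (\<lambda>u. A (u, v)))"
    and p: "0 < p" "p \<le> 1" and \<eta>: "\<eta> > 0"
  shows "\<exists>fs. (\<forall>b a l. a \<in> E \<longrightarrow> fs b a l \<in> A a) \<and>
     (\<forall>b. potential V D p Ms (labels E comb fs b) \<le> (4 * p) ^ b * (real (card Ms))\<^sup>2) \<and>
     (\<forall>b. (\<Sum>m\<in>Ms. \<Sum>v\<in>V - {1}. e v (sent E (fs b) (labels E comb fs b) v m)) \<le> 2 * (card Ms * card V * \<eta>))"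
proof -
  define Q where "Q = (\<lambda>lab f. (\<forall>a l. a \<in> E \<longrightarrow> f a l \<in> A a) \<and>
     potential V D p Ms (next_lab E comb f lab) \<le> 4 * p * potential V D p Ms lab \<and>
     (\<Sum>m\<in>Ms. \<Sum>v\<in>V - {1}. e v (sent E f lab v m)) \<le> 2 * (card Ms * card V * \<eta>))"
  have step: "\<exists>f. Q lab f" if "\<And>m. lab 1 m = [m]" for lab
    unfolding Q_def
  proof (rule network_step[where A = A and e = e and comb = comb and V = V and Ms = Ms and D = D])
    show "lab 1 m \<noteq> lab 1 m'" if "m \<noteq> m'" for m m' using that by (simp only: \<open>\<And>m. lab 1 m = [m]\<close>) simp
  qed (rule V E Ms p \<eta> e0 | erule A e | (rule inj; assumption) | (rule cut; assumption))+
  define F where "F = (\<lambda>lab. SOME f. Q lab f)"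
  \<comment> \<open>\<open>labels\<close> expects all functions as input, whereas the choice for
    block \<open>b\<close> depends on the labels before it. The recursion \<open>L\<close> runs
    choice and labelling together, and \<open>fs\<close> is read off afterwards.\<close>
  define L where "L = rec_nat (\<lambda>v m. if v = 1 then [m] else []) (\<lambda>b lab. next_lab E comb (F lab) lab)"
  define fs where "fs = (\<lambda>b. F (L b))"
  have L0: "L 0 = (\<lambda>v m. if v = 1 then [m] else [])" by (simp only: L_def nat.rec)
  have LS: "L (Suc b) = next_lab E comb (F (L b)) (L b)" for b by (simp only: L_def nat.rec)
  have L: "labels E comb fs b = L b" for b by (induction b) (simp_all only: labels.simps L0 LS fs_def)
  have Q: "Q (labels E comb fs b) (fs b)" for b
  proof -
    have "L b 1 m = [m]" for m using labels_source[of E comb fs b m] unfolding L .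
    then have "\<exists>f. Q (L b) f" by (rule step)
    then have "Q (L b) (F (L b))" unfolding F_def by (rule someI_ex)
    then show ?thesis unfolding L unfolding fs_def .
  qed
  have pot: "potential V D p Ms (labels E comb fs b) \<le> (4 * p) ^ b * (real (card Ms))\<^sup>2" for b
  proof (induction b)
    case 0
    have "potential V D p Ms (labels E comb fs 0) \<le> (\<Sum>(m, m')\<in>Ms \<times> Ms. 1)"
      unfolding potential_def
    proof (rule sum_mono, clarify)
      fix m m'
      have "p ^ k \<le> 1" for k using p by (intro power_le_one) auto
      then show "(if m = m' \<or> D \<subseteq> dist_nodes V (labels E comb fs 0) m m' then 0
          else p ^ card (dist_nodes V (labels E comb fs 0) m m')) \<le> 1"
        by (simp only: split: if_split) simp
    qed
    also have "(\<Sum>(m, m')\<in>Ms \<times> Ms. 1) = (real (card Ms))\<^sup>2"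
      by (simp add: card_cartesian_product power2_eq_square case_prod_unfold)
    finally show ?case by (simp only: power_0 mult_1)
  next
    case (Suc b)
    have "potential V D p Ms (labels E comb fs (Suc b)) \<le> 4 * p * potential V D p Ms (labels E comb fs b)"
      using Q[of b] unfolding Q_def labels.simps by (elim conjE)
    also have "\<dots> \<le> 4 * p * ((4 * p) ^ b * (real (card Ms))\<^sup>2)" using p Suc by (intro mult_left_mono) auto
    finally show ?case by (simp add: mult_ac)
  qed
  show ?thesis
  proof (intro exI[of _ fs] conjI allI impI)
    show "fs b a l \<in> A a" if "a \<in> E" for b a l using Q[of b] that unfolding Q_def by blast
    show "(\<Sum>m\<in>Ms. \<Sum>v\<in>V - {1}. e v (sent E (fs b) (labels E comb fs b) v m)) \<le> 2 * (card Ms * card V * \<eta>)" for b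
      using Q[of b] unfolding Q_def by (elim conjE)
  qed (rule pot)
qed

text \<open>Each bad message is charged to one partner with which it is confused. The resulting
  ordered pairs are distinct, and each weighs at least \<open>p ^ card V\<close>.\<close>

lemma bad_messages_le:
  fixes p :: real
  assumes V: "finite V" and Ms: "finite Ms" and p: "0 < p" "p \<le> 1" and D: "D \<subseteq> V"
  shows "card {m \<in> Ms. \<exists>m'\<in>Ms. m \<noteq> m' \<and> (\<exists>d\<in>D. lab d m = lab d m')} * p ^ card V \<le> potential V D p Ms lab"
proof -
  let ?Bd = "{m \<in> Ms. \<exists>m'\<in>Ms. m \<noteq> m' \<and> (\<exists>d\<in>D. lab d m = lab d m')}"
  have "\<forall>m\<in>?Bd. \<exists>m'. m' \<in> Ms \<and> m \<noteq> m' \<and> (\<exists>d\<in>D. lab d m = lab d m')" by blast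
  from bchoice[OF this] obtain pr where
    pr: "\<And>m. m \<in> ?Bd \<Longrightarrow> pr m \<in> Ms \<and> m \<noteq> pr m \<and> (\<exists>d\<in>D. lab d m = lab d (pr m))" by blast
  let ?w = "\<lambda>q. (if fst q = snd q \<or> D \<subseteq> dist_nodes V lab (fst q) (snd q) then 0 else p ^ card (dist_nodes V lab (fst q) (snd q)))"
  have "card ?Bd * p ^ card V = (\<Sum>m\<in>?Bd. p ^ card V)" by simp
  also have "\<dots> \<le> (\<Sum>m\<in>?Bd. ?w (m, pr m))"
  proof (rule sum_mono)
    fix m assume m: "m \<in> ?Bd"
    have "card (dist_nodes V lab m (pr m)) \<le> card V"
      using V by (intro card_mono) (auto simp: dist_nodes_def)
    then have "p ^ card V \<le> p ^ card (dist_nodes V lab m (pr m))" using p by (intro power_decreasing) auto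
    moreover have "\<not> D \<subseteq> dist_nodes V lab m (pr m)" "m \<noteq> pr m" using pr[OF m] unfolding dist_nodes_def by blast+
    ultimately show "p ^ card V \<le> ?w (m, pr m)" by simp
  qed
  also have "\<dots> = (\<Sum>q\<in>(\<lambda>m. (m, pr m)) ` ?Bd. ?w q)" by (subst sum.reindex) (auto simp: inj_on_def)
  also have "\<dots> \<le> (\<Sum>q\<in>Ms \<times> Ms. ?w q)"
    using Ms pr p by (intro sum_mono2) auto
  finally show ?thesis by (simp add: potential_def case_prod_unfold)
qed

section \<open>Received signals as functions of the noise\<close>

lemma hist_received: "t \<le> k \<Longrightarrow> hist E src enc m z k v t = received E src enc m z v t"
proof (induction k)
  case (Suc k)
  show ?case
  proof (cases "t \<le> k")
    case True then show ?thesis using Suc by simp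
  next
    case False
    then have "t = Suc k" using Suc by simp
    then show ?thesis by (simp add: received_def)
  qed
qed (simp add: received_def)

lemma chan_in_cong:
  "(\<And>s. s \<in> {1..<t} \<Longrightarrow> H u s = H' u s) \<Longrightarrow> chan_in src enc m H u v t = chan_in src enc m H' u v t"
  by (simp add: chan_in_def cong: restrict_cong)

lemma chan_input_received:
  "chan_input E src enc m z u v t = chan_in src enc m (received E src enc m z) u v t"
  unfolding chan_input_def by (rule chan_in_cong) (auto intro: hist_received)

lemma received_eq:
  assumes "t \<ge> 1"
  shows "received E src enc m z v t = (\<Sum>u\<in>inn E v. chan_in src enc m (received E src enc m z) u v t) + z (v, t)"
proof -
  obtain k where k: "t = Suc k" using assms by (cases t) auto
  have "received E src enc m z v t = (\<Sum>u\<in>inn E v. chan_in src enc m (hist E src enc m z k) u v t) + z (v, t)"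
    by (simp add: received_def k)
  also have "(\<Sum>u\<in>inn E v. chan_in src enc m (hist E src enc m z k) u v t)
      = (\<Sum>u\<in>inn E v. chan_in src enc m (received E src enc m z) u v t)"
    by (intro sum.cong refl chan_in_cong) (auto simp: k intro: hist_received)
  finally show ?thesis .
qed

text \<open>Induction on time. Edge set and measurable space are left general because the cut
  argument also runs the recursion on the edges that start outside \<open>S\<close>, fed with the
  crossing signals instead of the noise.\<close>

lemma received_measurable:
  assumes E: "\<And>u v. (u, v) \<in> E \<Longrightarrow> u \<in> W \<or> u = 1" "\<And>u. (u, 1) \<notin> E"
    and enc: "\<And>u w t. (u, w) \<in> E \<Longrightarrow> u \<noteq> 1 \<Longrightarrow> t \<in> {1..N} \<Longrightarrow> enc u w t \<in> borel_measurable (PiM {1..<t} (\<lambda>_. borel))"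
    and z: "\<And>v t. v \<in> W \<Longrightarrow> t \<in> {1..N} \<Longrightarrow> (\<lambda>z. z (v, t)) \<in> borel_measurable M"
  shows "v \<in> W \<Longrightarrow> t \<in> {1..N} \<Longrightarrow> (\<lambda>z. received E src enc m z v t) \<in> borel_measurable M"
    and "(u, v) \<in> E \<Longrightarrow> t \<in> {1..N} \<Longrightarrow> (\<lambda>z. chan_in src enc m (received E src enc m z) u v t) \<in> borel_measurable M"
proof -
  have ch: "(\<lambda>z. chan_in src enc m (received E src enc m z) u v t) \<in> borel_measurable M"
    if uv: "(u, v) \<in> E" and t: "t \<in> {1..N}"
      and IH: "\<And>s u. s \<in> {1..<t} \<Longrightarrow> u \<in> W \<Longrightarrow> (\<lambda>z. received E src enc m z u s) \<in> borel_measurable M" for u v t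
  proof (cases "u = 1")
    case True then show ?thesis by (simp add: chan_in_def)
  next
    case False
    then have "u \<in> W" using E(1)[OF uv] by simp
    then have "(\<lambda>z. \<lambda>s\<in>{1..<t}. received E src enc m z u s) \<in> measurable M (PiM {1..<t} (\<lambda>_. borel))"
      by (intro measurable_restrict IH)
    from measurable_compose[OF this enc[OF uv False t]] show ?thesis using False by (simp add: chan_in_def)
  qed
  have rec: "t \<in> {1..N} \<Longrightarrow> v \<in> W \<Longrightarrow> (\<lambda>z. received E src enc m z v t) \<in> borel_measurable M" for t v
  proof (induction t arbitrary: v rule: less_induct)
    case (less t)
    have IH: "(\<lambda>z. received E src enc m z u s) \<in> borel_measurable M" if "s \<in> {1..<t}" "u \<in> W" for s u
      using that less.prems(1) by (intro less.IH) auto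
    have "(\<lambda>z. chan_in src enc m (received E src enc m z) u v t) \<in> borel_measurable M" if "u \<in> inn E v" for u
    proof (rule ch[OF _ less.prems(1) IH])
      show "(u, v) \<in> E" using that by (simp add: inn_def)
    qed
    then have "(\<lambda>z. (\<Sum>u\<in>inn E v. chan_in src enc m (received E src enc m z) u v t) + z (v, t)) \<in> borel_measurable M"
      by (intro borel_measurable_add borel_measurable_sum z less.prems)
    moreover have "(\<lambda>z. received E src enc m z v t)
        = (\<lambda>z. (\<Sum>u\<in>inn E v. chan_in src enc m (received E src enc m z) u v t) + z (v, t))"
      using less.prems by (intro ext received_eq) simp
    ultimately show ?case by (rule ssubst[rotated])
  qed
  show "(\<lambda>z. received E src enc m z v t) \<in> borel_measurable M" if "v \<in> W" "t \<in> {1..N}"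
    by (rule rec[OF that(2,1)])
  show "(\<lambda>z. chan_in src enc m (received E src enc m z) u v t) \<in> borel_measurable M" if "(u, v) \<in> E" and t: "t \<in> {1..N}"
  proof (rule ch[OF that])
    fix s u assume "s \<in> {1..<t}" "u \<in> W"
    then show "(\<lambda>z. received E src enc m z u s) \<in> borel_measurable M" using t by (intro rec) auto
  qed
qed

section \<open>The physical block code\<close>

text \<open>The label as a relay reconstructs it from its received signal. Time starts at 1, so
  block \<open>i\<close> occupies the times \<open>i * n + 1\<close> to
  \<open>i * n + n\<close>.\<close>

definition dec_label :: "nat \<Rightarrow> (nat \<Rightarrow> (nat \<Rightarrow> real) \<Rightarrow> nat) \<Rightarrow> nat \<Rightarrow> nat \<Rightarrow> (nat \<Rightarrow> real) \<Rightarrow> nat list" where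
  "dec_label n G u b y = map (\<lambda>i. G u (\<lambda>j\<in>{..<n}. y (i * n + j + 1))) [0..<b]"

text \<open>After \<open>B\<close> full blocks every transmitter is silent, which accommodates
  lengths \<open>N\<close> that are not multiples of \<open>n\<close> at no cost in power.\<close>

definition net_src where
  "net_src n B fs v t m = (if (t - 1) div n < B then fs ((t - 1) div n) (1, v) [m] ((t - 1) mod n) else 0)"

definition net_enc where
  "net_enc n B G fs u v t y = (if (t - 1) div n < B
     then fs ((t - 1) div n) (u, v) (dec_label n G u ((t - 1) div n) y) ((t - 1) mod n) else 0)"

definition net_dec where
  "net_dec n B M G lab d y = (SOME m. m \<in> {1..M} \<and> lab d m = dec_label n G d B y)"

lemma dec_label_Suc: "dec_label n G u (Suc b) y = dec_label n G u b y @ [G u (\<lambda>j\<in>{..<n}. y (b * n + j + 1))]"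
  by (simp add: dec_label_def)

lemma block_index_le:
  fixes i j n b :: nat
  assumes "i < b" "j < n"
  shows "i * n + j + 1 \<le> b * n"
proof -
  have "i * n + j + 1 \<le> i * n + n" using assms by simp
  also have "\<dots> = Suc i * n" by simp
  also have "\<dots> \<le> b * n" using assms by (intro mult_le_mono1) simp
  finally show ?thesis .
qed

lemma dec_label_cong:
  assumes "\<And>s. 1 \<le> s \<Longrightarrow> s \<le> b * n \<Longrightarrow> y s = y' s"
  shows "dec_label n G u b y = dec_label n G u b y'"
  unfolding dec_label_def
proof (rule map_cong[OF refl])
  fix i assume "i \<in> set [0..<b]"
  then have "(\<lambda>j\<in>{..<n}. y (i * n + j + 1)) = (\<lambda>j\<in>{..<n}. y' (i * n + j + 1))"
    by (intro restrict_ext assms block_index_le) auto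
  then show "G u (\<lambda>j\<in>{..<n}. y (i * n + j + 1)) = G u (\<lambda>j\<in>{..<n}. y' (i * n + j + 1))" by (rule arg_cong)
qed

lemma dec_label_measurable:
  assumes G: "G u \<in> measurable (PiM {..<n} (\<lambda>_. borel)) (count_space UNIV)" and J: "{1..b * n} \<subseteq> J"
  shows "dec_label n G u b \<in> measurable (PiM J (\<lambda>_. borel)) (count_space UNIV)"
  using J
proof (induction b)
  case 0
  then show ?case by (simp add: dec_label_def)
next
  case (Suc b)
  let ?M = "PiM J (\<lambda>_. borel :: real measure)"
  have F: "dec_label n G u b \<in> measurable ?M (count_space UNIV)"
    by (rule Suc.IH) (rule subset_trans[OF _ Suc.prems], simp)
  have "(\<lambda>y. \<lambda>j\<in>{..<n}. y (b * n + j + 1)) \<in> measurable ?M (PiM {..<n} (\<lambda>_. borel))"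
  proof (intro measurable_restrict measurable_component_singleton)
    fix j assume "j \<in> {..<n}"
    then show "b * n + j + 1 \<in> J" using block_index_le[of b "Suc b" j n] by (intro subsetD[OF Suc.prems]) auto
  qed
  from measurable_compose[OF this G]
  have g: "(\<lambda>y. G u (\<lambda>j\<in>{..<n}. y (b * n + j + 1))) \<in> measurable ?M (count_space UNIV)" .
  have "(\<lambda>y. l @ [G u (\<lambda>j\<in>{..<n}. y (b * n + j + 1))]) \<in> measurable ?M (count_space UNIV)" for l
    by (rule measurable_compose[OF g]) simp
  from measurable_compose_countable[OF this F] show ?case unfolding dec_label_Suc .
qed

lemma sum_blocks:
  fixes g :: "nat \<Rightarrow> real"
  shows "(\<Sum>t=1..B * n. g t) = (\<Sum>b<B. \<Sum>j<n. g (b * n + j + 1))"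
proof -
  have "(\<Sum>t=1..B * n. g t) = (\<Sum>s<B * n. g (Suc s))" by (simp add: sum.atLeast1_atMost_eq)
  also have "\<dots> = (\<Sum>b<B. \<Sum>s\<in>{b * n..<b * n + n}. g (Suc s))" by (rule sum.nat_group[symmetric])
  also have "\<dots> = (\<Sum>b<B. \<Sum>j<n. g (b * n + j + 1))"
  proof (rule sum.cong[OF refl])
    fix b
    show "(\<Sum>s\<in>{b * n..<b * n + n}. g (Suc s)) = (\<Sum>j<n. g (b * n + j + 1))"
      by (subst sum.atLeastLessThan_shift_0) (simp add: lessThan_atLeast0)
  qed
  finally show ?thesis .
qed

text \<open>The noise of one block at one receiver consists of distinct coordinates of an i.i.d.
  product, hence has law \<open>gauss_vec n\<close>. This identifies the error of a single
  computation code with an event of the network noise.\<close>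

lemma noise_block_prob:
  assumes v: "v \<in> nodes nV - {1}" and b: "b < B" and BN: "B * n \<le> N"
    and S: "{x \<in> space (gauss_vec n). Q x} \<in> sets (gauss_vec n)"
  shows "{z \<in> space (noise nV N). Q (\<lambda>j\<in>{..<n}. z (v, b * n + j + 1))} \<in> sets (noise nV N)"
    and "measure (noise nV N) {z \<in> space (noise nV N). Q (\<lambda>j\<in>{..<n}. z (v, b * n + j + 1))}
       = measure (gauss_vec n) {x \<in> space (gauss_vec n). Q x}"
proof -
  let ?\<phi> = "\<lambda>z. \<lambda>j\<in>{..<n}. z (v, b * n + j + 1)" and ?K = "(nodes nV - {1}) \<times> {1..N}"
  have mem: "(\<lambda>j. (v, b * n + j + 1)) \<in> {..<n} \<rightarrow> ?K"
  proof
    fix j assume "j \<in> {..<n}"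
    then have "b * n + j + 1 \<le> N" using block_index_le[OF b, of j n] BN by simp
    then show "(v, b * n + j + 1) \<in> ?K" using v by simp
  qed
  have d: "distr (PiM ?K (\<lambda>_. gauss)) (gauss_vec n) ?\<phi> = gauss_vec n"
    by (rule distr_PiM_reindex[where M = "\<lambda>_. gauss" and f = "\<lambda>j. (v, b * n + j + 1)", OF prob_space_gauss _ mem])
       (simp add: inj_on_def)
  have m: "?\<phi> \<in> measurable (noise nV N) (gauss_vec n)"
    unfolding noise_def
    by (intro measurable_restrict measurable_component_singleton) (use mem in \<open>auto dest: funcset_mem\<close>)
  have eq: "?\<phi> -` {x \<in> space (gauss_vec n). Q x} \<inter> space (noise nV N)
      = {z \<in> space (noise nV N). Q (?\<phi> z)}"
    using measurable_space[OF m] by blast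
  show "{z \<in> space (noise nV N). Q (?\<phi> z)} \<in> sets (noise nV N)"
    using measurable_sets[OF m S] unfolding eq .
  have "measure (gauss_vec n) {x \<in> space (gauss_vec n). Q x}
      = measure (distr (noise nV N) (gauss_vec n) ?\<phi>) {x \<in> space (gauss_vec n). Q x}"
    using d by (simp add: noise_def)
  also have "\<dots> = measure (noise nV N) {z \<in> space (noise nV N). Q (?\<phi> z)}"
    unfolding measure_distr[OF m S] eq ..
  finally show "measure (noise nV N) {z \<in> space (noise nV N). Q (?\<phi> z)}
       = measure (gauss_vec n) {x \<in> space (gauss_vec n). Q x}" ..
qed

lemma prob_space_noise: "prob_space (noise nV N)"
  unfolding noise_def by (intro prob_space_PiM prob_space_gauss)

text \<open>As long as every receiver decodes every sum correctly, the reconstructed labels equal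
  those of the noiseless network. Transmission then fails only for a message that shares its final
  label with another message at some destination. The two terms are these messages and the union
  bound over all decoding failures.\<close>

lemma block_code:
  fixes fs :: "nat \<Rightarrow> nat \<times> nat \<Rightarrow> nat list \<Rightarrow> nat \<Rightarrow> real"
    and comb :: "nat \<Rightarrow> (nat \<Rightarrow> nat \<Rightarrow> real) \<Rightarrow> nat" and P :: "nat \<times> nat \<Rightarrow> real"
  assumes net: "gaussian_network nV E D" and n: "n > 0" and BN: "B * n \<le> N" and M: "M \<ge> 1"
    and Gm: "\<And>v. v \<in> nodes nV - {1} \<Longrightarrow> G v \<in> measurable (PiM {..<n} (\<lambda>_. borel)) (count_space UNIV)"
    and P0: "\<And>a. a \<in> E \<Longrightarrow> P a \<ge> 0"
    and pw: "\<And>b u v l. (u, v) \<in> E \<Longrightarrow> (\<Sum>j<n. (fs b (u, v) l j)\<^sup>2) \<le> n * P (u, v)"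
  defines "lab \<equiv> labels E comb fs"
  defines "e \<equiv> \<lambda>v x. measure (gauss_vec n) {z \<in> space (gauss_vec n). G v (\<lambda>i\<in>{..<n}. (\<Sum>u\<in>inn E v. x u i) + z i) \<noteq> comb v x}"
  shows "\<exists>src enc dec. valid_code nV E D P N M src enc dec \<and>
    error_prob nV E D N M src enc dec * M \<le>
      real (card {m \<in> {1..M}. \<exists>m'\<in>{1..M}. m \<noteq> m' \<and> (\<exists>d\<in>D. lab B d m = lab B d m')})
      + (\<Sum>b<B. \<Sum>m\<in>{1..M}. \<Sum>v\<in>nodes nV - {1}. e v (sent E (fs b) (lab b) v m))"
proof -
  interpret N: prob_space "noise nV N" by (rule prob_space_noise)
  define src where "src = net_src n B fs"
  define enc where "enc = net_enc n B G fs"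
  define dec where "dec = net_dec n B M G (lab B)"
  have edge: "u \<in> nodes nV" "v \<in> nodes nV - {1}" if "(u, v) \<in> E" for u v
  proof -
    have "E \<subseteq> nodes nV \<times> nodes nV" "(u, 1) \<notin> E" using net unfolding gaussian_network_def by blast+
    then show "u \<in> nodes nV" "v \<in> nodes nV - {1}" using that by auto
  qed
  have Dn: "d \<in> nodes nV - {1}" if "d \<in> D" for d using net that unfolding gaussian_network_def by blast
  define R where "R = (\<lambda>m z. received E src enc m z)"
  define lb where "lb = (\<lambda>m z u b. if u = 1 then [m] else dec_label n G u b (R m z u))"
  have bi: "(b * n + j + 1 - 1) div n = b" "(b * n + j + 1 - 1) mod n = j" if "j < n" for b j using that by auto
  have inp: "chan_in src enc m (R m z) u v (b * n + j + 1) = fs b (u, v) (lb m z u b) j"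
    if b: "b < B" and j: "j < n" for m z u v b j
  proof (cases "u = 1")
    case True
    have "chan_in src enc m (R m z) u v (b * n + j + 1) = src v (b * n + j + 1) m" using True by (simp only: chan_in_def if_True simp_thms)
    also have "\<dots> = fs b (1, v) [m] j" unfolding src_def net_src_def bi[OF j] using b by (simp only: if_True)
    finally show ?thesis unfolding lb_def using True by (simp only: if_True simp_thms)
  next
    case False
    have "dec_label n G u b (restrict (R m z u) {1..<b * n + j + 1}) = dec_label n G u b (R m z u)"
      by (rule dec_label_cong) simp
    then have "enc u v (b * n + j + 1) (restrict (R m z u) {1..<b * n + j + 1}) = fs b (u, v) (dec_label n G u b (R m z u)) j"
      unfolding enc_def net_enc_def bi[OF j] using b by (simp only: if_True)
    then show ?thesis unfolding chan_in_def lb_def using False by (simp only: if_False)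
  qed
  have inp0: "chan_in src enc m (R m z) u v t = 0" if t: "B * n < t" for m z u v t
  proof -
    have "B * n \<le> t - 1" using t by simp
    then have "\<not> (t - 1) div n < B" using n by (simp add: not_less less_eq_div_iff_mult_less_eq)
    then show ?thesis by (simp only: chan_in_def src_def enc_def net_src_def net_enc_def if_False if_cancel)
  qed
  have valid: "valid_code nV E D P N M src enc dec"
    unfolding valid_code_def
  proof (intro conjI allI impI ballI)
    show "M \<ge> 1" by (rule M)
  next
    fix u w t assume h: "(u, w) \<in> E \<and> u \<noteq> 1 \<and> t \<in> {1..N}"
    let ?b = "(t - 1) div n"
    have "?b * n < t" by (rule le_less_trans[OF div_times_less_eq_dividend]) (use h in auto)
    then have "{1..?b * n} \<subseteq> {1..<t}"
      by (metis atLeastAtMost_iff atLeastLessThan_iff le_less_trans subsetI)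
    moreover have "u \<in> nodes nV - {1}" using h edge by blast
    ultimately have "dec_label n G u ?b \<in> measurable (PiM {1..<t} (\<lambda>_. borel)) (count_space UNIV)"
      by (intro dec_label_measurable Gm)
    then have "(\<lambda>y. fs ?b (u, w) (dec_label n G u ?b y) ((t - 1) mod n)) \<in> borel_measurable (PiM {1..<t} (\<lambda>_. borel))"
      by (rule measurable_compose) simp
    then show "enc u w t \<in> borel_measurable (PiM {1..<t} (\<lambda>_. borel))"
      unfolding enc_def net_enc_def[abs_def] by (cases "?b < B") simp_all
  next
    fix d assume "d \<in> D"
    then have "dec_label n G d B \<in> measurable (PiM {1..N} (\<lambda>_. borel)) (count_space UNIV)"
      using BN by (intro dec_label_measurable Gm Dn) auto
    then show "dec d \<in> measurable (PiM {1..N} (\<lambda>_. borel)) (count_space UNIV)"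
      unfolding dec_def net_dec_def[abs_def] by (rule measurable_compose) simp
  next
    fix m z u w assume uw: "(u, w) \<in> E"
    let ?c = "\<lambda>t. chan_input E src enc m z u w t"
    have c: "?c t = chan_in src enc m (R m z) u w t" for t unfolding R_def by (rule chan_input_received)
    have "(\<Sum>t=1..N. (?c t)\<^sup>2) = (\<Sum>t=1..B * n. (?c t)\<^sup>2)"
    proof (rule sum.mono_neutral_right)
      show "\<forall>t\<in>{1..N} - {1..B * n}. (?c t)\<^sup>2 = 0" unfolding c by (auto simp: inp0)
    qed (use BN in auto)
    also have "\<dots> = (\<Sum>b<B. \<Sum>j<n. (?c (b * n + j + 1))\<^sup>2)" by (rule sum_blocks)
    also have "\<dots> = (\<Sum>b<B. \<Sum>j<n. (fs b (u, w) (lb m z u b) j)\<^sup>2)"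
      by (intro sum.cong refl) (simp only: c inp lessThan_iff)
    also have "\<dots> \<le> (\<Sum>b<B. n * P (u, w))" by (intro sum_mono pw uw)
    also have "\<dots> = real (B * n) * P (u, w)" by simp
    also have "\<dots> \<le> real N * P (u, w)" using BN by (intro mult_right_mono of_nat_mono P0 uw)
    finally have le: "(\<Sum>t=1..N. (?c t)\<^sup>2) \<le> real N * P (u, w)" .
    show "(\<Sum>t=1..N. (?c t)\<^sup>2) / real N \<le> P (u, w)"
    proof (cases "N = 0")
      case True then show ?thesis using P0[OF uw] by simp
    next
      case False then show ?thesis using le by (simp add: pos_divide_le_eq mult.commute)
    qed
  qed
  \<comment> \<open>The event refers to the codewords of the noiseless network, not to those
    actually sent. Its probability is therefore exactly \<open>e v\<close> at a fixed tuple, without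
    conditioning on earlier blocks; outside all these events the two kinds of codewords agree by
    induction.\<close>
  define Bd where "Bd = (\<lambda>m b v. {z \<in> space (noise nV N). G v (\<lambda>j\<in>{..<n}. (\<Sum>u\<in>inn E v. sent E (fs b) (lab b) v m u j)
      + (\<lambda>j\<in>{..<n}. z (v, b * n + j + 1)) j) \<noteq> comb v (sent E (fs b) (lab b) v m)})"
  have Bd: "Bd m b v \<in> sets (noise nV N)" "measure (noise nV N) (Bd m b v) = e v (sent E (fs b) (lab b) v m)"
    if b: "b < B" and v: "v \<in> nodes nV - {1}" for m b v
  proof -
    let ?X = "\<lambda>j. \<Sum>u\<in>inn E v. sent E (fs b) (lab b) v m u j" and ?c = "comb v (sent E (fs b) (lab b) v m)"
    have "(\<lambda>x. \<lambda>j\<in>{..<n}. ?X j + x j) \<in> measurable (gauss_vec n) (PiM {..<n} (\<lambda>_. borel))"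
      by (intro measurable_restrict borel_measurable_add borel_measurable_const measurable_gauss_vec_coord) simp
    from measurable_compose[OF this Gm[OF v]]
    have [measurable]: "(\<lambda>x. G v (\<lambda>j\<in>{..<n}. ?X j + x j)) \<in> measurable (gauss_vec n) (count_space UNIV)" .
    have S: "{x \<in> space (gauss_vec n). G v (\<lambda>j\<in>{..<n}. ?X j + x j) \<noteq> ?c} \<in> sets (gauss_vec n)"
      by measurable
    show "Bd m b v \<in> sets (noise nV N)" unfolding Bd_def by (rule noise_block_prob(1)[OF v b BN S])
    show "measure (noise nV N) (Bd m b v) = e v (sent E (fs b) (lab b) v m)"
      unfolding Bd_def e_def by (rule noise_block_prob(2)[OF v b BN S])
  qed
  have track: "\<forall>v\<in>nodes nV. lb m z v b = lab b v m"
    if good: "\<And>b v. b < B \<Longrightarrow> v \<in> nodes nV - {1} \<Longrightarrow> z \<notin> Bd m b v" and z: "z \<in> space (noise nV N)" and bB: "b \<le> B" for m z b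
    using bB
  proof (induction b)
    case 0
    show ?case by (simp add: lb_def lab_def dec_label_def)
  next
    case (Suc b)
    then have b: "b < B" and IH: "\<And>v. v \<in> nodes nV \<Longrightarrow> lb m z v b = lab b v m" by auto
    show ?case
    proof
      fix v assume v: "v \<in> nodes nV"
      show "lb m z v (Suc b) = lab (Suc b) v m"
      proof (cases "v = 1")
        case True then show ?thesis unfolding lb_def lab_def by (simp only: if_True labels_source simp_thms)
      next
        case False
        have rec: "R m z v (b * n + j + 1) = (\<Sum>u\<in>inn E v. sent E (fs b) (lab b) v m u j) + z (v, b * n + j + 1)" if j: "j < n" for j
        proof -
          have "R m z v (b * n + j + 1) = (\<Sum>u\<in>inn E v. chan_in src enc m (R m z) u v (b * n + j + 1)) + z (v, b * n + j + 1)"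
            unfolding R_def by (rule received_eq) simp
          also have "(\<Sum>u\<in>inn E v. chan_in src enc m (R m z) u v (b * n + j + 1)) = (\<Sum>u\<in>inn E v. sent E (fs b) (lab b) v m u j)"
          proof (rule sum.cong[OF refl])
            fix u assume u: "u \<in> inn E v"
            then have "u \<in> nodes nV" using edge(1)[of u v] by (simp add: inn_def)
            then show "chan_in src enc m (R m z) u v (b * n + j + 1) = sent E (fs b) (lab b) v m u j"
              unfolding inp[OF b j] sent_def using u by (simp only: IH restrict_apply if_True)
          qed
          finally show ?thesis .
        qed
        have "G v (\<lambda>j\<in>{..<n}. R m z v (b * n + j + 1)) = comb v (sent E (fs b) (lab b) v m)"
        proof -
          have "(\<lambda>j\<in>{..<n}. R m z v (b * n + j + 1)) = (\<lambda>j\<in>{..<n}. (\<Sum>u\<in>inn E v. sent E (fs b) (lab b) v m u j)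
              + (\<lambda>j\<in>{..<n}. z (v, b * n + j + 1)) j)"
            by (rule restrict_ext) (simp only: rec lessThan_iff restrict_apply if_True)
          moreover have "z \<notin> Bd m b v" using good[OF b] v False by simp
          ultimately show ?thesis using z unfolding Bd_def by simp
        qed
        then show ?thesis using False IH[OF v] unfolding lb_def lab_def labels.simps next_lab_def
          by (simp only: if_False dec_label_Suc)
      qed
    qed
  qed
  let ?bad = "{m \<in> {1..M}. \<exists>m'\<in>{1..M}. m \<noteq> m' \<and> (\<exists>d\<in>D. lab B d m = lab B d m')}"
  let ?Er = "\<lambda>m. {z \<in> space (noise nV N). \<exists>d\<in>D. dec d (restrict (received E src enc m z d) {1..N}) \<noteq> m}"
  have err: "measure (noise nV N) (?Er m) \<le> of_bool (m \<in> ?bad) + (\<Sum>b<B. \<Sum>v\<in>nodes nV - {1}. e v (sent E (fs b) (lab b) v m))"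
    if m: "m \<in> {1..M}" for m
  proof (cases "m \<in> ?bad")
    case True
    have "0 \<le> (\<Sum>b<B. \<Sum>v\<in>nodes nV - {1}. e v (sent E (fs b) (lab b) v m))"
      unfolding e_def by (intro sum_nonneg measure_nonneg)
    then show ?thesis using N.prob_le_1[of "?Er m"] True by (simp only: of_bool_eq)
  next
    case False
    have finV: "finite (nodes nV - {1})" by (simp add: nodes_def)
    have sub: "?Er m \<subseteq> (\<Union>b\<in>{..<B}. \<Union>v\<in>nodes nV - {1}. Bd m b v)"
    proof (rule subsetI, rule ccontr)
      fix z assume z: "z \<in> ?Er m" and nz: "z \<notin> (\<Union>b\<in>{..<B}. \<Union>v\<in>nodes nV - {1}. Bd m b v)"
      then have good: "\<And>b v. b < B \<Longrightarrow> v \<in> nodes nV - {1} \<Longrightarrow> z \<notin> Bd m b v" by blast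
      obtain d where d: "d \<in> D" "dec d (restrict (R m z d) {1..N}) \<noteq> m" using z unfolding R_def by blast
      have zs: "z \<in> space (noise nV N)" using z by blast
      have "lb m z d B = lab B d m" using track[OF good zs order_refl] Dn[OF d(1)] by blast
      moreover have "dec_label n G d B (restrict (R m z d) {1..N}) = dec_label n G d B (R m z d)"
        using BN by (intro dec_label_cong) simp
      ultimately have lab: "dec_label n G d B (restrict (R m z d) {1..N}) = lab B d m"
        using Dn[OF d(1)] by (simp add: lb_def)
      have "dec d (restrict (R m z d) {1..N}) = m"
        unfolding dec_def net_dec_def lab
      proof (rule some_equality)
        show "m \<in> {1..M} \<and> lab B d m = lab B d m" using m by blast
        fix m' assume m': "m' \<in> {1..M} \<and> lab B d m' = lab B d m"
        show "m' = m"
        proof (rule ccontr)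
          assume "m' \<noteq> m"
          then have "m \<in> ?bad" using m m' d(1) by (metis (mono_tags, lifting) mem_Collect_eq)
          then show False using False by blast
        qed
      qed
      then show False using d(2) by blast
    qed
    have "measure (noise nV N) (?Er m) \<le> measure (noise nV N) (\<Union>b\<in>{..<B}. \<Union>v\<in>nodes nV - {1}. Bd m b v)"
      using finV Bd(1) by (intro N.finite_measure_mono[OF sub] sets.finite_UN) auto
    also have "\<dots> \<le> (\<Sum>b<B. measure (noise nV N) (\<Union>v\<in>nodes nV - {1}. Bd m b v))"
      using finV Bd(1) by (intro measure_UNION_le sets.finite_UN) auto
    also have "\<dots> \<le> (\<Sum>b<B. \<Sum>v\<in>nodes nV - {1}. measure (noise nV N) (Bd m b v))"
      using finV Bd(1) by (intro sum_mono measure_UNION_le) auto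
    also have "\<dots> = (\<Sum>b<B. \<Sum>v\<in>nodes nV - {1}. e v (sent E (fs b) (lab b) v m))"
      by (intro sum.cong refl Bd(2)) auto
    finally show ?thesis using False by simp
  qed
  have "error_prob nV E D N M src enc dec * M = (\<Sum>m=1..M. measure (noise nV N) (?Er m))"
    using M by (simp add: error_prob_def)
  also have "\<dots> \<le> (\<Sum>m=1..M. of_bool (m \<in> ?bad) + (\<Sum>b<B. \<Sum>v\<in>nodes nV - {1}. e v (sent E (fs b) (lab b) v m)))"
    by (intro sum_mono err)
  also have "\<dots> = (\<Sum>m=1..M. of_bool (m \<in> ?bad)) + (\<Sum>b<B. \<Sum>m=1..M. \<Sum>v\<in>nodes nV - {1}. e v (sent E (fs b) (lab b) v m))"
    unfolding sum.distrib by (rule arg_cong2[where f = "(+)", OF refl sum.swap])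
  also have "(\<Sum>m=1..M. of_bool (m \<in> ?bad)) = real (card ?bad)"
  proof -
    have "{1..M} \<inter> ?bad = ?bad" by blast
    then show ?thesis by (subst sum_of_bool_eq) (simp_all only: finite_atLeastAtMost Collect_mem_eq)
  qed
  finally show ?thesis using valid by blast
qed

section \<open>Rates below the lower bound\<close>

lemma achievable_negative_rate:
  assumes P: "\<forall>e\<in>E. P e \<ge> 0" and R: "R < 0"
  shows "achievable nV E D P R"
  unfolding achievable_def
proof (rule allI, rule impI, rule exI[of _ 0], rule allI, rule impI)
  fix \<epsilon> :: real and N :: nat assume \<epsilon>: "\<epsilon> > 0"
  let ?src = "\<lambda>_ _ _. 0 :: real" and ?enc = "\<lambda>_ _ _ _. 0 :: real" and ?dec = "\<lambda>_ _. 1 :: nat"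
  have c: "chan_input E ?src ?enc m z u w t = 0" for m z u w t by (simp add: chan_input_def chan_in_def)
  have "valid_code nV E D P N 1 ?src ?enc ?dec"
    using P by (auto simp: valid_code_def c)
  moreover have "error_prob nV E D N 1 ?src ?enc ?dec = 0" by (simp add: error_prob_def)
  moreover have "2 powr (real N * R) \<le> real 1"
    using powr_mono[of "real N * R" 0 2] R by (simp add: mult_nonneg_nonpos)
  ultimately show "\<exists>M src enc dec. valid_code nV E D P N M src enc dec \<and> real M \<ge> 2 powr (real N * R)
      \<and> error_prob nV E D N M src enc dec \<le> \<epsilon>"
    using \<epsilon> by - (rule exI[of _ 1], rule exI[of _ ?src], rule exI[of _ ?enc], rule exI[of _ ?dec], simp)
qed

text \<open>The term \<open>lb_term\<close> with its maximum replaced by the power of one chosen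
  edge: the rate of that edge in the computation code at \<open>v\<close>.\<close>

definition edge_rate where
  "edge_rate E P u v = (if P (u, v) = 0 then 0 else max 0 (1/2 * log 2 ((1 / (\<Sum>u\<in>inn E v. P (u, v)) + 1) * P (u, v))))"

text \<open>The collision argument needs one edge across the cut for each receiver of the front;
  choosing the strongest one yields the maximum in the bound.\<close>

lemma lb_term_attained:
  assumes "finite (inn E v)" "inn E v \<inter> S \<noteq> {}"
  shows "\<exists>u\<in>inn E v \<inter> S. lb_term E P S v = edge_rate E P u v"
proof -
  have "Max ((\<lambda>u. P (u, v)) ` (inn E v \<inter> S)) \<in> (\<lambda>u. P (u, v)) ` (inn E v \<inter> S)"
    using assms by (intro Max_in) auto
  then obtain u where u: "u \<in> inn E v \<inter> S" "Max ((\<lambda>u. P (u, v)) ` (inn E v \<inter> S)) = P (u, v)" by blast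
  then show ?thesis by (intro bexI[of _ u]) (simp_all add: lb_term_def edge_rate_def)
qed

lemma computation_codeD:
  assumes "computation_code U n P r \<eta> A comb G"
  shows "u \<in> U \<Longrightarrow> finite (A u)" "u \<in> U \<Longrightarrow> A u \<noteq> {}" "u \<in> U \<Longrightarrow> 2 powr (n * r u) \<le> card (A u)"
    "u \<in> U \<Longrightarrow> a \<in> A u \<Longrightarrow> (\<Sum>i<n. (a i)\<^sup>2) \<le> n * P u"
    "x \<in> PiE U A \<Longrightarrow> y \<in> PiE U A \<Longrightarrow> u \<in> U \<Longrightarrow> \<forall>w\<in>U - {u}. x w = y w \<Longrightarrow> comb x = comb y \<Longrightarrow> x u = y u"
    "G \<in> measurable (PiM {..<n} (\<lambda>_. borel)) (count_space UNIV)"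
    "(\<Sum>x\<in>PiE U A. measure (gauss_vec n)
        {z \<in> space (gauss_vec n). G (\<lambda>i\<in>{..<n}. (\<Sum>u\<in>U. x u i) + z i) \<noteq> comb x}) \<le> \<eta> * real (card (PiE U A))"
proof -
  note c = assms[unfolded computation_code_def]
  note c1 = conjunct1[OF c] and c2 = conjunct1[OF conjunct2[OF c]] and c3 = conjunct2[OF conjunct2[OF c]]
  show "G \<in> measurable (PiM {..<n} (\<lambda>_. borel)) (count_space UNIV)" by (rule conjunct1[OF c3])
  show "(\<Sum>x\<in>PiE U A. measure (gauss_vec n)
        {z \<in> space (gauss_vec n). G (\<lambda>i\<in>{..<n}. (\<Sum>u\<in>U. x u i) + z i) \<noteq> comb x}) \<le> \<eta> * real (card (PiE U A))"
    by (rule conjunct2[OF c3])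
  show "x u = y u" if "x \<in> PiE U A" "y \<in> PiE U A" "u \<in> U" "\<forall>w\<in>U - {u}. x w = y w" "comb x = comb y"
    using c2 that by blast
  show "finite (A u)" "A u \<noteq> {}" "2 powr (n * r u) \<le> card (A u)" if "u \<in> U"
    using bspec[OF c1 that] by blast+
  show "(\<Sum>i<n. (a i)\<^sup>2) \<le> n * P u" if "u \<in> U" "a \<in> A u"
    using bspec[OF c1 that(1)] that(2) by (elim conjE bspec)
qed

text \<open>With \<open>p = 2 powr (- (n * \<kappa>))\<close> the number of confused messages is at
  most M times \<open>4 ^ B * M * (p ^ B / p ^ nV)\<close>. As M is about 2^(N R) with N at most (n
  + 1) B, the exponent is at most B R + n (R B - \<kappa> B + \<kappa> nV). A fixed large
  \<open>B\<close> makes the bracket at most -1, and the block length \<open>n = N div B\<close>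
  then grows with \<open>N\<close>.\<close>

lemma achievable_below_lower_bound:
  assumes net: "gaussian_network nV E D" and P: "\<forall>e\<in>E. P e \<ge> 0" and R: "0 \<le> R" "R < lower_bound nV E D P"
  shows "achievable nV E D P R"
  unfolding achievable_def
proof (intro allI impI)
  fix \<epsilon> :: real assume \<epsilon>: "\<epsilon> > 0"
  define V where "V = nodes nV"
  define lo where "lo = lower_bound nV E D P"
  define \<kappa> where "\<kappa> = (R + lo) / 2"
  \<comment> \<open>A front has at most \<open>nV\<close> receivers, so lowering every edge rate by
    \<open>\<delta>\<close> keeps all cut values at least \<open>\<kappa>\<close>. Positive rates
    become strictly smaller than the limit in \<open>computation_code_exists\<close>.\<close>
  define \<delta> where "\<delta> = (lo - \<kappa>) / (nV + 1)"
  define r where "r = (\<lambda>u v. max 0 (edge_rate E P u v - \<delta>))"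
  have \<kappa>: "R < \<kappa>" "\<kappa> < lo" "\<kappa> > 0" using R by (auto simp: \<kappa>_def lo_def)
  have \<delta>: "\<delta> > 0" using \<kappa> by (simp add: \<delta>_def)
  have "nV * \<delta> \<le> lo - \<kappa>"
  proof -
    have "nV * \<delta> \<le> (nV + 1) * \<delta>" using \<delta> by (intro mult_right_mono) auto
    also have "\<dots> = lo - \<kappa>" by (simp add: \<delta>_def)
    finally show ?thesis .
  qed
  then have nV\<delta>: "\<kappa> \<le> lo - nV * \<delta>" by simp
  have finV: "finite V" "card V = nV" by (auto simp: V_def nodes_def)
  have DV: "D \<subseteq> V" "E \<subseteq> V \<times> V" and D1: "D \<noteq> {}" "D \<subseteq> V - {1}" using net by (auto simp: gaussian_network_def V_def)
  have one: "1 \<in> V" and nV1: "nV \<ge> 1" using D1 by (auto simp: V_def nodes_def)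
  have no1: "inn E 1 = {}" using net by (auto simp: gaussian_network_def inn_def)
  have cutsum: "\<exists>us. (\<forall>v\<in>cut_front nV E S. us v \<in> inn E v \<inter> S) \<and> \<kappa> \<le> (\<Sum>v\<in>cut_front nV E S. r (us v) v)"
    if S: "S \<in> cuts nV D" for S
  proof -
    have "\<forall>v\<in>cut_front nV E S. \<exists>u. u \<in> inn E v \<inter> S \<and> lb_term E P S v = edge_rate E P u v"
    proof
      fix v assume "v \<in> cut_front nV E S"
      then have "inn E v \<inter> S \<noteq> {}" by (auto simp: cut_front_def inn_def)
      from lb_term_attained[OF finite_inn[OF net] this, of P]
      show "\<exists>u. u \<in> inn E v \<inter> S \<and> lb_term E P S v = edge_rate E P u v" by blast
    qed
    from bchoice[OF this] obtain us where us: "\<And>v. v \<in> cut_front nV E S \<Longrightarrow> us v \<in> inn E v \<inter> S \<and> lb_term E P S v = edge_rate E P (us v) v"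
      by blast
    have "card (cut_front nV E S) \<le> nV"
      using card_mono[of V "cut_front nV E S"] finV by (auto simp: cut_front_def V_def)
    then have "real (card (cut_front nV E S)) * \<delta> \<le> nV * \<delta>" using \<delta> by (intro mult_right_mono) auto
    moreover have "lo \<le> (\<Sum>v\<in>cut_front nV E S. lb_term E P S v)"
      unfolding lo_def lower_bound_def using S finite_cuts by (intro Min_le) auto
    ultimately have "\<kappa> \<le> (\<Sum>v\<in>cut_front nV E S. lb_term E P S v) - real (card (cut_front nV E S)) * \<delta>" using nV\<delta> by linarith
    also have "\<dots> = (\<Sum>v\<in>cut_front nV E S. lb_term E P S v - \<delta>)" by (simp add: sum_subtractf)
    also have "\<dots> \<le> (\<Sum>v\<in>cut_front nV E S. r (us v) v)" by (intro sum_mono) (simp add: us r_def)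
    finally show ?thesis using us by blast
  qed
  \<comment> \<open>Chosen for \<open>\<kappa> * nV + 1 \<le> (\<kappa> - R) * B\<close>: the rate
    margin over \<open>B\<close> blocks pays for the lost factor \<open>p ^ nV\<close> and still
    leaves a gain of 2^(-n).\<close>
  define B where "B = nat \<lceil>(\<kappa> * nV + 1) / (\<kappa> - R)\<rceil> + 1"
  have B1: "B \<ge> 1" by (simp add: B_def)
  have "(\<kappa> * nV + 1) / (\<kappa> - R) \<le> B" unfolding B_def by linarith
  then have Bgap: "\<kappa> * nV + 1 \<le> (\<kappa> - R) * B" using \<kappa> by (simp add: field_simps)
  \<comment> \<open>Each of the \<open>B\<close> blocks costs at most
    \<open>2 * M * nV * \<eta>\<close>, which adds up to \<open>M * \<epsilon> / 2\<close>.\<close>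
  define \<eta> where "\<eta> = \<epsilon> / (4 * B * nV)"
  have \<eta>: "\<eta> > 0" using \<epsilon> B1 nV1 by (simp add: \<eta>_def)
  \<comment> \<open>Collects the factors independent of n: \<open>4 ^ B\<close> from the potential,
    2 from rounding the number of messages up, and \<open>2 powr (B * R)\<close> for the leftover
    channel uses after the full blocks.\<close>
  define C where "C = 4 ^ B * 2 * 2 powr (B * R)"
  have ev1: "eventually (\<lambda>n. \<forall>v\<in>V - {1}. \<exists>A comb G. computation_code (inn E v) n (\<lambda>u. P (u, v)) (\<lambda>u. r u v) \<eta> A comb G) sequentially"
  proof (rule eventually_ball_finite, goal_cases)
    case 1 show ?case using finV by simp
  next
    case 2
    show ?case
    proof
      fix v assume "v \<in> V - {1}"
      have "\<exists>n0. \<forall>n\<ge>n0. \<exists>A comb G. computation_code (inn E v) n (\<lambda>u. P (u, v)) (\<lambda>u. r u v) \<eta> A comb G"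
      proof (rule computation_code_exists)
        show "finite (inn E v)" by (rule finite_inn[OF net])
        show "P (u, v) \<ge> 0" if "u \<in> inn E v" for u using P that by (auto simp: inn_def)
        show "r u v \<ge> 0" for u by (simp add: r_def)
        show "P (u, v) > 0 \<and> r u v < 1/2 * log 2 ((1 / (\<Sum>u\<in>inn E v. P (u, v)) + 1) * P (u, v))"
          if u: "u \<in> inn E v" and ru: "r u v > 0" for u
        proof -
          have er: "edge_rate E P u v > \<delta>" using ru by (simp add: r_def less_max_iff_disj)
          then have "P (u, v) \<noteq> 0" using \<delta> by (auto simp: edge_rate_def)
          moreover have "P (u, v) \<ge> 0" using P u by (auto simp: inn_def)
          moreover have "edge_rate E P u v = 1/2 * log 2 ((1 / (\<Sum>u\<in>inn E v. P (u, v)) + 1) * P (u, v))" (is "_ = ?L")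
          proof -
            have "edge_rate E P u v = max 0 ?L" unfolding edge_rate_def using \<open>P (u, v) \<noteq> 0\<close> by (simp only: if_False)
            then show ?thesis using er \<delta> by linarith
          qed
          moreover have "r u v < edge_rate E P u v" using er \<delta> by (simp add: r_def)
          ultimately show ?thesis by (simp only:) simp
        qed
        show "\<eta> > 0" by (rule \<eta>)
      qed
      then show "eventually (\<lambda>n. \<exists>A comb G. computation_code (inn E v) n (\<lambda>u. P (u, v)) (\<lambda>u. r u v) \<eta> A comb G) sequentially"
        by (simp only: eventually_sequentially)
    qed
  qed
  have ev2: "eventually (\<lambda>n. C * (1/2) ^ n < \<epsilon> / 2) sequentially"
  proof -
    have "(\<lambda>n. C * (1/2) ^ n) \<longlonglongrightarrow> C * 0" by (intro tendsto_intros LIMSEQ_power_zero) simp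
    then show ?thesis using \<epsilon> by (intro order_tendstoD(2)) auto
  qed
  obtain n0 where n0: "\<And>n. n \<ge> n0 \<Longrightarrow> n > 0 \<and> C * (1/2) ^ n < \<epsilon> / 2 \<and>
      (\<forall>v\<in>V - {1}. \<exists>A comb G. computation_code (inn E v) n (\<lambda>u. P (u, v)) (\<lambda>u. r u v) \<eta> A comb G)"
    using eventually_conj[OF eventually_gt_at_top[of 0] eventually_conj[OF ev2 ev1]] unfolding eventually_sequentially by blast
  show "\<exists>N0. \<forall>N\<ge>N0. \<exists>M src enc dec. valid_code nV E D P N M src enc dec \<and>
      real M \<ge> 2 powr (real N * R) \<and> error_prob nV E D N M src enc dec \<le> \<epsilon>"
  proof (rule exI[of _ "n0 * B"], rule allI, rule impI)
    fix N assume N: "N \<ge> n0 * B"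
    define n where "n = N div B"
    have "n0 * B div B \<le> n" unfolding n_def using N by (rule div_le_mono)
    then have nn0: "n \<ge> n0" using B1 by simp
    have BN: "B * n \<le> N" unfolding n_def by (rule times_div_less_eq_dividend)
    have NB: "N \<le> (n + 1) * B"
    proof -
      have "N = B * n + N mod B" unfolding n_def by simp
      also have "\<dots> \<le> B * n + B" using B1 by (intro add_left_mono less_imp_le mod_less_divisor) simp
      finally show ?thesis by (simp add: algebra_simps)
    qed
    note nprop = n0[OF nn0]
    have "\<forall>v\<in>V - {1}. \<exists>q. computation_code (inn E v) n (\<lambda>u. P (u, v)) (\<lambda>u. r u v) \<eta> (fst q) (fst (snd q)) (snd (snd q))"
    proof
      fix v assume "v \<in> V - {1}"
      then obtain A comb G where "computation_code (inn E v) n (\<lambda>u. P (u, v)) (\<lambda>u. r u v) \<eta> A comb G" using nprop by blast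
      then show "\<exists>q. computation_code (inn E v) n (\<lambda>u. P (u, v)) (\<lambda>u. r u v) \<eta> (fst q) (fst (snd q)) (snd (snd q))"
        by (intro exI[of _ "(A, comb, G)"]) (simp only: fst_conv snd_conv)
    qed
    from bchoice[OF this] obtain cd where
      cd: "\<And>v. v \<in> V - {1} \<Longrightarrow> computation_code (inn E v) n (\<lambda>u. P (u, v)) (\<lambda>u. r u v) \<eta> (fst (cd v)) (fst (snd (cd v))) (snd (snd (cd v)))" by (elim exE) (rule that, erule bspec)
    define A where "A = (\<lambda>a. fst (cd (snd a)) (fst a))"
    define comb where "comb = (\<lambda>v. fst (snd (cd v)))"
    define G where "G = (\<lambda>v. snd (snd (cd v)))"
    have A_eq: "(\<lambda>u. A (u, v)) = fst (cd v)" for v by (simp add: A_def)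
    have code: "computation_code (inn E v) n (\<lambda>u. P (u, v)) (\<lambda>u. r u v) \<eta> (\<lambda>u. A (u, v)) (comb v) (G v)" if "v \<in> V - {1}" for v
      unfolding A_eq comb_def G_def by (rule cd[OF that])
    have edge: "u \<in> inn E v" "v \<in> V - {1}" if "(u, v) \<in> E" for u v
    proof -
      show u: "u \<in> inn E v" using that unfolding inn_def by (rule CollectI)
      have "v \<in> V" using subsetD[OF DV(2) that] by (rule mem_Sigma_iff[THEN iffD1, THEN conjunct2])
      moreover have "v \<noteq> 1" using u no1 by (metis emptyE)
      ultimately show "v \<in> V - {1}" by blast
    qed
    have A1: "finite (A (u, v))" "A (u, v) \<noteq> {}" "2 powr (n * r u v) \<le> card (A (u, v))"
      and A2: "\<And>x. x \<in> A (u, v) \<Longrightarrow> (\<Sum>i<n. (x i)\<^sup>2) \<le> n * P (u, v)" if "(u, v) \<in> E" for u v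
      by (fact computation_codeD(1-4)[OF code[OF edge(2)[OF that]] edge(1)[OF that]])+
    define e where "e = (\<lambda>v x. measure (gauss_vec n) {z \<in> space (gauss_vec n). G v (\<lambda>i\<in>{..<n}. (\<Sum>u\<in>inn E v. x u i) + z i) \<noteq> comb v x})"
    define M where "M = nat \<lceil>2 powr (real N * R)\<rceil>"
    have cardM: "card {1..M} = M" by simp
    have pw1: "1 \<le> 2 powr (real N * R)" using R by (intro ge_one_powr_ge_zero) auto
    have Mge: "2 powr (real N * R) \<le> real M" unfolding M_def by linarith
    have M1: "M \<ge> 1" using Mge pw1 by linarith
    have Mle: "real M \<le> 2 * 2 powr (real N * R)" using pw1 unfolding M_def by linarith
    define p where "p = 2 powr (- (n * \<kappa>))"
    have p: "0 < p" "p \<le> 1" 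
    proof -
      show "0 < p" by (simp add: p_def)
      have "p \<le> 2 powr 0" unfolding p_def using \<kappa> by (intro powr_mono) auto
      then show "p \<le> 1" by simp
    qed
    have cutA: "\<exists>us. (\<forall>v\<in>{v\<in>V - S. inn E v \<inter> S \<noteq> {}}. us v \<in> inn E v \<inter> S) \<and>
         1 \<le> p * (\<Prod>v\<in>{v\<in>V - S. inn E v \<inter> S \<noteq> {}}. real (card (A (us v, v))))"
      if S: "S \<subseteq> V" "1 \<in> S" "\<not> D \<subseteq> S" for S
    proof -
      have Sc: "S \<in> cuts nV D" using S DV by (auto simp: cuts_def V_def)
      have fr: "{v\<in>V - S. inn E v \<inter> S \<noteq> {}} = cut_front nV E S" by (auto simp: cut_front_def V_def inn_def)
      obtain us where us: "\<And>v. v \<in> cut_front nV E S \<Longrightarrow> us v \<in> inn E v \<inter> S" and sum: "\<kappa> \<le> (\<Sum>v\<in>cut_front nV E S. r (us v) v)"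
        using cutsum[OF Sc] by blast
      have "1 = p * 2 powr (n * \<kappa>)" by (simp add: p_def powr_add[symmetric])
      also have "2 powr (n * \<kappa>) \<le> 2 powr (n * (\<Sum>v\<in>cut_front nV E S. r (us v) v))"
        using sum by (intro powr_mono mult_left_mono) auto
      also have "\<dots> = (\<Prod>v\<in>cut_front nV E S. 2 powr (n * r (us v) v))"
        by (simp add: sum_distrib_left powr_sum finite_cut_front)
      also have "\<dots> \<le> (\<Prod>v\<in>cut_front nV E S. real (card (A (us v, v))))"
      proof (rule prod_mono)
        fix v assume "v \<in> cut_front nV E S"
        then have "(us v, v) \<in> E" using us by (auto simp: inn_def)
        then show "0 \<le> 2 powr (n * r (us v) v) \<and> 2 powr (n * r (us v) v) \<le> real (card (A (us v, v)))"
          using A1(3) by (intro conjI powr_ge_zero)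
      qed
      finally have "1 \<le> p * (\<Prod>v\<in>cut_front nV E S. real (card (A (us v, v))))" using p by simp
      then show ?thesis unfolding fr using us by blast
    qed
    have "\<exists>fs. (\<forall>b a l. a \<in> E \<longrightarrow> fs b a l \<in> A a) \<and>
       (\<forall>b. potential V D p {1..M} (labels E comb fs b) \<le> (4 * p) ^ b * (real (card {1..M}))\<^sup>2) \<and>
       (\<forall>b. (\<Sum>m\<in>{1..M}. \<Sum>v\<in>V - {1}. e v (sent E (fs b) (labels E comb fs b) v m)) \<le> 2 * (card {1..M} * card V * \<eta>))"
    proof (rule network_code[where A = A and e = e and comb = comb and V = V and Ms = "{1..M}" and D = D])
      show "finite (A a)" "A a \<noteq> {}" if "a \<in> E" for a
        using A1(1,2)[of "fst a" "snd a"] that unfolding prod.collapse by blast+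
      show "x u = y u" if h: "v \<in> V" "x \<in> PiE (inn E v) (\<lambda>u. A (u, v))" "y \<in> PiE (inn E v) (\<lambda>u. A (u, v))"
         "u \<in> inn E v" "\<forall>w\<in>inn E v - {u}. x w = y w" "comb v x = comb v y" for v x y u
      proof -
        have "v \<in> V - {1}" using h(1,4) no1 by (cases "v = 1") auto
        from computation_codeD(5)[OF code[OF this] h(2-6)] show ?thesis .
      qed
      show "(\<Sum>x\<in>PiE (inn E v) (\<lambda>u. A (u, v)). e v x) \<le> \<eta> * card (PiE (inn E v) (\<lambda>u. A (u, v)))" if "v \<in> V - {1}" for v
        unfolding e_def by (rule computation_codeD(7)[OF code[OF that]])
      show "0 \<le> e v x" for v x by (simp add: e_def)
      show "{1..M} \<noteq> {}" using M1 by simp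
    qed (rule finV one DV p \<eta> finite_atLeastAtMost | (rule cutA; assumption))+
    then obtain fs where H: "(\<forall>b a l. a \<in> E \<longrightarrow> fs b a l \<in> A a) \<and>
       (\<forall>b. potential V D p {1..M} (labels E comb fs b) \<le> (4 * p) ^ b * (real M)\<^sup>2) \<and>
       (\<forall>b. (\<Sum>m\<in>{1..M}. \<Sum>v\<in>V - {1}. e v (sent E (fs b) (labels E comb fs b) v m)) \<le> 2 * (M * nV * \<eta>))"
      unfolding finV(2) cardM by (elim exE) (rule that)
    have fsA: "\<And>b a l. a \<in> E \<Longrightarrow> fs b a l \<in> A a"
      and pot: "\<And>b. potential V D p {1..M} (labels E comb fs b) \<le> (4 * p) ^ b * (real M)\<^sup>2"
      and er: "\<And>b. (\<Sum>m\<in>{1..M}. \<Sum>v\<in>V - {1}. e v (sent E (fs b) (labels E comb fs b) v m)) \<le> 2 * (M * nV * \<eta>)"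
      using conjunct1[OF H] conjunct1[OF conjunct2[OF H]] conjunct2[OF conjunct2[OF H]] by blast+
    let ?bad = "{m \<in> {1..M}. \<exists>m'\<in>{1..M}. m \<noteq> m' \<and> (\<exists>d\<in>D. labels E comb fs B d m = labels E comb fs B d m')}"
    have "\<exists>src enc dec. valid_code nV E D P N M src enc dec \<and>
      error_prob nV E D N M src enc dec * M \<le> real (card ?bad)
        + (\<Sum>b<B. \<Sum>m\<in>{1..M}. \<Sum>v\<in>nodes nV - {1}. e v (sent E (fs b) (labels E comb fs b) v m))"
      unfolding e_def
    proof (rule block_code[OF net _ BN M1])
      show "n > 0" using nprop by blast
      show "G v \<in> measurable (PiM {..<n} (\<lambda>_. borel)) (count_space UNIV)" if "v \<in> nodes nV - {1}" for v
        using that unfolding V_def[symmetric] by (intro computation_codeD(6)[OF code])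
      show "P a \<ge> 0" if "a \<in> E" for a using P that by blast
      show "(\<Sum>j<n. (fs b (u, v) l j)\<^sup>2) \<le> n * P (u, v)" if "(u, v) \<in> E" for b u v l
        by (rule A2[OF that fsA[OF that]])
    qed
    then obtain src enc dec where val: "valid_code nV E D P N M src enc dec"
      and err: "error_prob nV E D N M src enc dec * M \<le> real (card ?bad)
        + (\<Sum>b<B. \<Sum>m\<in>{1..M}. \<Sum>v\<in>V - {1}. e v (sent E (fs b) (labels E comb fs b) v m))" unfolding V_def by blast
    have "real (card ?bad) * p ^ nV \<le> potential V D p {1..M} (labels E comb fs B)"
      using bad_messages_le[OF finV(1) finite_atLeastAtMost p DV(1), of 1 M "labels E comb fs B"] unfolding finV(2) .
    also note pot
    finally have "real (card ?bad) \<le> (4 * p) ^ B * (real M)\<^sup>2 / p ^ nV" using p by (simp add: pos_le_divide_eq)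
    also have "\<dots> = real M * (4 ^ B * (real M * (p ^ B / p ^ nV)))" by (simp add: power_mult_distrib power2_eq_square)
    also have "\<dots> \<le> real M * (\<epsilon> / 2)"
    proof (rule mult_left_mono)
      have "p ^ B / p ^ nV = 2 powr (- (n * \<kappa>) * B) / 2 powr (- (n * \<kappa>) * nV)"
        by (simp add: p_def powr_power mult.commute)
      also have "\<dots> = 2 powr (- (n * \<kappa>) * B - (- (n * \<kappa>) * nV))" by (rule powr_diff[symmetric])
      finally have pp: "p ^ B / p ^ nV = 2 powr (- (n * \<kappa>) * B - (- (n * \<kappa>) * nV))" .
      have "real N * R \<le> real ((n + 1) * B) * R" using NB R by (intro mult_right_mono of_nat_mono)
      then have "2 powr (real N * R) \<le> 2 powr (real ((n + 1) * B) * R)" by (intro powr_mono) auto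
      then have "real M \<le> 2 * 2 powr (real ((n + 1) * B) * R)" using Mle by linarith
      then have "real M * (p ^ B / p ^ nV) \<le> 2 * 2 powr (real ((n + 1) * B) * R) * (p ^ B / p ^ nV)"
        using p by (intro mult_right_mono) auto
      also have "\<dots> = 2 * (2 powr (real ((n + 1) * B) * R + (- (n * \<kappa>) * B - (- (n * \<kappa>) * nV))))"
        unfolding pp powr_add by simp
      also have "\<dots> \<le> 2 * 2 powr (B * R + - real n)"
      proof (intro mult_left_mono powr_mono)
        have "n * (\<kappa> * nV + 1) \<le> n * ((\<kappa> - R) * B)" by (intro mult_left_mono Bgap) auto
        then show "real ((n + 1) * B) * R + (- (n * \<kappa>) * B - (- (n * \<kappa>) * nV)) \<le> B * R + - real n"
          by (simp add: algebra_simps)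
      qed auto
      also have "\<dots> = 2 * 2 powr (B * R) * (1/2) ^ n"
        unfolding powr_add by (simp add: powr_minus powr_realpow power_one_over inverse_eq_divide)
      finally have "4 ^ B * (real M * (p ^ B / p ^ nV)) \<le> 4 ^ B * (2 * 2 powr (B * R) * (1/2) ^ n)"
        by (intro mult_left_mono) auto
      also have "\<dots> = C * (1/2) ^ n" by (simp add: C_def)
      also have "\<dots> \<le> \<epsilon> / 2" using nprop by (intro less_imp_le) blast
      finally show "4 ^ B * (real M * (p ^ B / p ^ nV)) \<le> \<epsilon> / 2" .
    qed simp
    finally have bad: "real (card ?bad) \<le> real M * (\<epsilon> / 2)" .
    have "(\<Sum>b<B. \<Sum>m\<in>{1..M}. \<Sum>v\<in>V - {1}. e v (sent E (fs b) (labels E comb fs b) v m)) \<le> (\<Sum>b<B. 2 * (M * nV * \<eta>))"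
      by (intro sum_mono er)
    also have "\<dots> = real M * (\<epsilon> / 2)" using B1 nV1 by (simp add: \<eta>_def field_simps)
    finally have "error_prob nV E D N M src enc dec * M \<le> real M * (\<epsilon> / 2) + real M * (\<epsilon> / 2)" using err bad by linarith
    then have "error_prob nV E D N M src enc dec * M \<le> \<epsilon> * M" by (simp add: field_simps)
    then have "error_prob nV E D N M src enc dec \<le> \<epsilon>" using M1 by (subst (asm) mult_le_cancel_right_pos) auto
    then show "\<exists>M src enc dec. valid_code nV E D P N M src enc dec \<and>
      real M \<ge> 2 powr (real N * R) \<and> error_prob nV E D N M src enc dec \<le> \<epsilon>" using val Mge by blast
  qed
qed

section \<open>The cut-set bound\<close>

declare measurable_gauss_vec_coord [measurable del]

text \<open>The denominator cancels the standard normal density, which leaves a Lebesgue integral;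
  that is translation invariant.\<close>

lemma nn_integral_gauss_shift:
  fixes c s :: real and H :: "real \<Rightarrow> ennreal"
  assumes [measurable]: "H \<in> borel_measurable borel"
  shows "(\<integral>\<^sup>+ y. H (y + c) * ennreal (normal_density 0 s (y + c) / std_normal_density y) \<partial>gauss)
       = (\<integral>\<^sup>+ y. H y \<partial>density lborel (\<lambda>x. ennreal (normal_density 0 s x)))"
proof -
  have pos: "std_normal_density y > 0" for y by (rule normal_density_pos) simp
  have "(\<integral>\<^sup>+ y. H (y + c) * ennreal (normal_density 0 s (y + c) / std_normal_density y) \<partial>gauss)
      = (\<integral>\<^sup>+ y. ennreal (std_normal_density y) * (H (y + c) * ennreal (normal_density 0 s (y + c) / std_normal_density y)) \<partial>lborel)"
    by (rule nn_integral_density) measurable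
  also have "\<dots> = (\<integral>\<^sup>+ y. ennreal (normal_density 0 s (c + 1 * y)) * H (c + 1 * y) \<partial>lborel)"
  proof (rule nn_integral_cong)
    fix y
    have "ennreal (std_normal_density y) * ennreal (normal_density 0 s (y + c) / std_normal_density y)
        = ennreal (normal_density 0 s (y + c))"
      using pos[of y] by (simp add: ennreal_mult[symmetric] normal_density_nonneg)
    then show "ennreal (std_normal_density y) * (H (y + c) * ennreal (normal_density 0 s (y + c) / std_normal_density y))
        = ennreal (normal_density 0 s (c + 1 * y)) * H (c + 1 * y)"
      by (metis (no_types, lifting) add.commute mult.assoc mult.commute mult_1)
  qed
  also have "\<dots> = (\<integral>\<^sup>+ y. ennreal (normal_density 0 s y) * H y \<partial>lborel)"
    using nn_integral_real_affine[of "\<lambda>y. ennreal (normal_density 0 s y) * H y" 1 c] by simp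
  also have "\<dots> = (\<integral>\<^sup>+ y. H y \<partial>density lborel (\<lambda>x. ennreal (normal_density 0 s x)))"
    by (rule nn_integral_density[symmetric]) measurable
  finally show ?thesis .
qed

text \<open>The map \<open>z \<mapsto> z + a z\<close> is triangular with unit Jacobian, so the density ratio turns the law of the
  shifted noise into a product law.\<close>
lemma triangular_shift:
  fixes a :: "'i \<Rightarrow> ('i \<Rightarrow> real) \<Rightarrow> real" and rank :: "'i \<Rightarrow> nat" and \<sigma> :: "'i \<Rightarrow> real"
  defines "Q \<equiv> \<lambda>i. density lborel (\<lambda>x. ennreal (normal_density 0 (\<sigma> i) x))"
  assumes I: "finite I" and rank: "inj_on rank I" and \<sigma>: "\<And>i. \<sigma> i > 0"
    and am: "\<And>i. i \<in> I \<Longrightarrow> a i \<in> borel_measurable (PiM I (\<lambda>_. borel))"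
    and ad: "\<And>i z z'. i \<in> I \<Longrightarrow> (\<And>j. j \<in> I \<Longrightarrow> rank j < rank i \<Longrightarrow> z j = z' j) \<Longrightarrow> a i z = a i z'"
    and F: "F \<in> borel_measurable (PiM I (\<lambda>_. borel))"
  shows "(\<integral>\<^sup>+ z. F (\<lambda>i\<in>I. z i + a i z) * (\<Prod>i\<in>I. ennreal (normal_density 0 (\<sigma> i) (z i + a i z) / std_normal_density (z i))) \<partial>PiM I (\<lambda>_. gauss))
     = (\<integral>\<^sup>+ y. F y \<partial>PiM I Q)"
proof -
  interpret G: product_sigma_finite "\<lambda>_. gauss"
    by (rule product_sigma_finite.intro) (intro prob_space_imp_sigma_finite prob_space_gauss)
  have Qp: "prob_space (Q i)" for i unfolding Q_def by (rule prob_space_normal_density[OF \<sigma>])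
  interpret Q: product_sigma_finite Q
    by (rule product_sigma_finite.intro) (intro prob_space_imp_sigma_finite Qp)
  have setsQ: "sets (Q i) = sets borel" for i by (simp add: Q_def)
  have sG: "sets (PiM J (\<lambda>_. gauss)) = sets (PiM J (\<lambda>_. borel))" for J by (intro sets_PiM_cong) auto
  have sQ: "sets (PiM J Q) = sets (PiM J (\<lambda>_. borel))" for J by (intro sets_PiM_cong) (auto simp: setsQ)
  have mG: "measurable (PiM J (\<lambda>_. gauss)) N = measurable (PiM J (\<lambda>_. borel)) N" for J N
    by (rule measurable_cong_sets[OF sG refl])
  have mQ: "measurable (PiM J Q) N = measurable (PiM J (\<lambda>_. borel)) N" for J N
    by (rule measurable_cong_sets[OF sQ refl])
  \<comment> \<open>The coordinates are integrated out in decreasing rank. \<open>J k\<close> holds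
    those of rank below \<open>k\<close>, and the induction adds the coordinate of rank
    \<open>k\<close>, if there is one.\<close>
  define J where "J = (\<lambda>k. {i \<in> I. rank i < k})"
  define \<rho> where "\<rho> = (\<lambda>i z. ennreal (normal_density 0 (\<sigma> i) (z i + a i z) / std_normal_density (z i)))"
  have finJ: "finite (J k)" for k using I by (simp add: J_def)
  have aJ: "a i \<in> borel_measurable (PiM (J k) (\<lambda>_. borel))" if i: "i \<in> I" "rank i \<le> k" for i k
  proof -
    \<comment> \<open>Filling the missing coordinates with 0 does not change \<open>a i\<close>,
      which only looks at coordinates of smaller rank. This gives measurability on the smaller
      product.\<close>
    let ?e = "\<lambda>z. \<lambda>j\<in>I. if j \<in> J k then z j else (0::real)"
    have "?e \<in> measurable (PiM (J k) (\<lambda>_. borel)) (PiM I (\<lambda>_. borel))"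
    proof (rule measurable_restrict)
      fix j
      show "(\<lambda>z. if j \<in> J k then z j else (0::real)) \<in> borel_measurable (PiM (J k) (\<lambda>_. borel))"
        by (cases "j \<in> J k") simp_all
    qed
    from measurable_compose[OF this am[OF i(1)]] have "(\<lambda>z. a i (?e z)) \<in> borel_measurable (PiM (J k) (\<lambda>_. borel))" .
    moreover have "a i (?e z) = a i z" for z
    proof (rule ad[OF i(1)])
      fix j assume "j \<in> I" "rank j < rank i"
      then show "?e z j = z j" using i(2) by (simp add: J_def)
    qed
    ultimately show ?thesis by (simp only: )
  qed
  have step: "(\<integral>\<^sup>+ z. F (\<lambda>i\<in>J k. z i + a i z) * (\<Prod>i\<in>J k. \<rho> i z) \<partial>PiM (J k) (\<lambda>_. gauss)) = (\<integral>\<^sup>+ y. F y \<partial>PiM (J k) Q)"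
    if "F \<in> borel_measurable (PiM (J k) (\<lambda>_. borel))" for F k
    using that
  proof (induction k arbitrary: F)
    case 0
    have J0: "J 0 = {}" by (simp add: J_def)
    show ?case unfolding J0 by (simp add: PiM_empty nn_integral_count_space_finite restrict_def)
  next
    case (Suc k)
    show ?case
    proof (cases "\<exists>i\<in>I. rank i = k")
      case False
      then have "J (Suc k) = J k" by (auto simp: J_def less_Suc_eq)
      then show ?thesis using Suc.IH[of F] Suc.prems by (simp only: )
    next
      case True
      then obtain i where i: "i \<in> I" "rank i = k" by blast
      have Jins: "J (Suc k) = insert i (J k)"
        using i rank by (auto simp: J_def less_Suc_eq dest: inj_onD)
      have ni: "i \<notin> J k" using i by (simp add: J_def)
      have Fm: "F \<in> borel_measurable (PiM (insert i (J k)) (\<lambda>_. borel))" using Suc.prems unfolding Jins .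
      let ?T = "\<lambda>x. \<lambda>j\<in>J k. x j + a j x"
      have aupd: "a j (x(i := y)) = a j x" if "j \<in> insert i (J k)" for j x y
      proof (rule ad)
        show "j \<in> I" using that i by (auto simp: J_def)
        fix l assume "l \<in> I" "rank l < rank j"
        then have "l \<noteq> i" using that i by (auto simp: J_def)
        then show "(x(i := y)) l = x l" by simp
      qed
      have Tupd: "(\<lambda>j\<in>insert i (J k). (x(i := y)) j + a j (x(i := y))) = (?T x)(i := y + a i x)" for x y
      proof
        fix j
        consider "j = i" | "j \<in> J k" "j \<noteq> i" | "j \<notin> insert i (J k)" by blast
        then show "(\<lambda>j\<in>insert i (J k). (x(i := y)) j + a j (x(i := y))) j = ((?T x)(i := y + a i x)) j"
          by cases (simp_all add: aupd)
      qed
      have rupd: "\<rho> j (x(i := y)) = \<rho> j x" if "j \<in> J k" for j x y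
        using that ni aupd[of j x y] by (cases "j = i") (simp_all add: \<rho>_def)
      have rupdi: "\<rho> i (x(i := y)) = ennreal (normal_density 0 (\<sigma> i) (y + a i x) / std_normal_density y)" for x y
        using aupd[of i x y] by (simp add: \<rho>_def)
      \<comment> \<open>Given the coordinates of smaller rank, \<open>a i\<close> is a constant
        shift of coordinate \<open>i\<close>, so the inner integral is
        \<open>nn_integral_gauss_shift\<close>; its value is \<open>F'\<close> at the already
        shifted remaining coordinates.\<close>
      define F' where "F' = (\<lambda>x. \<integral>\<^sup>+ y. F (x(i := y)) \<partial>Q i)"
      have F'm: "F' \<in> borel_measurable (PiM (J k) (\<lambda>_. borel))"
      proof -
        have "(\<lambda>(x, y). x(i := y)) \<in> measurable (PiM (J k) (\<lambda>_. borel) \<Otimes>\<^sub>M borel) (PiM (insert i (J k)) (\<lambda>_. borel :: real measure))"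
          by (rule measurable_add_dim)
        then have "(\<lambda>p. F ((\<lambda>(x, y). x(i := y)) p)) \<in> borel_measurable (PiM (J k) (\<lambda>_. borel) \<Otimes>\<^sub>M borel)"
          by (rule measurable_compose[OF _ Fm])
        then have "(\<lambda>(x, y). F (x(i := y))) \<in> borel_measurable (PiM (J k) (\<lambda>_. borel) \<Otimes>\<^sub>M Q i)"
          by (simp add: case_prod_unfold measurable_cong_sets[OF sets_pair_measure_cong[OF refl setsQ] refl])
        then show ?thesis unfolding F'_def by (rule sigma_finite_measure.borel_measurable_nn_integral[OF prob_space_imp_sigma_finite[OF Qp]])
      qed
      have am': "a j \<in> borel_measurable (PiM (J (Suc k)) (\<lambda>_. borel))" if "j \<in> J (Suc k)" for j
        using that by (intro aJ) (auto simp: J_def)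
      have Tm: "(\<lambda>z. \<lambda>j\<in>J (Suc k). z j + a j z) \<in> measurable (PiM (J (Suc k)) (\<lambda>_. borel)) (PiM (J (Suc k)) (\<lambda>_. borel))"
        by (intro measurable_restrict borel_measurable_add measurable_component_singleton am')
      have rm: "\<rho> j \<in> borel_measurable (PiM (J (Suc k)) (\<lambda>_. borel))" if "j \<in> J (Suc k)" for j
      proof -
        have [measurable]: "(\<lambda>z. z j) \<in> borel_measurable (PiM (J (Suc k)) (\<lambda>_. borel :: real measure))"
          using that by (rule measurable_component_singleton)
        note am'[OF that, measurable]
        show ?thesis unfolding \<rho>_def by measurable
      qed
      have whole: "(\<lambda>z. F (\<lambda>j\<in>insert i (J k). z j + a j z) * (\<Prod>j\<in>insert i (J k). \<rho> j z)) \<in> borel_measurable (PiM (insert i (J k)) (\<lambda>_. gauss))"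
        unfolding mG Jins[symmetric]
        by (intro borel_measurable_times_ennreal borel_measurable_prod_ennreal rm measurable_compose[OF Tm Suc.prems])
      have inner: "(\<integral>\<^sup>+ y. F (\<lambda>j\<in>insert i (J k). (x(i := y)) j + a j (x(i := y))) * (\<Prod>j\<in>insert i (J k). \<rho> j (x(i := y))) \<partial>gauss)
          = F' (?T x) * (\<Prod>j\<in>J k. \<rho> j x)" if x: "x \<in> space (PiM (J k) (\<lambda>_. gauss))" for x
      proof -
        have Tx: "?T x \<in> space (PiM (J k) (\<lambda>_. borel :: real measure))" by (simp add: space_PiM)
        have Hm: "(\<lambda>y. F ((?T x)(i := y))) \<in> borel_measurable borel"
          using measurable_compose[OF measurable_component_update[OF Tx ni] Fm] .
        have "(\<Prod>j\<in>insert i (J k). \<rho> j (x(i := y))) = ennreal (normal_density 0 (\<sigma> i) (y + a i x) / std_normal_density y) * (\<Prod>j\<in>J k. \<rho> j x)" for y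
        proof -
          have "(\<Prod>j\<in>J k. \<rho> j (x(i := y))) = (\<Prod>j\<in>J k. \<rho> j x)" by (intro prod.cong refl rupd)
          then show ?thesis unfolding prod.insert[OF finJ ni] rupdi by (simp only: )
        qed
        then have "(\<integral>\<^sup>+ y. F (\<lambda>j\<in>insert i (J k). (x(i := y)) j + a j (x(i := y))) * (\<Prod>j\<in>insert i (J k). \<rho> j (x(i := y))) \<partial>gauss)
          = (\<integral>\<^sup>+ y. (F ((?T x)(i := y + a i x)) * ennreal (normal_density 0 (\<sigma> i) (y + a i x) / std_normal_density y)) * (\<Prod>j\<in>J k. \<rho> j x) \<partial>gauss)"
          unfolding Tupd by (simp only: mult.assoc)
        also have "\<dots> = (\<integral>\<^sup>+ y. F ((?T x)(i := y + a i x)) * ennreal (normal_density 0 (\<sigma> i) (y + a i x) / std_normal_density y) \<partial>gauss) * (\<Prod>j\<in>J k. \<rho> j x)"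
          using measurable_compose[OF _ Hm, of "\<lambda>y. y + a i x" gauss] by (intro nn_integral_multc borel_measurable_times_ennreal) auto
        also have "(\<integral>\<^sup>+ y. F ((?T x)(i := y + a i x)) * ennreal (normal_density 0 (\<sigma> i) (y + a i x) / std_normal_density y) \<partial>gauss)
           = F' (?T x)" unfolding F'_def Q_def by (rule nn_integral_gauss_shift[OF Hm])
        finally show ?thesis .
      qed
      have "(\<integral>\<^sup>+ z. F (\<lambda>j\<in>J (Suc k). z j + a j z) * (\<Prod>j\<in>J (Suc k). \<rho> j z) \<partial>PiM (J (Suc k)) (\<lambda>_. gauss))
          = (\<integral>\<^sup>+ x. F' (?T x) * (\<Prod>j\<in>J k. \<rho> j x) \<partial>PiM (J k) (\<lambda>_. gauss))"
        unfolding Jins G.product_nn_integral_insert[OF finJ ni whole] by (intro nn_integral_cong inner)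
      also have "\<dots> = (\<integral>\<^sup>+ x. F' x \<partial>PiM (J k) Q)" by (rule Suc.IH[OF F'm])
      also have "\<dots> = (\<integral>\<^sup>+ y. F y \<partial>PiM (J (Suc k)) Q)"
        unfolding F'_def Jins using Fm by (intro Q.product_nn_integral_insert[symmetric] finJ ni) (simp only: mQ)
      finally show ?thesis .
    qed
  qed
  have JI: "J (Suc (Max (insert 0 (rank ` I)))) = I"
  proof -
    have "rank i \<le> Max (insert 0 (rank ` I))" if "i \<in> I" for i using that I by (intro Max_ge) auto
    then show ?thesis by (auto simp: J_def less_Suc_eq_le)
  qed
  show ?thesis using step[of F "Suc (Max (insert 0 (rank ` I)))"] F unfolding JI \<rho>_def by (simp only: )
qed

lemma gauss_PiM_coord:
  fixes f :: "real \<Rightarrow> real"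
  assumes i: "i \<in> I" and f: "integrable gauss f"
  shows "integrable (PiM I (\<lambda>_. gauss)) (\<lambda>z. f (z i))" "(\<integral>z. f (z i) \<partial>PiM I (\<lambda>_. gauss)) = (\<integral>x. f x \<partial>gauss)"
proof -
  have d: "distr (PiM I (\<lambda>_. gauss)) gauss (\<lambda>z. z i) = gauss"
    by (rule distr_PiM_component[OF prob_space_gauss i])
  have m: "(\<lambda>z. z i) \<in> measurable (PiM I (\<lambda>_. gauss)) gauss" by (rule measurable_component_singleton[OF i])
  have fm: "f \<in> borel_measurable gauss" by (rule borel_measurable_integrable[OF f])
  show "integrable (PiM I (\<lambda>_. gauss)) (\<lambda>z. f (z i))"
    using integrable_distr_eq[OF m fm] f unfolding d by blast
  show "(\<integral>z. f (z i) \<partial>PiM I (\<lambda>_. gauss)) = (\<integral>x. f x \<partial>gauss)"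
    using integral_distr[OF m fm] unfolding d by (rule sym)
qed

text \<open>Coordinate \<open>i\<close> is integrated first: \<open>b\<close> is constant in it and
  its mean is 0. In the application \<open>b\<close> is the signal crossing the cut at one time,
  bounded by the power constraint and fixed before the noise of that time.\<close>

lemma gauss_PiM_uncorrelated:
  fixes b :: "('i \<Rightarrow> real) \<Rightarrow> real"
  assumes I: "finite I" "i \<in> I" and bm: "b \<in> borel_measurable (PiM I (\<lambda>_. gauss))"
    and bK: "\<And>z. z \<in> space (PiM I (\<lambda>_. gauss)) \<Longrightarrow> \<bar>b z\<bar> \<le> K" and bi: "\<And>z y. b (z(i := y)) = b z"
  shows "integrable (PiM I (\<lambda>_. gauss)) (\<lambda>z. b z * z i)" "(\<integral>z. b z * z i \<partial>PiM I (\<lambda>_. gauss)) = 0"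
proof -
  interpret G: product_sigma_finite "\<lambda>_. gauss"
    by (rule product_sigma_finite.intro) (intro prob_space_imp_sigma_finite prob_space_gauss)
  have zm: "(\<lambda>z. z i) \<in> borel_measurable (PiM I (\<lambda>_. gauss))"
    by (rule borel_measurable_integrable[OF gauss_PiM_coord(1)[OF I(2) gauss_integral_id(1)]])
  show int: "integrable (PiM I (\<lambda>_. gauss)) (\<lambda>z. b z * z i)"
  proof (rule Bochner_Integration.integrable_bound)
    show "integrable (PiM I (\<lambda>_. gauss)) (\<lambda>z. K * z i)"
      by (intro integrable_mult_right gauss_PiM_coord(1)[OF I(2) gauss_integral_id(1)])
    show "(\<lambda>z. b z * z i) \<in> borel_measurable (PiM I (\<lambda>_. gauss))" by (intro borel_measurable_times bm zm)
    show "AE z in PiM I (\<lambda>_. gauss). norm (b z * z i) \<le> norm (K * z i)"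
    proof (rule AE_I2)
      fix z assume "z \<in> space (PiM I (\<lambda>_. gauss))"
      then have "\<bar>b z\<bar> \<le> \<bar>K\<bar>" using bK[of z] by linarith
      then show "norm (b z * z i) \<le> norm (K * z i)" by (simp add: abs_mult mult_right_mono)
    qed
  qed
  have Ii: "insert i (I - {i}) = I" using I by blast
  have "(\<integral>z. b z * z i \<partial>PiM (insert i (I - {i})) (\<lambda>_. gauss))
      = (\<integral>x. (\<integral>y. b (x(i := y)) * (x(i := y)) i \<partial>gauss) \<partial>PiM (I - {i}) (\<lambda>_. gauss))"
  proof (rule G.product_integral_insert)
    show "integrable (PiM (insert i (I - {i})) (\<lambda>_. gauss)) (\<lambda>z. b z * z i)" unfolding Ii by (rule int)
  qed (use I in simp_all)
  also have "\<dots> = 0" by (simp add: bi gauss_integral_id)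
  finally show "(\<integral>z. b z * z i \<partial>PiM I (\<lambda>_. gauss)) = 0" unfolding Ii .
qed

text \<open>A channel input at time \<open>T\<close> depends only on noise strictly before
  \<open>T\<close>. This is what makes the shift by the transmitted signals triangular.\<close>

lemma received_causal:
  assumes E: "\<And>u v. (u, v) \<in> E \<Longrightarrow> u \<in> W \<or> u = 1"
    and z: "\<And>v s. v \<in> W \<Longrightarrow> s \<in> {1..<T} \<Longrightarrow> z (v, s) = z' (v, s)"
  shows "(u, v) \<in> E \<Longrightarrow> chan_in src enc m (received E src enc m z) u v T = chan_in src enc m (received E src enc m z') u v T"
proof -
  have ch: "chan_in src enc m (received E src enc m z) u v t = chan_in src enc m (received E src enc m z') u v t"
    if uv: "(u, v) \<in> E" and IH: "\<And>s w. w \<in> W \<Longrightarrow> s \<in> {1..<t} \<Longrightarrow> received E src enc m z w s = received E src enc m z' w s" for u v t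
  proof (cases "u = 1")
    case True then show ?thesis by (simp only: chan_in_def if_True simp_thms)
  next
    case False
    then have "u \<in> W" using E[OF uv] by blast
    then show ?thesis by (intro chan_in_cong IH)
  qed
  have rec: "v \<in> W \<Longrightarrow> s \<in> {1..<T} \<Longrightarrow> received E src enc m z v s = received E src enc m z' v s" for v s
  proof (induction s arbitrary: v rule: less_induct)
    case (less s)
    have s1: "s \<ge> 1" using less.prems by simp
    have "(\<Sum>u\<in>inn E v. chan_in src enc m (received E src enc m z) u v s) = (\<Sum>u\<in>inn E v. chan_in src enc m (received E src enc m z') u v s)"
    proof (rule sum.cong[OF refl])
      fix u assume "u \<in> inn E v"
      then have uv: "(u, v) \<in> E" by (simp add: inn_def)
      show "chan_in src enc m (received E src enc m z) u v s = chan_in src enc m (received E src enc m z') u v s"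
      proof (rule ch[OF uv])
        fix t w assume "w \<in> W" "t \<in> {1..<s}"
        then show "received E src enc m z w t = received E src enc m z' w t" using less.prems by (intro less.IH) auto
      qed
    qed
    then show ?case
      unfolding received_eq[OF s1, of E src enc m z v] received_eq[OF s1, of E src enc m z' v]
      using z[OF less.prems] by (simp only: )
  qed
  show ?thesis if "(u, v) \<in> E" by (rule ch[OF that rec])
qed

text \<open>If the noise behind the cut is replaced by noise plus crossing signal, the network
  without the edges out of \<open>S\<close> reproduces the received signals there. It has no edge
  out of the source, so any \<open>m0\<close> may stand for the message: what happens behind the cut
  is a function of \<open>y\<close> alone.\<close>

lemma cut_received:
  assumes E: "E \<subseteq> V \<times> V" and fin: "\<And>v. finite (inn E v)" and S: "1 \<in> S"
    and y: "\<And>v t. v \<in> V - S \<Longrightarrow> t \<in> {1..N} \<Longrightarrow>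
      y (v, t) = z (v, t) + (\<Sum>u\<in>inn E v \<inter> S. chan_in src enc m (received E src enc m z) u v t)"
  shows "v \<in> V - S \<Longrightarrow> t \<in> {1..N} \<Longrightarrow> received {(u, v) \<in> E. u \<notin> S} src enc m0 y v t = received E src enc m z v t"
proof (induction t arbitrary: v rule: less_induct)
  case (less t)
  let ?E = "{(u, v) \<in> E. u \<notin> S}"
  have t1: "t \<ge> 1" using less.prems by simp
  have innE: "inn ?E v = inn E v - S" by (auto simp: inn_def)
  have "(\<Sum>u\<in>inn ?E v. chan_in src enc m0 (received ?E src enc m0 y) u v t)
      = (\<Sum>u\<in>inn E v - S. chan_in src enc m (received E src enc m z) u v t)"
    unfolding innE
  proof (rule sum.cong[OF refl])
    fix u assume u: "u \<in> inn E v - S"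
    have uV: "u \<in> V - S" using u E by (auto simp: inn_def)
    have u1: "u \<noteq> 1" using u S by blast
    have "restrict (received ?E src enc m0 y u) {1..<t} = restrict (received E src enc m z u) {1..<t}"
    proof (rule restrict_ext)
      fix s assume "s \<in> {1..<t}"
      then show "received ?E src enc m0 y u s = received E src enc m z u s"
        using less.prems by (intro less.IH[OF _ uV]) auto
    qed
    then show "chan_in src enc m0 (received ?E src enc m0 y) u v t = chan_in src enc m (received E src enc m z) u v t"
      unfolding chan_in_def using u1 by (simp only: if_False)
  qed
  then have "received ?E src enc m0 y v t = (\<Sum>u\<in>inn E v - S. chan_in src enc m (received E src enc m z) u v t) + y (v, t)"
    unfolding received_eq[OF t1, of ?E] by (simp only: )
  also have "\<dots> = ((\<Sum>u\<in>inn E v \<inter> S. chan_in src enc m (received E src enc m z) u v t)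
      + (\<Sum>u\<in>inn E v - S. chan_in src enc m (received E src enc m z) u v t)) + z (v, t)"
    unfolding y[OF less.prems] by simp
  also have "\<dots> = (\<Sum>u\<in>inn E v. chan_in src enc m (received E src enc m z) u v t) + z (v, t)"
    unfolding sum.Int_Diff[OF fin, of _ v S, symmetric] ..
  also have "\<dots> = received E src enc m z v t" by (rule received_eq[OF t1, symmetric])
  finally show ?case .
qed

text \<open>Minkowski's inequality for the norm over time. It is the source of the square of the sum
  of \<open>sqrt P\<close> in the upper bound.\<close>

lemma sum_square_sum_le:
  fixes X :: "'u \<Rightarrow> 't \<Rightarrow> real" and P :: "'u \<Rightarrow> real"
  assumes A: "finite A" and le: "\<And>u. u \<in> A \<Longrightarrow> (\<Sum>t\<in>T. (X u t)\<^sup>2) \<le> N * P u" and N: "N \<ge> 0"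
  shows "(\<Sum>t\<in>T. (\<Sum>u\<in>A. X u t)\<^sup>2) \<le> N * (\<Sum>u\<in>A. sqrt (P u))\<^sup>2"
proof -
  have "L2_set (\<lambda>t. \<Sum>u\<in>A. X u t) T \<le> (\<Sum>u\<in>A. L2_set (X u) T)" using A
  proof (induction A)
    case empty then show ?case by (simp add: L2_set_def)
  next
    case (insert u A)
    have "L2_set (\<lambda>t. \<Sum>u\<in>insert u A. X u t) T = L2_set (\<lambda>t. X u t + (\<Sum>u\<in>A. X u t)) T"
      using insert.hyps by simp
    also have "\<dots> \<le> L2_set (X u) T + L2_set (\<lambda>t. \<Sum>u\<in>A. X u t) T" by (rule L2_set_triangle_ineq)
    finally show ?case using insert by simp
  qed
  also have "\<dots> \<le> (\<Sum>u\<in>A. sqrt N * sqrt (P u))"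
    unfolding L2_set_def real_sqrt_mult[symmetric] by (intro sum_mono real_sqrt_le_mono le)
  also have "\<dots> = sqrt N * (\<Sum>u\<in>A. sqrt (P u))" by (simp add: sum_distrib_left)
  finally have "sqrt (\<Sum>t\<in>T. (\<Sum>u\<in>A. X u t)\<^sup>2) \<le> sqrt N * (\<Sum>u\<in>A. sqrt (P u))" by (simp add: L2_set_def)
  then have "(sqrt (\<Sum>t\<in>T. (\<Sum>u\<in>A. X u t)\<^sup>2))\<^sup>2 \<le> (sqrt N * (\<Sum>u\<in>A. sqrt (P u)))\<^sup>2"
    by (intro power_mono) (auto intro!: sum_nonneg)
  then show ?thesis using N by (simp add: sum_nonneg power_mult_distrib)
qed

text \<open>\<open>r m\<close> is the likelihood ratio of the reference law to the true law of the
  crossing signals, and the mean of \<open>- ln (r m)\<close> is at most \<open>C\<close>, which is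
  \<open>N\<close> times the cut value in nats. The inequality \<open>ln x \<le> x - 1\<close>, with
  \<open>r m\<close> weighted by \<open>M\<close> on correct decoding, combines this divergence
  bound with the guessing bound \<open>1 / M\<close>.\<close>

lemma cut_converse:
  assumes net: "gaussian_network nV E D" and P: "\<forall>e\<in>E. P e \<ge> 0" and S: "S \<in> cuts nV D"
    and valid: "valid_code nV E D P N M src enc dec"
  defines "Qv \<equiv> \<lambda>v. (\<Sum>u\<in>inn E v \<inter> S. sqrt (P (u, v)))\<^sup>2"
  shows "(1 - error_prob nV E D N M src enc dec) * ln M \<le> N * (\<Sum>v\<in>cut_front nV E S. 1/2 * ln (1 + Qv v)) + ln 2"
proof -
  define W where "W = nodes nV - {1}"
  define I where "I = W \<times> {1..N}"
  interpret N: prob_space "noise nV N" by (rule prob_space_noise)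
  have noise: "noise nV N = PiM I (\<lambda>_. gauss)" by (simp add: noise_def I_def W_def)
  have finW: "finite W" and finI: "finite I" by (auto simp: W_def I_def nodes_def)
  have EV: "E \<subseteq> nodes nV \<times> nodes nV" and no1: "\<And>u. (u, 1) \<notin> E" using net unfolding gaussian_network_def by blast+
  have SV: "S \<subseteq> nodes nV" "1 \<in> S" using S unfolding cuts_def by blast+
  obtain d where d: "d \<in> D" "d \<in> nodes nV - S" using S unfolding cuts_def by blast
  have dW: "d \<in> W" using d SV unfolding W_def by blast
  have edge: "u \<in> W \<or> u = 1" "v \<in> W" if "(u, v) \<in> E" for u v
  proof -
    have "u \<in> nodes nV" "v \<in> nodes nV" using EV that by blast+
    then show "u \<in> W \<or> u = 1" "v \<in> W" using that no1 unfolding W_def by blast+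
  qed
  have fin: "finite (inn E v)" for v by (rule finite_inn[OF net])
  have M1: "M \<ge> 1"
    and encm: "\<And>u w t. (u, w) \<in> E \<Longrightarrow> u \<noteq> 1 \<Longrightarrow> t \<in> {1..N} \<Longrightarrow> enc u w t \<in> borel_measurable (PiM {1..<t} (\<lambda>_. borel))"
    and decm: "\<And>d. d \<in> D \<Longrightarrow> dec d \<in> measurable (PiM {1..N} (\<lambda>_. borel)) (count_space UNIV)"
    and pow: "\<And>m z u w. m \<in> {1..M} \<Longrightarrow> z \<in> space (noise nV N) \<Longrightarrow> (u, w) \<in> E \<Longrightarrow>
        (\<Sum>t=1..N. (chan_input E src enc m z u w t)\<^sup>2) / real N \<le> P (u, w)"
    using valid unfolding valid_code_def by blast+
  \<comment> \<open>Coordinates of nodes in \<open>S\<close> are not shifted and keep variance 1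
    under the reference law, so they contribute nothing to the divergence.\<close>
  define q where "q = (\<lambda>v. if v \<in> S then 0 else Qv v)"
  define s where "s = (\<lambda>v. 1 + q v)"
  define \<sigma> where "\<sigma> = (\<lambda>i::nat \<times> nat. sqrt (s (fst i)))"
  have q0: "q v \<ge> 0" for v by (simp add: q_def Qv_def)
  have s1: "s v \<ge> 1" for v using q0 by (simp add: s_def)
  have \<sigma>0: "\<sigma> i > 0" for i using s1[of "fst i"] unfolding \<sigma>_def by simp
  define Rc where "Rc = (\<lambda>m z. received E src enc m z)"
  define a where "a = (\<lambda>m i z. if fst i \<in> S then 0 else (\<Sum>u\<in>inn E (fst i) \<inter> S. chan_in src enc m (Rc m z) u (fst i) (snd i)))"
  define K where "K = nV + 1"
  \<comment> \<open>Lexicographic by time, then by node; \<open>K\<close> exceeds every node number.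
    Signals at one time depend only on earlier noise, hence on coordinates of smaller rank.\<close>
  define rank where "rank = (\<lambda>i::nat \<times> nat. snd i * K + fst i)"
  have rank_inj: "inj_on rank I"
  proof (rule inj_onI)
    fix i j assume ij: "i \<in> I" "j \<in> I" "rank i = rank j"
    have le: "fst i < K" "fst j < K" using ij(1,2) by (auto simp: I_def W_def nodes_def K_def)
    have K0: "K \<noteq> 0" by (simp add: K_def)
    have "fst i = rank i mod K" "snd i = rank i div K" "fst j = rank j mod K" "snd j = rank j div K"
      using le K0 unfolding rank_def by simp_all
    then show "i = j" using ij(3) by (simp add: prod_eq_iff)
  qed
  have coord: "(\<lambda>z. z (v, t)) \<in> borel_measurable (PiM I (\<lambda>_. borel :: real measure))" if "v \<in> W" "t \<in> {1..N}" for v t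
    using that by (intro measurable_component_singleton) (simp add: I_def)
  have am: "a m i \<in> borel_measurable (PiM I (\<lambda>_. borel))" if i: "i \<in> I" for m i
  proof (cases "fst i \<in> S")
    case True then show ?thesis unfolding a_def by simp
  next
    case False
    have "(\<lambda>z. \<Sum>u\<in>inn E (fst i) \<inter> S. chan_in src enc m (Rc m z) u (fst i) (snd i)) \<in> borel_measurable (PiM I (\<lambda>_. borel))"
    proof (rule borel_measurable_sum)
      fix u assume "u \<in> inn E (fst i) \<inter> S"
      then have uE: "(u, fst i) \<in> E" by (simp add: inn_def)
      have "snd i \<in> {1..N}" using i by (auto simp: I_def)
      then show "(\<lambda>z. chan_in src enc m (Rc m z) u (fst i) (snd i)) \<in> borel_measurable (PiM I (\<lambda>_. borel))"
        unfolding Rc_def by (intro received_measurable(2)[where W = W and N = N, OF edge(1) no1 encm coord uE])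
    qed
    then show ?thesis unfolding a_def using False by (simp only: if_False)
  qed
  have ad: "a m i z = a m i z'" if i: "i \<in> I" and eq: "\<And>j. j \<in> I \<Longrightarrow> rank j < rank i \<Longrightarrow> z j = z' j" for m i z z'
  proof -
    have "chan_in src enc m (Rc m z) u (fst i) (snd i) = chan_in src enc m (Rc m z') u (fst i) (snd i)"
      if "u \<in> inn E (fst i) \<inter> S" for u
      unfolding Rc_def
    proof (rule received_causal[where W = W])
      show "(u, fst i) \<in> E" using that by (simp add: inn_def)
      show "\<And>u v. (u, v) \<in> E \<Longrightarrow> u \<in> W \<or> u = 1" by (rule edge(1))
      fix v t assume v: "v \<in> W" and t: "t \<in> {1..<snd i}"
      have "(v, t) \<in> I" using v t i by (auto simp: I_def)
      moreover have "rank (v, t) < rank i"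
      proof -
        have "v < K" using v by (simp add: W_def nodes_def K_def)
        then have "rank (v, t) < Suc t * K" by (simp add: rank_def)
        also have "\<dots> \<le> snd i * K" using t by (intro mult_le_mono1) simp
        also have "\<dots> \<le> rank i" by (simp add: rank_def)
        finally show ?thesis .
      qed
      ultimately show "z (v, t) = z' (v, t)" by (rule eq)
    qed
    then show ?thesis unfolding a_def by (simp only: cong: sum.cong)
  qed
  define T where "T = (\<lambda>m z. \<lambda>i\<in>I. z i + a m i z)"
  \<comment> \<open>No edge of \<open>E'\<close> leaves the source, so the message argument 0 in
    \<open>D0\<close> is a dummy and \<open>D0\<close> is the same function for all
    messages.\<close>
  define E' where "E' = {(u, v) \<in> E. u \<notin> S}"
  define D0 where "D0 = (\<lambda>y. dec d (restrict (received E' src enc 0 y d) {1..N}))"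
  have rec_eq: "received E' src enc 0 (T m z) v t = Rc m z v t" if "v \<in> nodes nV - S" "t \<in> {1..N}" for m z v t
    unfolding E'_def Rc_def
  proof (rule cut_received[OF EV fin SV(2) _ that])
    fix v t assume v: "v \<in> nodes nV - S" and t: "t \<in> {1..N}"
    have "(v, t) \<in> I" using v t SV unfolding I_def W_def by blast
    then show "T m z (v, t) = z (v, t) + (\<Sum>u\<in>inn E v \<inter> S. chan_in src enc m (received E src enc m z) u v t)"
      using v unfolding T_def a_def Rc_def by simp
  qed
  have D0T: "D0 (T m z) = dec d (restrict (Rc m z d) {1..N})" for m z
  proof -
    have "restrict (received E' src enc 0 (T m z) d) {1..N} = restrict (Rc m z d) {1..N}"
      by (intro restrict_ext rec_eq d(2))
    then show ?thesis unfolding D0_def by (rule arg_cong)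
  qed
  have D0m: "D0 \<in> measurable (PiM I (\<lambda>_. borel)) (count_space UNIV)"
  proof -
    have "(\<lambda>y. \<lambda>t\<in>{1..N}. received E' src enc 0 y d t) \<in> measurable (PiM I (\<lambda>_. borel)) (PiM {1..N} (\<lambda>_. borel))"
    proof (rule measurable_restrict)
      fix t assume t: "t \<in> {1..N}"
      show "(\<lambda>y. received E' src enc 0 y d t) \<in> borel_measurable (PiM I (\<lambda>_. borel))"
      proof (rule received_measurable(1)[where W = W and N = N, OF _ _ _ coord dW t])
        show "\<And>u v. (u, v) \<in> E' \<Longrightarrow> u \<in> W \<or> u = 1" unfolding E'_def using edge(1) by blast
        show "\<And>u. (u, 1) \<notin> E'" unfolding E'_def using no1 by blast
        show "\<And>u w t. (u, w) \<in> E' \<Longrightarrow> u \<noteq> 1 \<Longrightarrow> t \<in> {1..N} \<Longrightarrow> enc u w t \<in> borel_measurable (PiM {1..<t} (\<lambda>_. borel))"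
          unfolding E'_def using encm by blast
      qed
    qed
    from measurable_compose[OF this decm[OF d(1)]] show ?thesis unfolding D0_def .
  qed
  have mN: "measurable (noise nV N) L = measurable (PiM I (\<lambda>_. borel)) L" for L
    unfolding noise by (rule measurable_cong_sets[OF sets_PiM_cong refl]) auto
  have spN: "space (noise nV N) = space (PiM I (\<lambda>_. borel :: real measure))"
    unfolding noise by (simp add: space_PiM)
  have Tm: "T m \<in> measurable (noise nV N) (PiM I (\<lambda>_. borel))" for m
    unfolding mN T_def by (intro measurable_restrict borel_measurable_add measurable_component_singleton am)
  define A where "A = (\<lambda>m. {z \<in> space (noise nV N). D0 (T m z) = m})"
  have Am: "A m \<in> sets (noise nV N)" for m
  proof -
    have "(\<lambda>z. D0 (T m z)) \<in> measurable (noise nV N) (count_space UNIV)" by (rule measurable_compose[OF Tm D0m])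
    then show ?thesis unfolding A_def by measurable
  qed
  define \<rho> where "\<rho> = (\<lambda>m i z. normal_density 0 (\<sigma> i) (z i + a m i z) / std_normal_density (z i))"
  define r where "r = (\<lambda>m z. \<Prod>i\<in>I. \<rho> m i z)"
  have \<rho>0: "\<rho> m i z > 0" for m i z
    unfolding \<rho>_def by (intro divide_pos_pos normal_density_pos \<sigma>0) simp
  have r0: "r m z > 0" for m z unfolding r_def by (intro prod_pos ballI \<rho>0)
  have rm: "r m \<in> borel_measurable (noise nV N)" for m
    unfolding r_def
  proof (intro borel_measurable_prod)
    fix i assume i: "i \<in> I"
    have [measurable]: "(\<lambda>z. z i) \<in> borel_measurable (noise nV N)"
      unfolding mN by (rule measurable_component_singleton[OF i])
    have [measurable]: "a m i \<in> borel_measurable (noise nV N)" unfolding mN by (rule am[OF i])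
    show "\<rho> m i \<in> borel_measurable (noise nV N)" unfolding \<rho>_def by measurable
  qed
  define Q where "Q = PiM I (\<lambda>i. density lborel (\<lambda>x. ennreal (normal_density 0 (\<sigma> i) x)))"
  interpret Q: prob_space Q unfolding Q_def by (intro prob_space_PiM prob_space_normal_density \<sigma>0)
  have mQ: "measurable Q L = measurable (PiM I (\<lambda>_. borel)) L" for L
    unfolding Q_def by (rule measurable_cong_sets[OF sets_PiM_cong refl]) auto
  have shift: "(\<integral>\<^sup>+ z. F (T m z) * ennreal (r m z) \<partial>noise nV N) = (\<integral>\<^sup>+ y. F y \<partial>Q)"
    if "F \<in> borel_measurable (PiM I (\<lambda>_. borel))" for F m
  proof -
    have "ennreal (r m z) = (\<Prod>i\<in>I. ennreal (normal_density 0 (\<sigma> i) (z i + a m i z) / std_normal_density (z i)))" for z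
    proof -
      have "(\<Prod>i\<in>I. ennreal (\<rho> m i z)) = ennreal (r m z)"
        unfolding r_def by (intro prod_ennreal less_imp_le \<rho>0)
      then show ?thesis unfolding \<rho>_def by (rule sym)
    qed
    then have "(\<integral>\<^sup>+ z. F (T m z) * ennreal (r m z) \<partial>noise nV N)
        = (\<integral>\<^sup>+ z. F (\<lambda>i\<in>I. z i + a m i z) * (\<Prod>i\<in>I. ennreal (normal_density 0 (\<sigma> i) (z i + a m i z) / std_normal_density (z i))) \<partial>PiM I (\<lambda>_. gauss))"
      unfolding noise T_def by (intro nn_integral_cong) (simp only: )
    also have "\<dots> = (\<integral>\<^sup>+ y. F y \<partial>Q)"
      unfolding Q_def by (rule triangular_shift[OF finI rank_inj \<sigma>0 am ad that])
    finally show ?thesis .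
  qed
  have nn1: "(\<integral>\<^sup>+ z. ennreal (r m z) \<partial>noise nV N) = 1" for m
    using shift[of "\<lambda>_. 1" m] by (simp add: Q.emeasure_space_1)
  define Fm where "Fm = (\<lambda>m y. indicator {m} (D0 y) :: ennreal)"
  have Fmm: "Fm m \<in> borel_measurable (PiM I (\<lambda>_. borel))" for m
    unfolding Fm_def by (rule measurable_compose[OF D0m]) simp
  have nnA: "(\<integral>\<^sup>+ z. ennreal (r m z * indicator (A m) z) \<partial>noise nV N) = (\<integral>\<^sup>+ y. Fm m y \<partial>Q)" for m
  proof -
    have "(\<integral>\<^sup>+ z. ennreal (r m z * indicator (A m) z) \<partial>noise nV N) = (\<integral>\<^sup>+ z. Fm m (T m z) * ennreal (r m z) \<partial>noise nV N)"
    proof (rule nn_integral_cong)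
      fix z assume "z \<in> space (noise nV N)"
      then show "ennreal (r m z * indicator (A m) z) = Fm m (T m z) * ennreal (r m z)"
        by (cases "D0 (T m z) = m") (simp_all add: A_def Fm_def)
    qed
    then show ?thesis using shift[OF Fmm] by simp
  qed
  define w where "w = (\<lambda>m. \<integral>z. r m z * indicator (A m) z \<partial>noise nV N)"
  have intr: "integrable (noise nV N) (r m)" "(\<integral>z. r m z \<partial>noise nV N) = 1" for m
  proof -
    show "integrable (noise nV N) (r m)"
      using nn1[of m] by (intro integrableI_nonneg rm) (auto simp: less_imp_le r0)
    show "(\<integral>z. r m z \<partial>noise nV N) = 1"
      using nn1[of m] by (subst integral_eq_nn_integral[OF rm]) (auto simp: less_imp_le r0)
  qed
  have intw: "integrable (noise nV N) (\<lambda>z. r m z * indicator (A m) z)" for m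
    using integrable_mult_indicator[OF Am[of m] intr(1)[of m]] by (simp add: mult.commute)
  \<comment> \<open>\<open>w m\<close> is the probability under \<open>Q\<close> that
    \<open>D0\<close> returns \<open>m\<close>. The law and the function are the same for all
    \<open>m\<close>, so these are disjoint events.\<close>
  have wsum: "(\<Sum>m=1..M. w m) \<le> 1"
  proof -
    have "ennreal (\<Sum>m=1..M. w m) = (\<Sum>m=1..M. ennreal (w m))"
      unfolding w_def by (intro sum_ennreal[symmetric] integral_nonneg_AE AE_I2) (simp add: less_imp_le r0)
    also have "\<dots> = (\<Sum>m=1..M. \<integral>\<^sup>+ y. Fm m y \<partial>Q)"
    proof (rule sum.cong[OF refl])
      fix m
      show "ennreal (w m) = (\<integral>\<^sup>+ y. Fm m y \<partial>Q)"
        unfolding w_def nnA[symmetric] by (intro nn_integral_eq_integral[symmetric] intw AE_I2) (simp add: less_imp_le r0)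
    qed
    also have "\<dots> = (\<integral>\<^sup>+ y. (\<Sum>m=1..M. Fm m y) \<partial>Q)"
      using Fmm by (intro nn_integral_sum[symmetric]) (simp only: mQ)
    also have "\<dots> \<le> (\<integral>\<^sup>+ y. 1 \<partial>Q)"
    proof (rule nn_integral_mono)
      fix y
      have "(\<Sum>m=1..M. Fm m y) = (\<Sum>m=1..M. if m = D0 y then 1 else 0)"
        unfolding Fm_def by (intro sum.cong refl) simp
      then show "(\<Sum>m=1..M. Fm m y) \<le> 1" by simp
    qed
    also have "\<dots> = 1" by (simp add: Q.emeasure_space_1)
    finally show ?thesis by (simp add: ennreal_le_1)
  qed
  have power: "(\<Sum>t=1..N. (a m (v, t) z)\<^sup>2) \<le> N * q v" if m: "m \<in> {1..M}" and z: "z \<in> space (noise nV N)" for m v z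
  proof (cases "v \<in> S")
    case True then show ?thesis by (simp add: a_def q_def)
  next
    case False
    have "(\<Sum>t=1..N. (\<Sum>u\<in>inn E v \<inter> S. chan_in src enc m (Rc m z) u v t)\<^sup>2) \<le> real N * (\<Sum>u\<in>inn E v \<inter> S. sqrt (P (u, v)))\<^sup>2"
    proof (rule sum_square_sum_le)
      show "finite (inn E v \<inter> S)" using fin by blast
      fix u assume "u \<in> inn E v \<inter> S"
      then have uv: "(u, v) \<in> E" by (simp add: inn_def)
      have "(\<Sum>t=1..N. (chan_in src enc m (Rc m z) u v t)\<^sup>2) / real N \<le> P (u, v)"
        using pow[OF m z uv] unfolding chan_input_received Rc_def .
      then show "(\<Sum>t=1..N. (chan_in src enc m (Rc m z) u v t)\<^sup>2) \<le> real N * P (u, v)"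
        by (cases "N = 0") (simp_all add: pos_divide_le_eq mult.commute)
    qed simp
    then show ?thesis using False by (simp add: a_def q_def Qv_def)
  qed
  have abound: "\<bar>a m i z\<bar> \<le> sqrt (N * q (fst i))" if m: "m \<in> {1..M}" and i: "i \<in> I" and z: "z \<in> space (noise nV N)" for m i z
  proof -
    have "(a m (fst i, snd i) z)\<^sup>2 \<le> (\<Sum>t=1..N. (a m (fst i, t) z)\<^sup>2)"
      using i by (intro member_le_sum[where f = "\<lambda>t. (a m (fst i, t) z)\<^sup>2"]) (auto simp: I_def)
    also have "\<dots> \<le> N * q (fst i)" by (rule power[OF m z])
    finally show ?thesis by (intro real_le_rsqrt) simp
  qed
  \<comment> \<open>Expanding the Gaussian exponents gives \<open>- ln (\<rho> m i z) = h m i z + (a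
    m i z)^2 / (2 * s (fst i))\<close>. In \<open>U\<close> the squares are replaced by their power
    bound, valid for every \<open>z\<close>. The mean of \<open>h\<close> has no mixed term, and
    because \<open>s = 1 + q\<close> the rest cancels to half the logarithm of \<open>s\<close> for
    each time.\<close>
  define h where "h = (\<lambda>m i z. 1/2 * ln (s (fst i)) + (1 / (2 * s (fst i)) - 1/2) * (z i)\<^sup>2 + 1 / s (fst i) * (a m i z * z i))"
  define U where "U = (\<lambda>m z. (\<Sum>i\<in>I. h m i z) + (\<Sum>v\<in>W. N * q v / (2 * s v)))"
  have lnr: "- U m z \<le> ln (r m z)" if m: "m \<in> {1..M}" and z: "z \<in> space (noise nV N)" for m z
  proof -
    have ln\<rho>: "ln (\<rho> m i z) = - h m i z - (a m i z)\<^sup>2 / (2 * s (fst i))" for i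
    proof -
      let ?s = "s (fst i)" and ?x = "z i + a m i z"
      have sp: "?s > 0" using s1[of "fst i"] by simp
      have sig: "(\<sigma> i)\<^sup>2 = ?s" using sp by (simp add: \<sigma>_def)
      have n1: "ln (normal_density 0 (\<sigma> i) ?x) = - 1/2 * ln (2 * pi * ?s) - ?x\<^sup>2 / (2 * ?s)"
        unfolding normal_density_def sig using sp by (simp add: ln_mult ln_div ln_sqrt)
      have n2: "ln (std_normal_density (z i)) = - 1/2 * ln (2 * pi) - (z i)\<^sup>2 / 2"
        unfolding std_normal_density_def by (simp add: ln_mult ln_div ln_sqrt)
      have n3: "ln (2 * pi * ?s) = ln (2 * pi) + ln ?s" using sp by (intro ln_mult_pos) auto
      have "ln (\<rho> m i z) = ln (normal_density 0 (\<sigma> i) ?x) - ln (std_normal_density (z i))"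
        unfolding \<rho>_def by (intro ln_divide_pos normal_density_pos \<sigma>0) simp
      also have "\<dots> = - h m i z - (a m i z)\<^sup>2 / (2 * ?s)"
        unfolding n1 n2 n3 h_def using sp by (simp add: field_simps power2_eq_square)
      finally show ?thesis .
    qed
    have "\<rho> m i z \<noteq> 0" for i using \<rho>0[of m i z] by simp
    then have "ln (r m z) = (\<Sum>i\<in>I. ln (\<rho> m i z))" unfolding r_def by (intro ln_prod finI)
    also have "\<dots> = - (\<Sum>i\<in>I. h m i z) - (\<Sum>i\<in>I. (a m i z)\<^sup>2 / (2 * s (fst i)))"
      unfolding ln\<rho> by (simp add: sum_subtractf sum_negf)
    also have "(\<Sum>i\<in>I. (a m i z)\<^sup>2 / (2 * s (fst i))) = (\<Sum>v\<in>W. \<Sum>t=1..N. (a m (v, t) z)\<^sup>2 / (2 * s v))"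
      unfolding I_def sum.cartesian_product by (intro sum.cong) auto
    finally have eq: "ln (r m z) = - (\<Sum>i\<in>I. h m i z) - (\<Sum>v\<in>W. \<Sum>t=1..N. (a m (v, t) z)\<^sup>2 / (2 * s v))" .
    have "(\<Sum>v\<in>W. \<Sum>t=1..N. (a m (v, t) z)\<^sup>2 / (2 * s v)) \<le> (\<Sum>v\<in>W. N * q v / (2 * s v))"
    proof (rule sum_mono)
      fix v
      have "0 \<le> 2 * s v" using s1[of v] by simp
      then show "(\<Sum>t=1..N. (a m (v, t) z)\<^sup>2 / (2 * s v)) \<le> N * q v / (2 * s v)"
        unfolding sum_divide_distrib[symmetric] by (intro divide_right_mono power[OF m z])
    qed
    then show ?thesis unfolding eq U_def by linarith
  qed
  have inth: "integrable (noise nV N) (h m i)" "(\<integral>z. h m i z \<partial>noise nV N) = 1/2 * ln (s (fst i)) + (1 / (2 * s (fst i)) - 1/2)"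
    if m: "m \<in> {1..M}" and i: "i \<in> I" for m i
  proof -
    have sq: "integrable (noise nV N) (\<lambda>z. (z i)\<^sup>2)" "(\<integral>z. (z i)\<^sup>2 \<partial>noise nV N) = 1"
      unfolding noise using gauss_PiM_coord[OF i gauss_integrable_power[of 2]] gauss_integral_square by simp_all
    have ind: "a m i (z(i := y)) = a m i z" for z y
      by (rule ad[OF i]) auto
    have az: "integrable (noise nV N) (\<lambda>z. a m i z * z i)" "(\<integral>z. a m i z * z i \<partial>noise nV N) = 0"
      using gauss_PiM_uncorrelated[OF finI i am[OF i, of m, folded mN, unfolded noise] abound[OF m i, unfolded noise] ind]
      unfolding noise by simp_all
    show "integrable (noise nV N) (h m i)" unfolding h_def using sq az by (intro Bochner_Integration.integrable_add integrable_mult_right N.integrable_const)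
    show "(\<integral>z. h m i z \<partial>noise nV N) = 1/2 * ln (s (fst i)) + (1 / (2 * s (fst i)) - 1/2)"
      unfolding h_def using sq az by (simp add: N.prob_space)
  qed
  define C where "C = N * (\<Sum>v\<in>W. 1/2 * ln (s v))"
  have intU: "integrable (noise nV N) (U m)" "(\<integral>z. U m z \<partial>noise nV N) = C" if m: "m \<in> {1..M}" for m
  proof -
    show "integrable (noise nV N) (U m)" unfolding U_def
      by (intro Bochner_Integration.integrable_add Bochner_Integration.integrable_sum inth(1)[OF m] N.integrable_const)
    have "(\<integral>z. U m z \<partial>noise nV N) = (\<Sum>i\<in>I. 1/2 * ln (s (fst i)) + (1 / (2 * s (fst i)) - 1/2)) + (\<Sum>v\<in>W. N * q v / (2 * s v))"
    proof -
      have "(\<integral>z. U m z \<partial>noise nV N) = (\<integral>z. (\<Sum>i\<in>I. h m i z) \<partial>noise nV N) + (\<integral>z. (\<Sum>v\<in>W. N * q v / (2 * s v)) \<partial>noise nV N)"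
        unfolding U_def by (intro Bochner_Integration.integral_add Bochner_Integration.integrable_sum inth(1)[OF m] N.integrable_const)
      also have "(\<integral>z. (\<Sum>i\<in>I. h m i z) \<partial>noise nV N) = (\<Sum>i\<in>I. \<integral>z. h m i z \<partial>noise nV N)"
        by (intro Bochner_Integration.integral_sum inth(1)[OF m])
      also have "\<dots> = (\<Sum>i\<in>I. 1/2 * ln (s (fst i)) + (1 / (2 * s (fst i)) - 1/2))" by (intro sum.cong refl inth(2)[OF m])
      finally show ?thesis by (simp add: N.prob_space)
    qed
    also have "(\<Sum>i\<in>I. 1/2 * ln (s (fst i)) + (1 / (2 * s (fst i)) - 1/2)) = (\<Sum>v\<in>W. \<Sum>t=1..N. 1/2 * ln (s v) + (1 / (2 * s v) - 1/2))"
      unfolding I_def sum.cartesian_product by (intro sum.cong) auto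
    also have "\<dots> = (\<Sum>v\<in>W. N * (1/2 * ln (s v) + (1 / (2 * s v) - 1/2)))" by simp
    also have "\<dots> + (\<Sum>v\<in>W. N * q v / (2 * s v)) = (\<Sum>v\<in>W. N * (1/2 * ln (s v)))"
      unfolding sum.distrib[symmetric]
    proof (rule sum.cong[OF refl])
      fix v
      have "s v > 0" using s1[of v] by simp
      then have "1 / (2 * s v) - 1/2 + q v / (2 * s v) = 0" by (simp add: s_def field_simps)
      then have "N * (1/2 * ln (s v)) + N * (1 / (2 * s v) - 1/2 + q v / (2 * s v)) = N * (1/2 * ln (s v))" by simp
      then show "N * (1/2 * ln (s v) + (1 / (2 * s v) - 1/2)) + N * q v / (2 * s v) = N * (1/2 * ln (s v))"
        by (simp add: distrib_left)
    qed
    finally show "(\<integral>z. U m z \<partial>noise nV N) = C" unfolding C_def sum_distrib_left .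
  qed
  have per: "ln M * measure (noise nV N) (A m) - ln 2 - C \<le> 1/2 + M / 2 * w m - 1" if m: "m \<in> {1..M}" for m
  proof -
    have iA: "integrable (noise nV N) (indicator (A m) :: _ \<Rightarrow> real)" using Am by (simp add: N.emeasure_eq_measure)
    have "(\<integral>z. ln M * indicator (A m) z - ln 2 - U m z \<partial>noise nV N) \<le> (\<integral>z. 1/2 * r m z + M / 2 * (r m z * indicator (A m) z) - 1 \<partial>noise nV N)"
    proof (rule integral_mono)
      show "integrable (noise nV N) (\<lambda>z. ln M * indicator (A m) z - ln 2 - U m z)"
        by (intro Bochner_Integration.integrable_diff integrable_mult_right iA N.integrable_const intU(1)[OF m])
      show "integrable (noise nV N) (\<lambda>z. 1/2 * r m z + M / 2 * (r m z * indicator (A m) z) - 1)"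
        by (intro Bochner_Integration.integrable_diff Bochner_Integration.integrable_add integrable_mult_right intr(1) intw N.integrable_const)
      fix z assume z: "z \<in> space (noise nV N)"
      \<comment> \<open>The mixture with weight 1/2 keeps \<open>x\<close> positive also where
        decoding fails. Its upper bound \<open>r / 2 + M / 2 * r * indicator (A m)\<close> has mean
        at most 1 when averaged over the messages, so \<open>ln x \<le> x - 1\<close> costs only the
        \<open>ln 2\<close>.\<close>
      define x where "x = r m z * (if z \<in> A m then real M else 1) / 2"
      have k0: "(if z \<in> A m then real M else 1) > 0" using M1 by simp
      then have x0: "x > 0" unfolding x_def using r0[of m z] by simp
      have "ln x = ln (r m z) + ln (if z \<in> A m then real M else 1) - ln 2"
        unfolding x_def using r0[of m z] k0 by (simp add: ln_divide_pos ln_mult_pos)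
      moreover have "ln (if z \<in> A m then real M else 1) = ln M * indicator (A m) z" by simp
      moreover have "ln x \<le> x - 1" by (rule ln_le_minus_one[OF x0])
      moreover have "x \<le> 1/2 * r m z + M / 2 * (r m z * indicator (A m) z)"
        unfolding x_def using r0[of m z] by (cases "z \<in> A m") simp_all
      moreover note lnr[OF m z]
      ultimately show "ln M * indicator (A m) z - ln 2 - U m z \<le> 1/2 * r m z + M / 2 * (r m z * indicator (A m) z) - 1" by linarith
    qed
    moreover have "(\<integral>z. ln M * indicator (A m) z - ln 2 - U m z \<partial>noise nV N) = ln M * measure (noise nV N) (A m) - ln 2 - C"
      using iA intU[OF m] Am by (simp add: N.prob_space)
    moreover have "(\<integral>z. 1/2 * r m z + M / 2 * (r m z * indicator (A m) z) - 1 \<partial>noise nV N) = 1/2 + M / 2 * w m - 1"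
      using intr[of m] intw[of m] by (simp add: N.prob_space w_def)
    ultimately show ?thesis by (simp only: )
  qed
  have err: "1 - measure (noise nV N) {z \<in> space (noise nV N). \<exists>d\<in>D. dec d (restrict (received E src enc m z d) {1..N}) \<noteq> m}
      \<le> measure (noise nV N) (A m)" for m
  proof -
    let ?Er = "{z \<in> space (noise nV N). \<exists>d\<in>D. dec d (restrict (received E src enc m z d) {1..N}) \<noteq> m}"
    have finD: "finite D" using net unfolding gaussian_network_def nodes_def by (metis finite_Diff finite_atLeastAtMost finite_subset)
    have "{z \<in> space (noise nV N). dec d' (restrict (received E src enc m z d') {1..N}) \<noteq> m} \<in> sets (noise nV N)" if d': "d' \<in> D" for d'
    proof -
      have d'W: "d' \<in> W" using net d' unfolding gaussian_network_def W_def by blast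
      have "(\<lambda>z. \<lambda>t\<in>{1..N}. received E src enc m z d' t) \<in> measurable (noise nV N) (PiM {1..N} (\<lambda>_. borel))"
        unfolding mN
        by (intro measurable_restrict received_measurable(1)[where W = W and N = N, OF edge(1) no1 encm coord d'W])
      from measurable_compose[OF this decm[OF d']]
      have "(\<lambda>z. dec d' (restrict (received E src enc m z d') {1..N})) \<in> measurable (noise nV N) (count_space UNIV)" .
      then show ?thesis by measurable
    qed
    then have "(\<Union>d'\<in>D. {z \<in> space (noise nV N). dec d' (restrict (received E src enc m z d') {1..N}) \<noteq> m}) \<in> sets (noise nV N)"
      using finD by (intro sets.finite_UN)
    moreover have "?Er = (\<Union>d'\<in>D. {z \<in> space (noise nV N). dec d' (restrict (received E src enc m z d') {1..N}) \<noteq> m})" by blast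
    ultimately have Erm: "?Er \<in> sets (noise nV N)" by (simp only: )
    have "1 - measure (noise nV N) ?Er = measure (noise nV N) (space (noise nV N) - ?Er)" by (rule N.prob_compl[OF Erm, symmetric])
    also have "\<dots> \<le> measure (noise nV N) (A m)"
    proof (rule N.finite_measure_mono[OF _ Am])
      show "space (noise nV N) - ?Er \<subseteq> A m" unfolding A_def D0T Rc_def using d(1) by blast
    qed
    finally show ?thesis .
  qed
  have lnM: "ln (real M) \<ge> 0" using M1 by simp
  let ?er = "\<lambda>m. measure (noise nV N) {z \<in> space (noise nV N). \<exists>d\<in>D. dec d (restrict (received E src enc m z d) {1..N}) \<noteq> m}"
  have "(\<Sum>m=1..M. ln M * (1 - ?er m)) \<le> (\<Sum>m=1..M. ln M * measure (noise nV N) (A m))"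
    by (intro sum_mono mult_left_mono err lnM)
  also have "\<dots> \<le> (\<Sum>m=1..M. (ln 2 + C - 1/2) + M / 2 * w m)"
  proof (rule sum_mono)
    fix m assume "m \<in> {1..M}"
    from per[OF this] show "ln M * measure (noise nV N) (A m) \<le> (ln 2 + C - 1/2) + M / 2 * w m" by linarith
  qed
  also have "\<dots> = M * (ln 2 + C - 1/2) + M / 2 * (\<Sum>m=1..M. w m)" by (simp add: sum.distrib sum_distrib_left)
  also have "\<dots> \<le> M * (ln 2 + C - 1/2) + M / 2 * 1" by (intro add_left_mono mult_left_mono wsum) simp
  also have "\<dots> = M * (ln 2 + C)" by (simp add: algebra_simps)
  finally have sum: "(\<Sum>m=1..M. ln M * (1 - ?er m)) \<le> M * (ln 2 + C)" .
  have "(\<Sum>m=1..M. ln M * (1 - ?er m)) = ln M * (M - (\<Sum>m=1..M. ?er m))"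
    by (simp add: sum_distrib_left[symmetric] sum_subtractf)
  also have "(\<Sum>m=1..M. ?er m) = M * error_prob nV E D N M src enc dec" using M1 by (simp add: error_prob_def)
  finally have "ln M * (M - M * error_prob nV E D N M src enc dec) \<le> M * (ln 2 + C)"
    using sum by (rule ord_eq_le_trans[OF sym])
  moreover have "ln M * (M - M * error_prob nV E D N M src enc dec) = M * ((1 - error_prob nV E D N M src enc dec) * ln M)"
    by (simp add: algebra_simps)
  ultimately have "M * ((1 - error_prob nV E D N M src enc dec) * ln M) \<le> M * (ln 2 + C)" by (simp only: )
  then have fin1: "(1 - error_prob nV E D N M src enc dec) * ln M \<le> ln 2 + C" using M1 by simp
  have "(\<Sum>v\<in>W. 1/2 * ln (s v)) = (\<Sum>v\<in>cut_front nV E S. 1/2 * ln (1 + Qv v))"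
  proof -
    have sub: "cut_front nV E S \<subseteq> W" using SV unfolding cut_front_def W_def by blast
    have "(\<Sum>v\<in>W. 1/2 * ln (s v)) = (\<Sum>v\<in>cut_front nV E S. 1/2 * ln (s v))"
    proof (rule sum.mono_neutral_right[OF finW sub], rule ballI)
      fix v assume v: "v \<in> W - cut_front nV E S"
      have "q v = 0"
      proof (cases "v \<in> S")
        case False
        then have "inn E v \<inter> S = {}" using v unfolding cut_front_def W_def inn_def by blast
        then show ?thesis by (simp add: q_def Qv_def)
      qed (simp add: q_def)
      then show "1/2 * ln (s v) = 0" by (simp add: s_def)
    qed
    also have "\<dots> = (\<Sum>v\<in>cut_front nV E S. 1/2 * ln (1 + Qv v))"
      by (intro sum.cong refl) (simp add: s_def q_def cut_front_def)
    finally show ?thesis .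
  qed
  then show ?thesis using fin1 unfolding C_def by simp
qed

lemma achievable_le_cut:
  assumes net: "gaussian_network nV E D" and P: "\<forall>e\<in>E. P e \<ge> 0" and S: "S \<in> cuts nV D"
    and R: "achievable nV E D P R"
  shows "R \<le> (\<Sum>v\<in>cut_front nV E S. Cfun ((\<Sum>u\<in>inn E v \<inter> S. sqrt (P (u, v)))\<^sup>2))"
proof (rule ccontr)
  let ?Q = "\<lambda>v. (\<Sum>u\<in>inn E v \<inter> S. sqrt (P (u, v)))\<^sup>2"
  define c where "c = (\<Sum>v\<in>cut_front nV E S. Cfun (?Q v))"
  assume "\<not> R \<le> (\<Sum>v\<in>cut_front nV E S. Cfun (?Q v))"
  then have Rc: "R > c" by (simp add: c_def)
  have "Cfun (?Q v) \<ge> 0" for v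
  proof -
    have "log 2 1 \<le> log 2 (1 + ?Q v)" by (intro log_mono) auto
    then show ?thesis by (simp add: Cfun_def)
  qed
  then have c0: "c \<ge> 0" unfolding c_def by (intro sum_nonneg)
  \<comment> \<open>Makes \<open>(1 - \<epsilon>) * R\<close> the midpoint of \<open>c\<close> and
    \<open>R\<close>. The converse then forces \<open>(R - c) * N \<le> 2\<close>, which fails for
    large \<open>N\<close>.\<close>
  define \<epsilon> where "\<epsilon> = (R - c) / (2 * R)"
  have \<epsilon>: "\<epsilon> > 0" "\<epsilon> < 1" using Rc c0 by (auto simp: \<epsilon>_def field_simps)
  have eR: "(1 - \<epsilon>) * R = (R + c) / 2" using Rc c0 by (simp add: \<epsilon>_def field_simps)
  obtain N0 where N0: "\<And>N. N \<ge> N0 \<Longrightarrow> \<exists>M src enc dec. valid_code nV E D P N M src enc dec \<and>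
      real M \<ge> 2 powr (real N * R) \<and> error_prob nV E D N M src enc dec \<le> \<epsilon>"
    using R \<epsilon>(1) unfolding achievable_def by blast
  define N where "N = max N0 (nat \<lceil>2 / (R - c)\<rceil> + 1)"
  have Nbig: "real N > 2 / (R - c)" unfolding N_def by linarith
  obtain M src enc dec where code: "valid_code nV E D P N M src enc dec" "real M \<ge> 2 powr (real N * R)"
    "error_prob nV E D N M src enc dec \<le> \<epsilon>" using N0[of N] unfolding N_def by (meson max.cobounded1)
  have "ln (2 powr (real N * R)) \<le> ln (real M)"
    using code(2) by (intro ln_mono) (auto intro: less_le_trans[OF _ code(2)])
  then have lnM: "real N * R * ln 2 \<le> ln (real M)" by (simp add: ln_powr)
  have NR: "real N * R * ln 2 \<ge> 0" using Rc c0 by simp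
  have "(1 - \<epsilon>) * (real N * R * ln 2) \<le> (1 - error_prob nV E D N M src enc dec) * ln M"
    using code(3) lnM NR \<epsilon> by (intro mult_mono) auto
  also have "\<dots> \<le> N * (\<Sum>v\<in>cut_front nV E S. 1/2 * ln (1 + ?Q v)) + ln 2"
    by (rule cut_converse[OF net P S code(1)])
  also have "(\<Sum>v\<in>cut_front nV E S. 1/2 * ln (1 + ?Q v)) = c * ln 2"
    unfolding c_def Cfun_def log_def sum_distrib_right by (intro sum.cong refl) simp
  finally have "((1 - \<epsilon>) * R * N) * ln 2 \<le> (c * N + 1) * ln 2" by (simp add: algebra_simps)
  then have "(1 - \<epsilon>) * R * N \<le> c * N + 1" by simp
  then have "(R - c) * N \<le> 2" unfolding eR by (simp add: field_simps)
  moreover have "(R - c) * N > 2" using Nbig Rc by (simp add: field_simps)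
  ultimately show False by simp
qed

theorem theorem1:
  fixes nV :: nat and E :: "(nat \<times> nat) set" and D :: "nat set" and P :: "nat \<times> nat \<Rightarrow> real"
  assumes "gaussian_network nV E D"
    and "\<forall>e\<in>E. P e \<ge> 0"
  shows "multicast_capacity nV E D P \<le> upper_bound nV E D P
    \<and> (\<forall>R. R < lower_bound nV E D P \<longrightarrow> achievable nV E D P R)
    \<and> upper_bound nV E D P - lower_bound nV E D P
           \<le> (\<Sum>v\<in>{v \<in> nodes nV - {1}. inn E v \<noteq> {}}. log 2 (real (card (inn E v))))"
proof (intro conjI allI impI)
  show ach: "achievable nV E D P R" if "R < lower_bound nV E D P" for R
    using achievable_below_lower_bound[OF assms] achievable_negative_rate[OF assms(2)] that
    by (cases "R < 0") auto
  show "multicast_capacity nV E D P \<le> upper_bound nV E D P"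
    unfolding multicast_capacity_def
  proof (rule cSup_least)
    \<comment> \<open>The supremum of a set of reals is bounded by \<open>cSup_least\<close> only if
      the set is nonempty; a negative rate is achievable with a single message.\<close>
    have "achievable nV E D P (- 1)" by (rule achievable_negative_rate[OF assms(2)]) simp
    then show "{R. achievable nV E D P R} \<noteq> {}" by blast
    fix R assume "R \<in> {R. achievable nV E D P R}"
    then show "R \<le> upper_bound nV E D P"
      unfolding upper_bound_def using finite_cuts cuts_nonempty[OF assms(1)] achievable_le_cut[OF assms]
      by (intro Min.boundedI) auto
  qed
  show "upper_bound nV E D P - lower_bound nV E D P
           \<le> (\<Sum>v\<in>{v \<in> nodes nV - {1}. inn E v \<noteq> {}}. log 2 (real (card (inn E v))))"
    by (rule upper_bound_minus_lower_bound[OF assms])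
qed

end
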